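(* Let $\Omega\subseteq\mathbb{R}^n$ ($n\ge1$) be an open set and let $\mathcal{L}={\rm div}(A\nabla\cdot)+\mathbf{b}\cdot\nabla+c$, where $A\in D'(\Omega)^{n\times n}$, $\mathbf{b}\in D'(\Omega)^n$ and $c\in D'(\Omega)$ are real-valued. Let $P=A^s=\frac12(A+A^\perp)$, where $A^\perp$ is the transpose of $A$, and suppose that $P\in L^1_{\rm loc}(\Omega)^{n\times n}$ is a nonnegative definite matrix a.e. Let $\sigma=c-\frac12{\rm div}(\mathbf{b})$. (i) If there exists a measurable vector field $\mathbf{g}$ in $\Omega$ such that $(P\mathbf{g})\cdot\mathbf{g}\in L^1_{\rm loc}(\Omega)$ and $$\sigma\le{\rm div}(P\mathbf{g})-(P\mathbf{g})\cdot\mathbf{g}\quad\text{in } D'(\Omega),\qquad( * )$$ then the operator $-\mathcal{L}$ is nonnegative definite. (ii) Conversely, if $-\mathcal{L}$ is nonnegative definite, then there exists a vector field $\mathbf{g}\in L^2_{\rm loc}(\Omega)^n$ such that $(P\mathbf{g})\cdot\mathbf{g}\in L^1_{\rm loc}(\Omega)$ and $( * )$ holds, provided $P$ is uniformly elliptic.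
   Context: $D'(\Omega)$ denotes the distributions on $\Omega$. The form of $\mathcal{L}$ is $\langle\mathcal{L}u,v\rangle=-\langle A\nabla u,\nabla v\rangle+\langle\mathbf{b}\cdot\nabla u,v\rangle+\langle cu,v\rangle$ with distributional pairings, i.e. for real-valued $u,v\in C_0^\infty(\Omega)$: $\langle A\nabla u,\nabla v\rangle=\sum_{j,k}a_{jk}(\partial_k u\,\partial_j v)$, $\langle\mathbf{b}\cdot\nabla u,v\rangle=\sum_j b_j(v\,\partial_j u)$, $\langle cu,v\rangle=c(uv)$ (each distribution being applied to the test function in parentheses). The operator $-\mathcal{L}$ is nonnegative definite if $\langle-\mathcal{L}h,h\rangle\ge0$ for all real-valued $h\in C_0^\infty(\Omega)$. Vector fields $\mathbf{g}$ are $\mathbb{R}^n$-valued. An inequality $S\le T$ in $D'(\Omega)$ means $(T-S)(\varphi)\ge0$ for every nonnegative $\varphi\in C_0^\infty(\Omega)$. (Since $P\in L^1_{\rm loc}$ is nonnegative definite a.e. and $(P\mathbf{g})\cdot\mathbf{g}\in L^1_{\rm loc}$, one has $P\mathbf{g}\in L^1_{\rm loc}(\Omega)^n$, so ${\rm div}(P\mathbf{g})$ is a well-defined distribution.) $P$ is uniformly elliptic if there are constants $m>0$ and $M<\infty$ such that $m|\xi|^2\le P(x)\xi\cdot\xi\le M|\xi|^2$ for all $\xi\in\mathbb{R}^n$ and a.e. $x\in\Omega$. *)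

theory Defs
  imports "HOL-Analysis.Analysis"
begin

section \<open>Test functions\<close>

definition partial_deriv :: "'n \<Rightarrow> (real^'n \<Rightarrow> real) \<Rightarrow> real^'n \<Rightarrow> real" where
  "partial_deriv i f x = frechet_derivative f (at x) (axis i 1)"

definition iterated_partial :: "'n list \<Rightarrow> (real^'n \<Rightarrow> real) \<Rightarrow> real^'n \<Rightarrow> real" where
  "iterated_partial is f = foldr partial_deriv is f"

definition smooth :: "(real^'n \<Rightarrow> real) \<Rightarrow> bool" where
  "smooth f \<longleftrightarrow> (\<forall>is x. iterated_partial is f differentiable (at x))"

definition support :: "(real^'n \<Rightarrow> real) \<Rightarrow> (real^'n) set" where
  "support f = closure {x. f x \<noteq> 0}"

text \<open>Elements of \<open>C\<^sub>0\<^sup>\<infinity>(\<Omega>)\<close> are extended by zero to the whole space.\<close>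

definition test_functions :: "(real^'n) set \<Rightarrow> (real^'n \<Rightarrow> real) set" where
  "test_functions \<Omega> = {\<phi>. smooth \<phi> \<and> compact (support \<phi>) \<and> support \<phi> \<subseteq> \<Omega>}"

section \<open>Real-valued distributions\<close>

text \<open>
  A real-valued distribution is determined by its values on real-valued test functions.
  It is represented by a functional on all functions, of which only the values on
  \<open>test_functions \<Omega>\<close> matter. Continuity is the usual seminorm estimate on each
  compact subset; summing over lists of indices instead of multi-indices only repeats mixed
  partial derivatives.
\<close>

type_synonym 'n distr = "((real, 'n) vec \<Rightarrow> real) \<Rightarrow> real"

definition distribution :: "(real^'n) set \<Rightarrow> 'n distr \<Rightarrow> bool" where
  "distribution \<Omega> T \<longleftrightarrow>
     (\<forall>\<phi>\<in>test_functions \<Omega>. \<forall>\<psi>\<in>test_functions \<Omega>. T (\<lambda>x. \<phi> x + \<psi> x) = T \<phi> + T \<psi>) \<and>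
     (\<forall>r. \<forall>\<phi>\<in>test_functions \<Omega>. T (\<lambda>x. r * \<phi> x) = r * T \<phi>) \<and>
     (\<forall>K. compact K \<and> K \<subseteq> \<Omega> \<longrightarrow>
        (\<exists>C N. \<forall>\<phi>\<in>test_functions \<Omega>. support \<phi> \<subseteq> K \<longrightarrow>
           \<bar>T \<phi>\<bar> \<le> C * (\<Sum>is\<in>{is. length is \<le> N}. SUP x. \<bar>iterated_partial is \<phi> x\<bar>)))"

definition distr_le :: "(real^'n) set \<Rightarrow> 'n distr \<Rightarrow> 'n distr \<Rightarrow> bool" where
  "distr_le \<Omega> S T \<longleftrightarrow> (\<forall>\<phi>\<in>test_functions \<Omega>. (\<forall>x. 0 \<le> \<phi> x) \<longrightarrow> 0 \<le> T \<phi> - S \<phi>)"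

definition div_distr :: "'n distr ^ 'n \<Rightarrow> 'n distr" where
  "div_distr b \<phi> = - (\<Sum>j\<in>UNIV. (b $ j) (partial_deriv j \<phi>))"

section \<open>Locally integrable functions\<close>

definition L1_loc :: "(real^'n) set \<Rightarrow> (real^'n \<Rightarrow> 'b::euclidean_space) set" where
  "L1_loc \<Omega> = {f. \<forall>K. compact K \<and> K \<subseteq> \<Omega> \<longrightarrow> f absolutely_integrable_on K}"

definition L2_loc :: "(real^'n) set \<Rightarrow> (real^'n \<Rightarrow> 'b::euclidean_space) set" where
  "L2_loc \<Omega> = {f. f \<in> borel_measurable (lebesgue_on \<Omega>) \<and> (\<lambda>x. (norm (f x))\<^sup>2) \<in> L1_loc \<Omega>}"

definition regular_distr :: "(real^'n) set \<Rightarrow> (real^'n \<Rightarrow> real) \<Rightarrow> 'n distr" where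
  "regular_distr \<Omega> f \<phi> = (LINT x:\<Omega>|lebesgue. f x * \<phi> x)"

definition regular_distr_vec :: "(real^'n) set \<Rightarrow> (real^'n \<Rightarrow> real^'n) \<Rightarrow> 'n distr ^ 'n" where
  "regular_distr_vec \<Omega> F = (\<chi> j. regular_distr \<Omega> (\<lambda>x. F x $ j))"

section \<open>The operator\<close>

definition sym_part :: "'n distr ^ 'n ^ 'n \<Rightarrow> 'n distr ^ 'n ^ 'n" where
  "sym_part A = (\<chi> j k. (\<lambda>\<phi>. 1/2 * ((A $ j $ k) \<phi> + (transpose A $ j $ k) \<phi>)))"

text \<open>\<open>P\<close> is (a representative of) an \<open>L\<^sup>1\<^sub>l\<^sub>o\<^sub>c(\<Omega>)\<close> matrix function that equals
  the matrix distribution \<open>T\<close>.\<close>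

definition L1_loc_density ::
    "(real^'n) set \<Rightarrow> 'n distr ^ 'n ^ 'n \<Rightarrow> (real^'n \<Rightarrow> real^'n^'n) \<Rightarrow> bool" where
  "L1_loc_density \<Omega> T P \<longleftrightarrow> P \<in> L1_loc \<Omega> \<and>
     (\<forall>j k. \<forall>\<phi>\<in>test_functions \<Omega>. (T $ j $ k) \<phi> = regular_distr \<Omega> (\<lambda>x. P x $ j $ k) \<phi>)"

definition ae_nonneg_definite :: "(real^'n) set \<Rightarrow> (real^'n \<Rightarrow> real^'n^'n) \<Rightarrow> bool" where
  "ae_nonneg_definite \<Omega> P \<longleftrightarrow> (AE x in lebesgue_on \<Omega>. \<forall>\<xi>. 0 \<le> (P x *v \<xi>) \<bullet> \<xi>)"

definition uniformly_elliptic :: "(real^'n) set \<Rightarrow> (real^'n \<Rightarrow> real^'n^'n) \<Rightarrow> bool" where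
  "uniformly_elliptic \<Omega> P \<longleftrightarrow> (\<exists>m>0. \<exists>M. AE x in lebesgue_on \<Omega>. \<forall>\<xi>.
     m * (norm \<xi>)\<^sup>2 \<le> (P x *v \<xi>) \<bullet> \<xi> \<and> (P x *v \<xi>) \<bullet> \<xi> \<le> M * (norm \<xi>)\<^sup>2)"

text \<open>The pairing \<open>\<langle>\<L>u, v\<rangle>\<close> for \<open>\<L> = div(A\<nabla>\<cdot>) + b\<cdot>\<nabla> + c\<close>.\<close>

definition L_form :: "'n distr ^ 'n ^ 'n \<Rightarrow> 'n distr ^ 'n \<Rightarrow> 'n distr \<Rightarrow>
    (real^'n \<Rightarrow> real) \<Rightarrow> (real^'n \<Rightarrow> real) \<Rightarrow> real" where
  "L_form A b c u v =
     - (\<Sum>j\<in>UNIV. \<Sum>k\<in>UNIV. (A $ j $ k) (\<lambda>x. partial_deriv k u x * partial_deriv j v x))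
     + (\<Sum>j\<in>UNIV. (b $ j) (\<lambda>x. v x * partial_deriv j u x))
     + c (\<lambda>x. u x * v x)"

definition minus_L_nonneg_definite ::
    "(real^'n) set \<Rightarrow> 'n distr ^ 'n ^ 'n \<Rightarrow> 'n distr ^ 'n \<Rightarrow> 'n distr \<Rightarrow> bool" where
  "minus_L_nonneg_definite \<Omega> A b c \<longleftrightarrow> (\<forall>h\<in>test_functions \<Omega>. 0 \<le> - L_form A b c h h)"

end

theory Submission
  imports Defs
begin

text \<open>
  On the diagonal the antisymmetric part of \<open>A\<close> drops out, and \<open>h \<nabla>h = \<nabla>(h\<^sup>2)/2\<close> moves the derivatives onto \<open>b\<close>, so
  \<open>\<langle>-\<L>h, h\<rangle> = \<integral> P\<nabla>h\<sqdot>\<nabla>h - \<sigma>(h\<^sup>2)\<close> (\<open>L_form_diagonal\<close>), and nonnegativity means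
  \<open>\<sigma>(h\<^sup>2) \<le> \<integral> P\<nabla>h\<sqdot>\<nabla>h\<close> for every test function \<open>h\<close>. If \<open>g\<close> satisfies the Riccati inequality, test
  it with \<open>h\<^sup>2\<close> and complete the square: \<open>\<integral> P\<nabla>h\<sqdot>\<nabla>h - \<sigma>(h\<^sup>2)\<close> is at least
  \<open>\<integral> P(\<nabla>h + h g)\<sqdot>(\<nabla>h + h g) \<ge> 0\<close>. Only the symmetry of \<open>P\<close> needs an argument here: the entries agree as
  distributions, and the fundamental lemma of the calculus of variations makes them agree almost
  everywhere.

  For the converse no differential equation is solved. Put
  \<open>F(g, \<phi>) = \<sigma>(\<phi>) + \<integral> Pg\<sqdot>\<nabla>\<phi> + \<integral> \<phi> Pg\<sqdot>g\<close>. The inequality asks for one \<open>g\<close> with \<open>F(g, \<phi>) \<le> 0\<close> for all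
  test functions \<open>\<phi> \<ge> 0\<close>. The functional is linear in \<open>\<phi>\<close> and convex in \<open>g\<close>, so this is a minimax problem.
  For a single \<open>\<phi>\<close> the infimum over \<open>g\<close> is formally attained at \<open>g = -\<nabla>\<phi>/(2\<phi>)\<close>, where \<open>F\<close> equals
  \<open>\<sigma>(h\<^sup>2) - \<integral> P\<nabla>h\<sqdot>\<nabla>h\<close> with \<open>h = \<surd>\<phi>\<close>, which is nonpositive by assumption. Since \<open>\<surd>\<phi>\<close> need not be
  smooth, \<open>riccati_single_test\<close> perturbs \<open>\<phi>\<close> to \<open>\<phi> + \<delta>\<eta>\<^sup>2\<close> with a cutoff \<open>\<eta>\<close> that equals 1 near the support of
  \<open>\<phi>\<close>; this function does have a smooth square root.

  A theorem of the alternative for convexlike functions (\<open>convexlike_alternative\<close>) passes from one test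
  function to finitely many, up to an error \<open>\<epsilon>\<close>. To reach all of them, note that \<open>F(g, \<eta>\<^sup>2) \<le> 1\<close> bounds
  \<open>\<integral> \<bar>g\<bar>\<^sup>2\<close> on every set where \<open>\<eta> = 1\<close> (\<open>L2_bound_from_riccati\<close>). Hence the convex sets
  \<open>{g. F(g, \<phi>) \<le> \<epsilon>}\<close> have the finite intersection property inside a fixed ball of a weighted \<open>L\<^sup>2\<close> space.
  Instead of weak compactness, elements of almost minimal norm are taken in more and more of these sets: by
  the parallelogram law they form a Cauchy sequence, and its limit is also a limit of elements of each of
  the sets (\<open>minimal_norm_sequence\<close>). The convexity of \<open>F\<close> in \<open>g\<close> gives lower semicontinuity, so the limit is
  the required field (\<open>riccati_field_exists\<close>).
\<close>

section \<open>Closure properties of smooth functions\<close>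

text \<open>The innermost derivative is peeled off first, so that sums, products and compositions can be treated by
  induction on the order, with the functions generalized.\<close>

primrec differentiable_upto :: "nat \<Rightarrow> (real^'n \<Rightarrow> real) \<Rightarrow> bool" where
  "differentiable_upto 0 f \<longleftrightarrow> True"
| "differentiable_upto (Suc k) f \<longleftrightarrow>
     (\<forall>x. f differentiable (at x)) \<and> (\<forall>i. differentiable_upto k (partial_deriv i f))"

lemma differentiable_upto_iff:
  fixes f :: "real^'n \<Rightarrow> real"
  shows "differentiable_upto k f \<longleftrightarrow>
     (\<forall>is x. length is < k \<longrightarrow> iterated_partial is f differentiable (at x))"
proof (induction k arbitrary: f)
  case (Suc k)
  have snoc: "iterated_partial (js @ [i]) f = iterated_partial js (partial_deriv i f)" for js i
    by (simp add: iterated_partial_def)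
  have nil: "iterated_partial [] f = f"
    by (simp add: iterated_partial_def)
  show ?case
  proof
    assume *: "differentiable_upto (Suc k) f"
    show "\<forall>is x. length is < Suc k \<longrightarrow> iterated_partial is f differentiable (at x)"
    proof (intro allI impI)
      fix "is" :: "'n list" and x assume "length is < Suc k"
      then show "iterated_partial is f differentiable (at x)"
        using * Suc.IH by (cases "is" rule: rev_cases) (auto simp: snoc nil)
    qed
  next
    assume *: "\<forall>is x. length is < Suc k \<longrightarrow> iterated_partial is f differentiable (at x)"
    have "f differentiable (at x)" for x
      using *[rule_format, of "[]" x] by (simp add: nil)
    moreover have "differentiable_upto k (partial_deriv i f)" for i
      unfolding Suc.IH using * by (auto simp flip: snoc)
    ultimately show "differentiable_upto (Suc k) f" by simp
  qed
qed simp

lemma smooth_iff_differentiable_upto: "smooth f \<longleftrightarrow> (\<forall>k. differentiable_upto k f)"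
  unfolding smooth_def differentiable_upto_iff by blast

lemma differentiable_upto_Suc_imp: "differentiable_upto (Suc k) f \<Longrightarrow> differentiable_upto k f"
  by (auto simp: differentiable_upto_iff)

lemma smooth_imp_differentiable: "smooth f \<Longrightarrow> f differentiable (at x)"
  unfolding smooth_iff_differentiable_upto using differentiable_upto.simps(2) by blast

lemma smooth_imp_continuous: "smooth f \<Longrightarrow> continuous_on S f"
  by (meson smooth_imp_differentiable continuous_at_imp_continuous_on differentiable_imp_continuous_within)

lemma smooth_partial_deriv: "smooth f \<Longrightarrow> smooth (partial_deriv i f)"
  unfolding smooth_iff_differentiable_upto using differentiable_upto.simps(2) by blast

lemma partial_deriv_eqI:
  "(f has_derivative f') (at x) \<Longrightarrow> partial_deriv i f x = f' (axis i 1)"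
  unfolding partial_deriv_def using frechet_derivative_at by metis

lemma has_derivative_frechet:
  "f differentiable (at x) \<Longrightarrow> (f has_derivative frechet_derivative f (at x)) (at x)"
  by (simp add: frechet_derivative_works)

lemma partial_deriv_const: "partial_deriv i (\<lambda>x. c) = (\<lambda>x. 0)"
  by (rule ext, rule partial_deriv_eqI[where f' = "\<lambda>h. 0", simplified]) simp

lemma partial_deriv_component: "partial_deriv i (\<lambda>x. x $ j) = (\<lambda>x. axis i 1 $ j)"
  by (intro ext partial_deriv_eqI bounded_linear_imp_has_derivative bounded_linear_vec_nth)

lemma partial_deriv_add:
  assumes "f differentiable (at x)" "g differentiable (at x)"
  shows "partial_deriv i (\<lambda>x. f x + g x) x = partial_deriv i f x + partial_deriv i g x"
  using partial_deriv_eqI[OF has_derivative_add[OF assms[THEN has_derivative_frechet]]]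
  by (simp add: partial_deriv_def)

lemma partial_deriv_mult:
  assumes "f differentiable (at x)" "g differentiable (at x)"
  shows "partial_deriv i (\<lambda>x. f x * g x) x = partial_deriv i f x * g x + f x * partial_deriv i g x"
  using partial_deriv_eqI[OF has_derivative_mult[OF assms[THEN has_derivative_frechet]]]
  by (simp add: partial_deriv_def algebra_simps)

lemma partial_deriv_compose:
  assumes "f differentiable (at x)" "(d has_real_derivative d') (at (f x))"
  shows "partial_deriv i (\<lambda>x. d (f x)) x = d' * partial_deriv i f x"
proof -
  have "((\<lambda>x. d (f x)) has_derivative (\<lambda>h. d' * frechet_derivative f (at x) h)) (at x)"
    using has_derivative_compose[OF has_derivative_frechet[OF assms(1)]
        assms(2)[unfolded has_field_derivative_def]] by simp
  from partial_deriv_eqI[OF this] show ?thesis by (simp add: partial_deriv_def)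
qed

lemma differentiable_upto_add:
  "differentiable_upto k f \<Longrightarrow> differentiable_upto k g \<Longrightarrow> differentiable_upto k (\<lambda>x. f x + g x)"
proof (induction k arbitrary: f g)
  case (Suc k)
  have "partial_deriv i (\<lambda>x. f x + g x) = (\<lambda>x. partial_deriv i f x + partial_deriv i g x)" for i
    using Suc.prems by (auto simp: partial_deriv_add)
  with Suc show ?case by (auto intro: differentiable_add)
qed simp

lemma differentiable_upto_mult:
  "differentiable_upto k f \<Longrightarrow> differentiable_upto k g \<Longrightarrow> differentiable_upto k (\<lambda>x. f x * g x)"
proof (induction k arbitrary: f g)
  case (Suc k)
  have "partial_deriv i (\<lambda>x. f x * g x)
      = (\<lambda>x. partial_deriv i f x * g x + f x * partial_deriv i g x)" for i
    using Suc.prems by (auto simp: partial_deriv_mult)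
  moreover have "differentiable_upto k f" "differentiable_upto k g"
    using Suc.prems[THEN differentiable_upto_Suc_imp] by auto
  ultimately show ?case using Suc
    by (auto intro!: differentiable_mult differentiable_upto_add)
qed simp

lemma differentiable_upto_compose:
  assumes D: "\<And>n t. t \<in> U \<Longrightarrow> (D n has_real_derivative D (Suc n) t) (at t)"
    and U: "\<And>x. f x \<in> U"
  shows "differentiable_upto k f \<Longrightarrow> differentiable_upto k (\<lambda>x. D n (f x))"
proof (induction k arbitrary: n)
  case (Suc k)
  have "partial_deriv i (\<lambda>x. D n (f x)) = (\<lambda>x. D (Suc n) (f x) * partial_deriv i f x)" for i
    using Suc.prems D[OF U] by (auto intro!: partial_deriv_compose)
  moreover have "(\<lambda>x. D n (f x)) differentiable (at x)" for x
    using Suc.prems D[OF U[of x], of n]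
    by (intro differentiable_compose[of "D n" f]) (auto simp: differentiable_def has_field_derivative_def)
  ultimately show ?case
    using Suc.prems Suc.IH[OF differentiable_upto_Suc_imp[OF Suc.prems]]
    by (auto intro!: differentiable_upto_mult)
qed simp

lemma differentiable_upto_const: "differentiable_upto k (\<lambda>x. c)"
  by (induction k arbitrary: c) (auto simp: partial_deriv_const)

lemma smooth_const: "smooth (\<lambda>x. c)"
  by (simp add: smooth_iff_differentiable_upto differentiable_upto_const)

lemma smooth_component: "smooth (\<lambda>x :: real^'n. x $ j)"
proof -
  have "differentiable_upto k (\<lambda>x :: real^'n. x $ j)" for k
  proof (cases k)
    case (Suc l)
    have "(\<lambda>x. x $ j) differentiable (at x)" for x :: "real^'n"
      by (simp add: bounded_linear_imp_differentiable bounded_linear_vec_nth)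
    then show ?thesis by (simp add: Suc partial_deriv_component differentiable_upto_const)
  qed simp
  then show ?thesis by (simp add: smooth_iff_differentiable_upto)
qed

lemma smooth_add: "smooth f \<Longrightarrow> smooth g \<Longrightarrow> smooth (\<lambda>x. f x + g x)"
  by (simp add: smooth_iff_differentiable_upto differentiable_upto_add)

lemma smooth_mult: "smooth f \<Longrightarrow> smooth g \<Longrightarrow> smooth (\<lambda>x. f x * g x)"
  by (simp add: smooth_iff_differentiable_upto differentiable_upto_mult)

text \<open>The sequence \<open>D\<close> lists the successive derivatives of the outer function. By the chain rule, a derivative of
  \<open>D n \<circ> f\<close> is a product of \<open>D (Suc n) \<circ> f\<close> with a derivative of \<open>f\<close>, so the induction must carry all \<open>n\<close>.\<close>

lemma smooth_compose:
  assumes "smooth f" "\<And>n t. t \<in> U \<Longrightarrow> (D n has_real_derivative D (Suc n) t) (at t)" "\<And>x. f x \<in> U"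
  shows "smooth (\<lambda>x. D n (f x))"
  using assms differentiable_upto_compose[of U D f]
  by (simp add: smooth_iff_differentiable_upto)

lemma smooth_diff:
  assumes "smooth f" "smooth g" shows "smooth (\<lambda>x. f x - g x)"
  using smooth_add[OF assms(1) smooth_mult[OF smooth_const[of "-1"] assms(2)]] by simp

lemma smooth_sum: "(\<And>i. i \<in> I \<Longrightarrow> smooth (f i)) \<Longrightarrow> smooth (\<lambda>x. \<Sum>i\<in>I. f i x)"
  by (induction I rule: infinite_finite_induct) (simp_all add: smooth_const smooth_add)

text \<open>The exponents \<open>1/2\<close> and \<open>-1\<close> give square roots and reciprocals.\<close>

lemma smooth_powr:
  assumes "smooth f" "\<And>x. 0 < f x"
  shows "smooth (\<lambda>x. f x powr a)"
proof -
  define D where "D n t = (\<Prod>i<n. a - real i) * t powr (a - real n)" for n t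
  have "(D n has_real_derivative D (Suc n) t) (at t)" if "t \<in> {0<..}" for n t
  proof -
    have "((\<lambda>t. t powr (a - real n)) has_real_derivative
        (a - real n) * t powr (a - real n - 1)) (at t)"
      using that by (intro has_real_derivative_powr) auto
    from DERIV_cmult[OF this, of "\<Prod>i<n. a - real i"] show ?thesis
      by (simp add: D_def[abs_def] diff_diff_eq ac_simps)
  qed
  from smooth_compose[of f "{0<..}" D, OF assms(1) this, of 0] assms(2) show ?thesis
    by (simp add: D_def)
qed

lemma partial_deriv_power2:
  assumes "smooth f"
  shows "partial_deriv i (\<lambda>x. (f x)\<^sup>2) = (\<lambda>x. 2 * (f x * partial_deriv i f x))"
  unfolding power2_eq_square using assms
  by (auto simp: partial_deriv_mult smooth_imp_differentiable)

section \<open>Cutoff functions\<close>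

text \<open>The standard smooth function that is flat at the origin, the source of all bump functions below.\<close>

definition flat_exp :: "real \<Rightarrow> real" where
  "flat_exp t = (if 0 < t then exp (- 1 / t) else 0)"

lemma poly_times_exp_minus_tendsto_0:
  fixes p :: "real poly"
  shows "((\<lambda>s. s ^ k * poly p s * exp (- s)) \<longlongrightarrow> 0) at_top"
proof (induction p arbitrary: k)
  case (pCons a p)
  have "((\<lambda>s. a * (s ^ k / exp s) + s ^ Suc k * poly p s * exp (- s)) \<longlongrightarrow> a * 0 + 0) at_top"
    by (intro tendsto_intros tendsto_power_div_exp_0 pCons.IH)
  moreover have "s ^ k * poly (pCons a p) s * exp (- s)
      = a * (s ^ k / exp s) + s ^ Suc k * poly p s * exp (- s)" for s
    by (simp add: exp_minus divide_inverse ring_distribs)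
  ultimately show ?case by simp
qed simp

text \<open>Every derivative has the form \<open>p(1/t) exp(-1/t)\<close> with a polynomial \<open>p\<close>, continued by 0; at the origin the
  exponential decay beats the polynomial growth of \<open>p(1/t)/t\<close>.\<close>

lemma flat_exp_derivatives:
  obtains D where "D 0 = flat_exp" "\<And>n t. (D n has_real_derivative D (Suc n) t) (at t)"
proof -
  define p :: "nat \<Rightarrow> real poly" where
    "p = rec_nat 1 (\<lambda>_ q. [:0, 0, 1:] * (q - pderiv q))"
  have p: "p 0 = 1" "p (Suc n) = [:0, 0, 1:] * (p n - pderiv (p n))" for n
    by (simp_all add: p_def)
  define D where "D n t = (if 0 < t then poly (p n) (1 / t) * exp (- 1 / t) else 0)" for n t
  have "(D n has_real_derivative D (Suc n) t) (at t)" for n t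
  proof -
    consider "0 < t" | "t < 0" | "t = 0" by linarith
    then show ?thesis
    proof cases
      case 1
      have "((\<lambda>t. poly (p n) (1 / t) * exp (- 1 / t)) has_real_derivative D (Suc n) t) (at t)"
        using 1 by (auto intro!: derivative_eq_intros simp: D_def p field_simps power2_eq_square)
      moreover have "\<forall>\<^sub>F x in nhds t. x \<in> {0<..}"
        using 1 by (intro eventually_nhds_in_open) auto
      then have "\<forall>\<^sub>F x in nhds t. D n x = poly (p n) (1 / x) * exp (- 1 / x)"
        by eventually_elim (simp add: D_def)
      ultimately show ?thesis
        using DERIV_cong_ev[of t t "D n" "\<lambda>t. poly (p n) (1 / t) * exp (- 1 / t)"] by blast
    next
      case 2
      have "\<forall>\<^sub>F x in nhds t. x \<in> {..<0}"
        using 2 by (intro eventually_nhds_in_open) auto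
      then have "\<forall>\<^sub>F x in nhds t. D n x = 0"
        by eventually_elim (simp add: D_def)
      then show ?thesis
        using DERIV_cong_ev[of t t "D n" "\<lambda>t. 0"] 2 by (simp add: D_def)
    next
      case 3
      have "((\<lambda>h. (1 / h) ^ 1 * poly (p n) (1 / h) * exp (- (1 / h))) \<longlongrightarrow> 0) (at_right 0)"
        using filterlim_compose[OF poly_times_exp_minus_tendsto_0[of 1 "p n"] filterlim_inverse_at_top_right]
        by (simp add: inverse_eq_divide)
      then have r: "((\<lambda>h. (D n (0 + h) - D n 0) / h) \<longlongrightarrow> 0) (at_right 0)"
        by (rule Lim_transform_eventually)
           (use eventually_at_right_less[of 0] in eventually_elim, auto simp: D_def)
      have l: "((\<lambda>h. (D n (0 + h) - D n 0) / h) \<longlongrightarrow> 0) (at_left 0)"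
        by (rule Lim_transform_eventually[of "\<lambda>_. 0"])
           (auto simp: D_def eventually_at_filter)
      show ?thesis
        using l r filterlim_split_at[OF l r] 3 by (simp add: DERIV_def D_def)
    qed
  qed
  moreover have "D 0 = flat_exp" by (auto simp: D_def p flat_exp_def)
  ultimately show ?thesis using that by blast
qed

lemma smooth_flat_exp: "smooth f \<Longrightarrow> smooth (\<lambda>x. flat_exp (f x))"
  by (rule flat_exp_derivatives) (metis UNIV_I smooth_compose)

text \<open>The support is a closure; it suffices to know that the function vanishes off some compact subset of the
  domain.\<close>

lemma test_functionsI:
  assumes "smooth f" "compact K" "K \<subseteq> \<Omega>" "\<And>x. x \<notin> K \<Longrightarrow> f x = 0"
  shows "f \<in> test_functions \<Omega>"
proof -
  have "support f \<subseteq> K"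
    unfolding support_def using assms by (intro closure_minimal compact_imp_closed) auto
  then show ?thesis using assms unfolding test_functions_def
    by (auto simp: support_def compact_closure intro: bounded_subset[OF compact_imp_bounded])
qed

lemma test_functionsE:
  assumes "f \<in> test_functions \<Omega>"
  obtains "smooth f" "compact (support f)" "support f \<subseteq> \<Omega>" "\<And>x. x \<notin> support f \<Longrightarrow> f x = 0"
    "\<And>x i. x \<notin> support f \<Longrightarrow> partial_deriv i f x = 0"
proof -
  have 0: "f x = 0" if "x \<notin> support f" for x
    using that closure_subset[of "{x. f x \<noteq> 0}"] by (auto simp: support_def)
  have "partial_deriv i f x = 0" if "x \<notin> support f" for x i
  proof -
    have "open (- support f)" unfolding support_def by (intro open_Compl closed_closure)
    then have "(f has_derivative (\<lambda>h. 0)) (at x)"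
      using has_derivative_transform_within_open[of "\<lambda>x. 0" "\<lambda>h. 0" x UNIV "- support f" f] 0 that
      by auto
    from partial_deriv_eqI[OF this] show ?thesis by simp
  qed
  then show ?thesis using that 0 assms by (auto simp: test_functions_def)
qed

lemma test_functions_add:
  assumes "f \<in> test_functions \<Omega>" "g \<in> test_functions \<Omega>"
  shows "(\<lambda>x. f x + g x) \<in> test_functions \<Omega>"
  by (rule test_functionsE[OF assms(1)], rule test_functionsE[OF assms(2)],
      rule test_functionsI[of _ "support f \<union> support g"]) (auto intro: smooth_add)

lemma test_functions_mult:
  assumes "f \<in> test_functions \<Omega>" "smooth g"
  shows "(\<lambda>x. f x * g x) \<in> test_functions \<Omega>" "(\<lambda>x. g x * f x) \<in> test_functions \<Omega>"
  by (rule test_functionsE[OF assms(1)], rule test_functionsI[of _ "support f"],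
      auto intro: smooth_mult assms)+

lemma test_functions_smooth: "f \<in> test_functions \<Omega> \<Longrightarrow> smooth f"
  by (simp add: test_functions_def)

lemma test_functions_scale: "f \<in> test_functions \<Omega> \<Longrightarrow> (\<lambda>x. r * f x) \<in> test_functions \<Omega>"
  by (rule test_functions_mult(2)[OF _ smooth_const])

lemma test_functions_zero: "(\<lambda>x. 0) \<in> test_functions \<Omega>"
  by (rule test_functionsI[of _ "{}"]) (auto simp: smooth_const)

lemma test_functions_partial_deriv:
  assumes "f \<in> test_functions \<Omega>" shows "partial_deriv i f \<in> test_functions \<Omega>"
  by (rule test_functionsE[OF assms], rule test_functionsI[of _ "support f"])
     (auto intro: smooth_partial_deriv)

lemma test_functions_power2:
  "f \<in> test_functions \<Omega> \<Longrightarrow> (\<lambda>x. (f x)\<^sup>2) \<in> test_functions \<Omega>"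
  unfolding power2_eq_square by (intro test_functions_mult test_functions_smooth)

lemma test_functions_bounded:
  assumes "f \<in> test_functions \<Omega>"
  obtains C where "0 \<le> C" "\<And>x. \<bar>f x\<bar> \<le> C"
proof -
  from assms show ?thesis
  proof (rule test_functionsE)
    assume "compact (support f)" "smooth f" and 0: "\<And>x. x \<notin> support f \<Longrightarrow> f x = 0"
    then have "compact (f ` support f)"
      by (intro compact_continuous_image smooth_imp_continuous)
    then obtain C where "\<And>x. x \<in> support f \<Longrightarrow> \<bar>f x\<bar> \<le> C" "0 < C"
      unfolding bounded_pos by (metis bounded_pos compact_imp_bounded imageI real_norm_def)
    then show ?thesis using that[of C] 0 by (metis abs_zero less_imp_le)
  qed
qed

text \<open>A finite sum \<open>\<rho>\<close> of bumps on balls covering \<open>K\<close> is positive on \<open>K\<close>, hence larger than some \<open>c > 0\<close> there. Composing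
  \<open>\<rho>\<close> with a smooth step that rises from 0 at the origin to 1 at \<open>c\<close> yields a cutoff equal to 1 on
  the open set \<open>{\<rho> > c}\<close>, and not just on \<open>K\<close>: this makes its gradient vanish near \<open>K\<close>.\<close>

lemma cutoff_function_exists:
  fixes K :: "(real^'n) set"
  assumes "open \<Omega>" "compact K" "K \<subseteq> \<Omega>"
  obtains \<eta> U where "\<eta> \<in> test_functions \<Omega>" "open U" "K \<subseteq> U" "\<And>x. x \<in> U \<Longrightarrow> \<eta> x = 1"
    "\<And>x. 0 \<le> \<eta> x" "\<And>x. \<eta> x \<le> 1"
proof -
  have "\<forall>x\<in>K. \<exists>r>0. cball x r \<subseteq> \<Omega>"
    using assms open_contains_cball by blast
  then obtain r where r: "\<And>x. x \<in> K \<Longrightarrow> 0 < r x" "\<And>x. x \<in> K \<Longrightarrow> cball x (r x) \<subseteq> \<Omega>"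
    by metis
  then obtain C where C: "C \<subseteq> K" "finite C" "K \<subseteq> (\<Union>x\<in>C. ball x (r x))"
    using compactE_image[OF assms(2), of K "\<lambda>x. ball x (r x)"] by force
  define \<rho> where "\<rho> y = (\<Sum>x\<in>C. flat_exp ((r x)\<^sup>2 - (\<Sum>i\<in>UNIV. (y $ i - x $ i)\<^sup>2)))" for y
  define L where "L = (\<Union>x\<in>C. cball x (r x))"
  have "compact L" unfolding L_def using C(2) by (intro compact_UN) auto
  moreover have "L \<subseteq> \<Omega>" unfolding L_def using C(1) r(2) by blast
  ultimately have L: "compact L" "L \<subseteq> \<Omega>" .
  have "smooth (\<lambda>y. flat_exp ((r x)\<^sup>2 - (\<Sum>i\<in>UNIV. (y $ i - x $ i)\<^sup>2)))" for x
    unfolding power2_eq_square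
    by (intro smooth_flat_exp smooth_diff smooth_sum smooth_mult smooth_const smooth_component)
  then have \<rho>_smooth: "smooth \<rho>"
    unfolding \<rho>_def by (intro smooth_sum)
  have fe: "0 \<le> flat_exp t" "0 < flat_exp t \<longleftrightarrow> 0 < t" "flat_exp t = 0 \<longleftrightarrow> t \<le> 0" for t
    by (auto simp: flat_exp_def)
  have dist: "(\<Sum>i\<in>UNIV. (y $ i - x $ i)\<^sup>2) = (dist x y)\<^sup>2" for x y :: "real^'n"
    by (simp add: dist_vec_def L2_set_def sum_nonneg dist_real_def power2_commute)
  have pos: "0 < (r x)\<^sup>2 - (dist x y)\<^sup>2 \<longleftrightarrow> y \<in> ball x (r x)" if "x \<in> C" for x y
    using r(1)[of x] that C power_mono_iff[of "r x" "dist x y" 2]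
    by (auto simp flip: not_le)
  have \<rho>_nonneg: "0 \<le> \<rho> y" for y unfolding \<rho>_def by (intro sum_nonneg fe)
  have \<rho>_0: "\<rho> y = 0" if "y \<notin> L" for y
    unfolding \<rho>_def dist using that pos fe(3)
    by (intro sum.neutral ballI) (force simp: L_def not_less)
  have \<rho>_pos: "0 < \<rho> y" if y: "y \<in> K" for y
  proof -
    obtain x where x: "x \<in> C" "y \<in> ball x (r x)" using y C by blast
    then have "0 < flat_exp ((r x)\<^sup>2 - (dist x y)\<^sup>2)"
      by (simp only: fe(2) pos)
    then show ?thesis unfolding \<rho>_def dist
      by (intro sum_pos2[of _ x] fe x C)
  qed
  obtain c where c: "0 < c" "\<And>y. y \<in> K \<Longrightarrow> c < \<rho> y"
  proof (cases "K = {}")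
    case False
    then obtain y0 where "y0 \<in> K" "\<And>y. y \<in> K \<Longrightarrow> \<rho> y0 \<le> \<rho> y"
      using continuous_attains_inf[OF assms(2) _ smooth_imp_continuous[OF \<rho>_smooth]] by blast
    then show ?thesis using \<rho>_pos[of y0] that[of "\<rho> y0 / 2"] by force
  qed (auto intro: that[of 1])
  \<comment> \<open>The two summands never vanish together, so the quotient below is a smooth step in \<open>\<rho>\<close>.\<close>
  define d where "d x = flat_exp (\<rho> x) + flat_exp (c - \<rho> x)" for x
  have d: "0 < d x" for x
    using fe(1)[of "\<rho> x"] fe(1)[of "c - \<rho> x"] fe(2)[of "\<rho> x"] fe(2)[of "c - \<rho> x"] c(1)
    unfolding d_def by (cases "0 < \<rho> x") linarith+
  define \<eta> where "\<eta> x = flat_exp (\<rho> x) * d x powr (-1)" for x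
  have \<eta>: "\<eta> x = flat_exp (\<rho> x) / d x" for x
    using d[of x] by (simp add: \<eta>_def powr_minus divide_inverse)
  have "smooth d" unfolding d_def
    by (intro smooth_add smooth_flat_exp smooth_diff \<rho>_smooth smooth_const)
  then have "smooth \<eta>" unfolding \<eta>_def
    by (intro smooth_mult smooth_flat_exp smooth_powr \<rho>_smooth d)
  then have "\<eta> \<in> test_functions \<Omega>"
    using L by (intro test_functionsI[of \<eta> L]) (auto simp: \<eta> \<rho>_0 fe)
  moreover have "open {x. c < \<rho> x}"
    by (intro open_Collect_less smooth_imp_continuous \<rho>_smooth continuous_on_const)
  moreover have "\<eta> x = 1" if "x \<in> {x. c < \<rho> x}" for x
    using d[of x] that by (auto simp: \<eta> d_def fe)
  moreover have "0 \<le> \<eta> x" "\<eta> x \<le> 1" for x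
    using d[of x] fe(1)[of "\<rho> x"] fe(1)[of "c - \<rho> x"] by (auto simp: \<eta> d_def)
  ultimately show ?thesis
    using c(2) by (intro that[of \<eta> "{x. c < \<rho> x}"]) auto
qed

section \<open>The fundamental lemma of the calculus of variations\<close>

text \<open>Local integrability is a statement about compact subsets; an exhaustion by compact sets glues the pieces.\<close>

lemma L1_loc_borel_measurable:
  fixes f :: "real^'n \<Rightarrow> 'b::euclidean_space"
  assumes "open \<Omega>" "f \<in> L1_loc \<Omega>"
  shows "f \<in> borel_measurable (lebesgue_on \<Omega>)"
proof -
  obtain C where C: "\<And>n. compact (C n)" "\<And>n. C n \<subseteq> \<Omega>" "\<And>n. C n \<subseteq> interior (C (Suc n))"
    "\<Union>(range C) = \<Omega>" "\<And>K. compact K \<Longrightarrow> K \<subseteq> \<Omega> \<Longrightarrow> \<exists>N. \<forall>n\<ge>N. K \<subseteq> C n"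
    by (rule open_Union_compact_subsets[OF assms(1)]) (rule that)
  have "(\<lambda>x. indicator (C n) x *\<^sub>R f x) \<in> borel_measurable (lebesgue_on \<Omega>)" for n
  proof -
    have "f absolutely_integrable_on C n" using assms C by (auto simp: L1_loc_def)
    then have "(\<lambda>x. indicator (C n) x *\<^sub>R f x) \<in> borel_measurable lebesgue"
      unfolding set_integrable_def by (rule borel_measurable_integrable)
    then show ?thesis by (rule measurable_restrict_space1)
  qed
  moreover have "(\<lambda>n. indicator (C n) x *\<^sub>R f x) \<longlonglongrightarrow> f x" if x: "x \<in> space (lebesgue_on \<Omega>)" for x
  proof (rule tendsto_eventually)
    obtain N where "\<forall>n\<ge>N. {x} \<subseteq> C n" using C(5)[of "{x}"] x by auto
    then show "\<forall>\<^sub>F n in sequentially. indicator (C n) x *\<^sub>R f x = f x"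
      by (auto simp: eventually_sequentially intro!: exI[of _ N])
  qed
  ultimately show ?thesis by (rule borel_measurable_LIMSEQ_metric)
qed

lemma test_functions_borel_measurable:
  "\<phi> \<in> test_functions \<Omega> \<Longrightarrow> \<phi> \<in> borel_measurable (lebesgue_on S)"
  by (intro measurable_restrict_space1 measurable_completion)
     (auto intro!: borel_measurable_continuous_onI smooth_imp_continuous test_functions_smooth)

lemma L1_loc_indicator_integrable:
  fixes f :: "real^'n \<Rightarrow> real"
  assumes "open \<Omega>" "f \<in> L1_loc \<Omega>" "compact K" "K \<subseteq> \<Omega>"
  shows "integrable (lebesgue_on \<Omega>) (\<lambda>x. indicator K x * f x)"
proof -
  have "integrable lebesgue (\<lambda>x. indicator K x *\<^sub>R f x)"
    using assms by (auto simp: L1_loc_def set_integrable_def)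
  moreover have "(\<lambda>x. indicator \<Omega> x *\<^sub>R (indicator K x * f x)) = (\<lambda>x. indicator K x *\<^sub>R f x)"
    using subsetD[OF assms(4)] by (auto simp: indicator_def fun_eq_iff)
  ultimately show ?thesis
    using assms(1) by (subst integrable_restrict_space) auto
qed

lemma L1_loc_times_test_function_integrable:
  fixes f :: "real^'n \<Rightarrow> real"
  assumes "open \<Omega>" "f \<in> L1_loc \<Omega>" "\<phi> \<in> test_functions \<Omega>"
  shows "integrable (lebesgue_on \<Omega>) (\<lambda>x. f x * \<phi> x)"
proof (rule test_functionsE[OF assms(3)])
  assume K: "compact (support \<phi>)" "support \<phi> \<subseteq> \<Omega>" "\<And>x. x \<notin> support \<phi> \<Longrightarrow> \<phi> x = 0"
  obtain C where C: "0 \<le> C" "\<And>x. \<bar>\<phi> x\<bar> \<le> C" using test_functions_bounded[OF assms(3)] by blast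
  show ?thesis
  proof (rule Bochner_Integration.integrable_bound)
    show "integrable (lebesgue_on \<Omega>) (\<lambda>x. C * (indicator (support \<phi>) x * f x))"
      by (intro integrable_mult_right L1_loc_indicator_integrable assms K)
    show "(\<lambda>x. f x * \<phi> x) \<in> borel_measurable (lebesgue_on \<Omega>)"
      using L1_loc_borel_measurable[OF assms(1,2)] test_functions_borel_measurable[OF assms(3)]
      by (rule borel_measurable_times)
    show "AE x in lebesgue_on \<Omega>. norm (f x * \<phi> x) \<le> norm (C * (indicator (support \<phi>) x * f x))"
      using K(3) C by (intro AE_I2) (auto simp: indicator_def abs_mult mult.commute intro!: mult_right_mono)
  qed
qed

text \<open>Cutoff functions concentrating on a compact \<open>K\<close> show that \<open>f\<close> has integral 0 over every compact set. If
  \<open>{f > 0}\<close> had positive measure, then by inner regularity it would contain a compact set of positive measure, over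
  which the integral of \<open>f\<close> could not vanish; the same applies to \<open>-f\<close>.\<close>

lemma fundamental_lemma_calculus_of_variations:
  fixes f :: "real^'n \<Rightarrow> real"
  assumes "open \<Omega>" "f \<in> L1_loc \<Omega>"
    and zero: "\<And>\<phi>. \<phi> \<in> test_functions \<Omega> \<Longrightarrow> (\<integral>x. f x * \<phi> x \<partial>lebesgue_on \<Omega>) = 0"
  shows "AE x in lebesgue_on \<Omega>. f x = 0"
proof -
  let ?M = "lebesgue_on \<Omega>"
  obtain C where C: "\<And>n. compact (C n)" "\<And>n. C n \<subseteq> \<Omega>" "\<And>n. C n \<subseteq> interior (C (Suc n))"
    "\<Union>(range C) = \<Omega>" "\<And>K. compact K \<Longrightarrow> K \<subseteq> \<Omega> \<Longrightarrow> \<exists>N. \<forall>n\<ge>N. K \<subseteq> C n"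
    by (rule open_Union_compact_subsets[OF assms(1)]) (rule that)
  have compact_0: "(\<integral>x. f x * indicator K x \<partial>?M) = 0" if K: "compact K" "K \<subseteq> \<Omega>" for K
  proof (cases "K = {}")
    case False
    obtain N where N: "K \<subseteq> C N" using C(5)[OF K] by blast
    define L where "L = C (Suc N)"
    define U where "U n = {x. infdist x K < 1 / Suc n} \<inter> interior L" for n
    have U: "open (U n)" "K \<subseteq> U n" for n
      using C(3)[of N] N unfolding U_def L_def
      by (auto intro!: open_Int open_Collect_less continuous_intros)
    have "\<forall>n. \<exists>\<eta>\<in>test_functions (U n). (\<forall>x\<in>K. \<eta> x = 1) \<and> (\<forall>x. 0 \<le> \<eta> x \<and> \<eta> x \<le> 1)"
      using cutoff_function_exists[OF U(1) K(1) U(2)] by (metis subsetD)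
    then obtain \<eta> where \<eta>: "\<And>n. \<eta> n \<in> test_functions (U n)" "\<And>n x. x \<in> K \<Longrightarrow> \<eta> n x = 1"
      "\<And>n x. 0 \<le> \<eta> n x" "\<And>n x. \<eta> n x \<le> 1" by metis
    have \<eta>_out: "\<eta> n x = 0" if "x \<notin> U n" for n x
      using \<eta>(1)[of n] that by (auto elim!: test_functionsE)
    have "U n \<subseteq> \<Omega>" for n using C(2)[of "Suc N"] interior_subset[of L] by (auto simp: U_def L_def)
    then have \<eta>_test: "\<eta> n \<in> test_functions \<Omega>" for n
      using \<eta>(1)[of n] by (fastforce simp: test_functions_def)
    have "(\<lambda>n. \<integral>x. f x * \<eta> n x \<partial>?M) \<longlonglongrightarrow> (\<integral>x. f x * indicator K x \<partial>?M)"
    proof (rule integral_dominated_convergence)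
      show "integrable ?M (\<lambda>x. \<bar>indicator L x * f x\<bar>)"
        unfolding L_def by (intro integrable_abs L1_loc_indicator_integrable assms C)
      show "(\<lambda>x. f x * indicator K x) \<in> borel_measurable ?M"
        using L1_loc_indicator_integrable[OF assms(1,2) K] by (simp add: mult.commute)
      show "(\<lambda>x. f x * \<eta> n x) \<in> borel_measurable ?M" for n
        using L1_loc_times_test_function_integrable[OF assms(1,2) \<eta>_test] by simp
      show "AE x in ?M. norm (f x * \<eta> n x) \<le> \<bar>indicator L x * f x\<bar>" for n
      proof (intro AE_I2)
        fix x
        show "norm (f x * \<eta> n x) \<le> \<bar>indicator L x * f x\<bar>"
        proof (cases "x \<in> U n")
          case True
          then have "x \<in> L" using interior_subset[of L] by (auto simp: U_def)
          then show ?thesis using \<eta>(3,4)[of n x] by (simp add: abs_mult mult_left_le)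
        qed (simp add: \<eta>_out)
      qed
      show "AE x in ?M. (\<lambda>n. f x * \<eta> n x) \<longlonglongrightarrow> f x * indicator K x"
      proof (intro AE_I2 tendsto_mult tendsto_const)
        fix x
        show "(\<lambda>n. \<eta> n x) \<longlonglongrightarrow> indicator K x"
        proof (cases "x \<in> K")
          case False
          then have "0 < infdist x K"
            using K \<open>K \<noteq> {}\<close> by (simp add: infdist_pos_not_in_closed compact_imp_closed)
          then have "\<forall>\<^sub>F n in sequentially. 1 / Suc n < infdist x K"
            using LIMSEQ_inverse_real_of_nat by (intro order_tendstoD) (simp add: inverse_eq_divide)
          then have "\<forall>\<^sub>F n in sequentially. \<eta> n x = indicator K x"
            by eventually_elim (use False in \<open>auto simp: U_def intro: \<eta>_out\<close>)
          then show ?thesis by (rule tendsto_eventually)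
        qed (simp add: \<eta>(2))
      qed
    qed
    then show ?thesis by (simp add: zero[OF \<eta>_test] LIMSEQ_const_iff)
  qed simp
  \<comment> \<open>To be used for \<open>f\<close> and for \<open>-f\<close>.\<close>
  have half: "AE x in lebesgue. x \<in> \<Omega> \<longrightarrow> g x \<le> 0"
    if g: "g \<in> L1_loc \<Omega>" and g0: "\<And>K. compact K \<Longrightarrow> K \<subseteq> \<Omega> \<Longrightarrow> (\<integral>x. g x * indicator K x \<partial>?M) = 0"
    for g :: "real^'n \<Rightarrow> real"
  proof -
    have null: "{x \<in> C k. 0 < g x} \<in> null_sets lebesgue" for k
    proof -
      let ?E = "{x \<in> C k. 0 < g x}"
      have ii: "(\<lambda>x. indicator (C k) x * g x) \<in> borel_measurable lebesgue"
        using g C(1,2)[of k] by (auto simp: L1_loc_def set_integrable_def dest: borel_measurable_integrable)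
      have "?E = {x \<in> space lebesgue. 0 < indicator (C k) x * g x}"
        by (auto simp: indicator_def)
      also have "\<dots> \<in> sets lebesgue" using ii by measurable
      finally have E: "?E \<in> sets lebesgue" .
      have "emeasure lebesgue ?E \<le> 0 + ennreal e" if "0 < e" for e
      proof -
        obtain T where T: "closed T" "T \<subseteq> ?E" "?E - T \<in> lmeasurable"
          "emeasure lebesgue (?E - T) < ennreal e"
          by (rule sets_lebesgue_inner_closed[OF E \<open>0 < e\<close>]) (rule that)
        have "C k \<inter> T = T" using T(2) by blast
        then have "compact T" using compact_Int_closed[OF C(1)[of k] T(1)] by simp
        have "T \<subseteq> \<Omega>" using T C(2)[of k] by auto
        have "0 \<le> g x * indicator T x" for x
          using T(2) by (auto simp: indicator_def)
        then have "AE x in ?M. g x * indicator T x = 0"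
          using L1_loc_indicator_integrable[OF assms(1) g \<open>compact T\<close> \<open>T \<subseteq> \<Omega>\<close>]
            g0[OF \<open>compact T\<close> \<open>T \<subseteq> \<Omega>\<close>]
          by (subst integral_nonneg_eq_0_iff_AE[symmetric]) (simp_all add: mult.commute)
        then have "AE x in lebesgue. x \<in> \<Omega> \<longrightarrow> g x * indicator T x = 0"
          using assms(1) by (subst (asm) AE_restrict_space_iff) auto
        then have "AE x in lebesgue. x \<notin> T"
          by eventually_elim (use T(2) \<open>T \<subseteq> \<Omega>\<close> in \<open>auto simp: indicator_def split: if_splits\<close>)
        then have "T \<in> null_sets lebesgue"
          using T(1) by (subst (asm) AE_iff_null_sets[symmetric]) auto
        then have "emeasure lebesgue (?E - T) = emeasure lebesgue ?E"
          using E by (intro emeasure_Diff_null_set)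
        then show ?thesis using T(4) by simp
      qed
      then have "emeasure lebesgue ?E \<le> 0" by (rule ennreal_le_epsilon)
      then show ?thesis using E by auto
    qed
    have "AE x in lebesgue. \<forall>k. x \<notin> {x \<in> C k. 0 < g x}"
      unfolding AE_all_countable by (intro allI AE_not_in null)
    then show ?thesis
    proof eventually_elim
      case (elim x)
      show ?case
      proof
        assume "x \<in> \<Omega>"
        then obtain k where "x \<in> C k" using C(5)[of "{x}"] by auto
        then show "g x \<le> 0" using elim by (auto simp: not_less)
      qed
    qed
  qed
  have "(\<lambda>x. - f x) \<in> L1_loc \<Omega>" using assms(2) by (auto simp: L1_loc_def set_integrable_def)
  from half[OF assms(2) compact_0] half[OF this] compact_0
  have "AE x in lebesgue. x \<in> \<Omega> \<longrightarrow> f x = 0" by auto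
  then show ?thesis using assms(1) by (subst AE_restrict_space_iff) auto
qed

section \<open>The quadratic form of the operator\<close>

definition gradient :: "(real^'n \<Rightarrow> real) \<Rightarrow> real^'n \<Rightarrow> real^'n" where
  "gradient f x = (\<chi> i. partial_deriv i f x)"

lemma gradient_component [simp]: "gradient f x $ i = partial_deriv i f x"
  by (simp add: gradient_def)

lemma matrix_form_expand:
  fixes P :: "real^'n^'n"
  shows "(P *v \<xi>) \<bullet> \<zeta> = (\<Sum>j\<in>UNIV. \<Sum>k\<in>UNIV. P $ j $ k * (\<xi> $ k * \<zeta> $ j))"
  by (simp add: inner_vec_def matrix_vector_mult_def sum_distrib_right mult.assoc)

lemma symmetric_form_commute:
  fixes P :: "real^'n^'n"
  assumes "\<And>j k. P $ j $ k = P $ k $ j"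
  shows "(P *v \<xi>) \<bullet> \<zeta> = (P *v \<zeta>) \<bullet> \<xi>"
  unfolding matrix_form_expand
  by (subst sum.swap) (simp add: assms[of _ "_::'n"] mult_ac cong: sum.cong)

text \<open>The binomial formula from which every completion of a square below is read off.\<close>

lemma symmetric_form_square:
  fixes P :: "real^'n^'n"
  assumes "\<And>j k. P $ j $ k = P $ k $ j"
  shows "(P *v (a *\<^sub>R \<xi> + b *\<^sub>R \<zeta>)) \<bullet> (a *\<^sub>R \<xi> + b *\<^sub>R \<zeta>)
    = a\<^sup>2 * ((P *v \<xi>) \<bullet> \<xi>) + 2 * a * b * ((P *v \<xi>) \<bullet> \<zeta>) + b\<^sup>2 * ((P *v \<zeta>) \<bullet> \<zeta>)"
  using symmetric_form_commute[OF assms, of \<xi> \<zeta>]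
  by (simp add: matrix_vector_right_distrib matrix_vector_mult_scaleR inner_add_left inner_add_right
      power2_eq_square algebra_simps)

text \<open>Expand the form at \<open>\<xi> + \<zeta>\<close> and at \<open>\<xi> - \<zeta>\<close>.\<close>

lemma nonneg_form_cross_bound:
  fixes P :: "real^'n^'n"
  assumes "\<And>j k. P $ j $ k = P $ k $ j" "\<And>\<xi>. 0 \<le> (P *v \<xi>) \<bullet> \<xi>"
  shows "2 * \<bar>(P *v \<xi>) \<bullet> \<zeta>\<bar> \<le> (P *v \<xi>) \<bullet> \<xi> + (P *v \<zeta>) \<bullet> \<zeta>"
  using assms(2)[of "1 *\<^sub>R \<xi> + 1 *\<^sub>R \<zeta>"] assms(2)[of "1 *\<^sub>R \<xi> + (-1) *\<^sub>R \<zeta>"]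
  unfolding symmetric_form_square[OF assms(1)] by (simp add: abs_if)

text \<open>Linearity on test functions is inherited at once by \<open>\<sigma>\<close> from \<open>b\<close> and \<open>c\<close>.\<close>

definition test_linear :: "(real^'n) set \<Rightarrow> 'n distr \<Rightarrow> bool" where
  "test_linear \<Omega> T \<longleftrightarrow>
     (\<forall>\<phi>\<in>test_functions \<Omega>. \<forall>\<psi>\<in>test_functions \<Omega>. T (\<lambda>x. \<phi> x + \<psi> x) = T \<phi> + T \<psi>) \<and>
     (\<forall>r. \<forall>\<phi>\<in>test_functions \<Omega>. T (\<lambda>x. r * \<phi> x) = r * T \<phi>)"

lemma test_linearD:
  assumes "test_linear \<Omega> T" "\<phi> \<in> test_functions \<Omega>"
  shows "\<psi> \<in> test_functions \<Omega> \<Longrightarrow> T (\<lambda>x. \<phi> x + \<psi> x) = T \<phi> + T \<psi>" "T (\<lambda>x. r * \<phi> x) = r * T \<phi>"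
  using assms by (auto simp: test_linear_def)

lemma distribution_imp_test_linear: "distribution \<Omega> T \<Longrightarrow> test_linear \<Omega> T"
  by (simp add: distribution_def test_linear_def)

lemma test_linear_diff_div:
  assumes "test_linear \<Omega> c" "\<And>j. test_linear \<Omega> (b $ j)"
  shows "test_linear \<Omega> (\<lambda>\<phi>. c \<phi> - 1/2 * div_distr b \<phi>)"
proof -
  have add: "partial_deriv j (\<lambda>x. \<phi> x + \<psi> x) = (\<lambda>x. partial_deriv j \<phi> x + partial_deriv j \<psi> x)"
    if "\<phi> \<in> test_functions \<Omega>" "\<psi> \<in> test_functions \<Omega>" for \<phi> \<psi> j
    using that by (auto intro!: partial_deriv_add smooth_imp_differentiable test_functions_smooth)
  have scale: "partial_deriv j (\<lambda>x. r * \<phi> x) = (\<lambda>x. r * partial_deriv j \<phi> x)"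
    if "\<phi> \<in> test_functions \<Omega>" for \<phi> r j
  proof
    fix x
    have "\<phi> differentiable (at x)"
      using that by (intro smooth_imp_differentiable test_functions_smooth)
    then show "partial_deriv j (\<lambda>x. r * \<phi> x) x = r * partial_deriv j \<phi> x"
      by (simp add: partial_deriv_mult partial_deriv_const)
  qed
  show ?thesis
    using assms unfolding test_linear_def div_distr_def
    by (simp add: add scale test_functions_partial_deriv sum.distrib sum_distrib_left[symmetric]
        distrib_left right_diff_distrib)
qed

lemma regular_distr_eq: 
  "open \<Omega> \<Longrightarrow> regular_distr \<Omega> f \<phi> = (\<integral>x. f x * \<phi> x \<partial>lebesgue_on \<Omega>)"
  unfolding regular_distr_def set_lebesgue_integral_def
  by (subst integral_restrict_space) auto

lemma L1_loc_component:
  fixes P :: "real^'n \<Rightarrow> real^'n^'n"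
  assumes "P \<in> L1_loc \<Omega>" shows "(\<lambda>x. P x $ j $ k) \<in> L1_loc \<Omega>"
proof -
  have "bounded_linear (\<lambda>A :: real^'n^'n. A $ j $ k)"
    by (intro bounded_linear_compose[OF bounded_linear_vec_nth bounded_linear_vec_nth])
  then show ?thesis using assms
    by (auto simp: L1_loc_def dest: absolutely_integrable_linear[unfolded o_def])
qed

lemma L1_loc_add:
  fixes f g :: "real^'n \<Rightarrow> real"
  shows "f \<in> L1_loc \<Omega> \<Longrightarrow> g \<in> L1_loc \<Omega> \<Longrightarrow> (\<lambda>x. f x + g x) \<in> L1_loc \<Omega>"
  by (auto simp: L1_loc_def)

lemma borel_measurable_matrix_form:
  fixes P :: "'a \<Rightarrow> real^'n^'n"
  assumes [measurable]: "P \<in> borel_measurable M" "u \<in> borel_measurable M" "v \<in> borel_measurable M"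
  shows "(\<lambda>x. (P x *v u x) \<bullet> v x) \<in> borel_measurable M"
proof -
  have vec: "(\<lambda>x. w x $ j) \<in> borel_measurable M" if "w \<in> borel_measurable M" for w :: "'a \<Rightarrow> real^'n" and j
    by (rule measurable_compose[OF that]) (auto intro!: borel_measurable_continuous_onI continuous_intros)
  have comp: "(\<lambda>x. P x $ j $ k) \<in> borel_measurable M" for j k
    by (rule measurable_compose[OF assms(1), of "\<lambda>A. A $ j $ k"])
       (auto intro!: borel_measurable_continuous_onI continuous_intros)
  show ?thesis unfolding matrix_form_expand
    by (intro borel_measurable_sum borel_measurable_times comp vec[OF assms(2)] vec[OF assms(3)])
qed

lemma borel_measurable_gradient:
  assumes "\<phi> \<in> test_functions \<Omega>"
  shows "gradient \<phi> \<in> borel_measurable (lebesgue_on S)"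
proof -
  have "continuous_on UNIV (gradient \<phi>)"
    unfolding gradient_def
    by (intro continuous_on_vec_lambda smooth_imp_continuous smooth_partial_deriv test_functions_smooth[OF assms])
  then show ?thesis
    by (intro measurable_restrict_space1 measurable_completion) (auto intro!: borel_measurable_continuous_onI)
qed

text \<open>The entries \<open>(j, k)\<close> and \<open>(k, j)\<close> of the symmetric part are the same distribution; the fundamental lemma turns
  this into equality almost everywhere.\<close>

lemma L1_loc_density_symmetric:
  assumes "open \<Omega>" "L1_loc_density \<Omega> (sym_part A) P"
  shows "AE x in lebesgue_on \<Omega>. \<forall>j k. P x $ j $ k = P x $ k $ j"
proof -
  have P: "P \<in> L1_loc \<Omega>"
    and d: "\<And>j k \<phi>. \<phi> \<in> test_functions \<Omega> \<Longrightarrow>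
        (sym_part A $ j $ k) \<phi> = (\<integral>x. P x $ j $ k * \<phi> x \<partial>lebesgue_on \<Omega>)"
    using assms by (auto simp: L1_loc_density_def regular_distr_eq)
  have "AE x in lebesgue_on \<Omega>. P x $ j $ k - P x $ k $ j = 0" for j k
  proof (rule fundamental_lemma_calculus_of_variations[OF assms(1)])
    show "(\<lambda>x. P x $ j $ k - P x $ k $ j) \<in> L1_loc \<Omega>"
      using L1_loc_component[OF P, of j k] L1_loc_component[OF P, of k j]
      by (auto simp: L1_loc_def)
    fix \<phi> assume \<phi>: "\<phi> \<in> test_functions \<Omega>"
    have "(\<integral>x. (P x $ j $ k - P x $ k $ j) * \<phi> x \<partial>lebesgue_on \<Omega>)
      = (sym_part A $ j $ k) \<phi> - (sym_part A $ k $ j) \<phi>"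
      unfolding d[OF \<phi>] left_diff_distrib
      by (intro Bochner_Integration.integral_diff L1_loc_times_test_function_integrable
          L1_loc_component P \<phi> assms(1))
    also have "\<dots> = 0" by (simp add: sym_part_def transpose_def)
    finally show "(\<integral>x. (P x $ j $ k - P x $ k $ j) * \<phi> x \<partial>lebesgue_on \<Omega>) = 0" .
  qed
  then show ?thesis by (simp add: AE_all_countable)
qed

text \<open>Evaluated at \<open>u = v = h\<close>, the matrix is paired with the symmetric array \<open>\<partial>\<^sub>k h \<partial>\<^sub>j h\<close>, which sees only the symmetric
  part, and \<open>h \<partial>\<^sub>j h = \<partial>\<^sub>j(h\<^sup>2)/2\<close> turns the drift term into \<open>-div b/2\<close> applied to \<open>h\<^sup>2\<close>.\<close>

lemma L_form_diagonal:
  assumes "open \<Omega>" "\<And>j k. test_linear \<Omega> (A $ j $ k)" "\<And>j. test_linear \<Omega> (b $ j)"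
    and "L1_loc_density \<Omega> (sym_part A) P" and h: "h \<in> test_functions \<Omega>"
  shows "integrable (lebesgue_on \<Omega>) (\<lambda>x. (P x *v gradient h x) \<bullet> gradient h x)"
    and "- L_form A b c h h = (\<integral>x. (P x *v gradient h x) \<bullet> gradient h x \<partial>lebesgue_on \<Omega>)
      - (c (\<lambda>x. (h x)\<^sup>2) - 1/2 * div_distr b (\<lambda>x. (h x)\<^sup>2))"
proof -
  have P: "P \<in> L1_loc \<Omega>"
    and d: "\<And>j k \<phi>. \<phi> \<in> test_functions \<Omega> \<Longrightarrow>
        (sym_part A $ j $ k) \<phi> = (\<integral>x. P x $ j $ k * \<phi> x \<partial>lebesgue_on \<Omega>)"
    using assms(1,4) by (auto simp: L1_loc_density_def regular_distr_eq)
  define \<psi> where "\<psi> j k = (\<lambda>x. partial_deriv k h x * partial_deriv j h x)" for j k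
  have \<psi>: "\<psi> j k \<in> test_functions \<Omega>" for j k unfolding \<psi>_def
    by (intro test_functions_mult test_functions_partial_deriv h test_functions_smooth[of _ \<Omega>])
  have \<psi>_comm: "\<psi> j k = \<psi> k j" for j k by (simp add: \<psi>_def mult.commute)
  have int: "integrable (lebesgue_on \<Omega>) (\<lambda>x. P x $ j $ k * \<psi> j k x)" for j k
    by (intro L1_loc_times_test_function_integrable L1_loc_component P \<psi> assms(1))
  have expand: "(P x *v gradient h x) \<bullet> gradient h x
      = (\<Sum>j\<in>UNIV. \<Sum>k\<in>UNIV. P x $ j $ k * \<psi> j k x)" for x
    by (simp add: matrix_form_expand \<psi>_def)
  show "integrable (lebesgue_on \<Omega>) (\<lambda>x. (P x *v gradient h x) \<bullet> gradient h x)"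
    unfolding expand by (intro Bochner_Integration.integrable_sum int)
  have "(\<integral>x. (P x *v gradient h x) \<bullet> gradient h x \<partial>lebesgue_on \<Omega>)
      = (\<Sum>j\<in>UNIV. \<Sum>k\<in>UNIV. (sym_part A $ j $ k) (\<psi> j k))"
    unfolding expand d[OF \<psi>]
    by (simp add: Bochner_Integration.integral_sum Bochner_Integration.integrable_sum int)
  also have "\<dots> = 1/2 * (\<Sum>j\<in>UNIV. \<Sum>k\<in>UNIV. (A $ j $ k) (\<psi> j k))
      + 1/2 * (\<Sum>j\<in>UNIV. \<Sum>k\<in>UNIV. (A $ k $ j) (\<psi> j k))"
    by (simp add: sym_part_def transpose_def sum.distrib sum_distrib_left distrib_left)
  also have "(\<Sum>j\<in>UNIV. \<Sum>k\<in>UNIV. (A $ k $ j) (\<psi> j k)) = (\<Sum>j\<in>UNIV. \<Sum>k\<in>UNIV. (A $ j $ k) (\<psi> j k))"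
    by (subst sum.swap) (simp add: \<psi>_comm)
  finally have 1: "(\<Sum>j\<in>UNIV. \<Sum>k\<in>UNIV. (A $ j $ k) (\<psi> j k))
      = (\<integral>x. (P x *v gradient h x) \<bullet> gradient h x \<partial>lebesgue_on \<Omega>)" by simp
  have "(\<lambda>x. h x * partial_deriv j h x) \<in> test_functions \<Omega>" for j
    by (intro test_functions_mult test_functions_partial_deriv h test_functions_smooth[of _ \<Omega>])
  then have 2: "(b $ j) (\<lambda>x. h x * partial_deriv j h x) = 1/2 * (b $ j) (partial_deriv j (\<lambda>x. (h x)\<^sup>2))" for j
    by (simp add: partial_deriv_power2 test_functions_smooth[OF h] test_linearD(2)[OF assms(3)])
  show "- L_form A b c h h = (\<integral>x. (P x *v gradient h x) \<bullet> gradient h x \<partial>lebesgue_on \<Omega>)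
      - (c (\<lambda>x. (h x)\<^sup>2) - 1/2 * div_distr b (\<lambda>x. (h x)\<^sup>2))"
    unfolding L_form_def 1[symmetric] 2 div_distr_def
    by (simp add: \<psi>_def sum_distrib_left sum_negf sum_divide_distrib power2_eq_square)
qed

text \<open>The components \<open>Pg\<sqdot>e\<^sub>j\<close> are locally integrable because \<open>2\<bar>Pg\<sqdot>e\<^sub>j\<bar> \<le> Pg\<sqdot>g + Pe\<^sub>j\<sqdot>e\<^sub>j\<close>, so that the divergence is given by
  a convergent integral.\<close>

lemma div_distr_flux:
  assumes "open \<Omega>" and P: "P \<in> L1_loc \<Omega>"
    and sym: "AE x in lebesgue_on \<Omega>. \<forall>j k. P x $ j $ k = P x $ k $ j"
    and nn: "AE x in lebesgue_on \<Omega>. \<forall>\<xi>. 0 \<le> (P x *v \<xi>) \<bullet> \<xi>"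
    and g: "g \<in> borel_measurable (lebesgue_on \<Omega>)" "(\<lambda>x. (P x *v g x) \<bullet> g x) \<in> L1_loc \<Omega>"
    and \<phi>: "\<phi> \<in> test_functions \<Omega>"
  shows "integrable (lebesgue_on \<Omega>) (\<lambda>x. (P x *v g x) \<bullet> gradient \<phi> x)"
    and "div_distr (regular_distr_vec \<Omega> (\<lambda>x. P x *v g x)) \<phi>
      = - (\<integral>x. (P x *v g x) \<bullet> gradient \<phi> x \<partial>lebesgue_on \<Omega>)"
proof -
  let ?M = "lebesgue_on \<Omega>"
  have Pm: "P \<in> borel_measurable ?M" by (rule L1_loc_borel_measurable[OF assms(1) P])
  have cross: "integrable ?M (\<lambda>x. (P x *v g x) $ j * \<psi> x)" if "\<psi> \<in> test_functions \<Omega>" for j \<psi>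
  proof (rule Bochner_Integration.integrable_bound)
    show "integrable ?M (\<lambda>x. ((P x *v g x) \<bullet> g x + P x $ j $ j) * \<psi> x)"
      by (intro L1_loc_times_test_function_integrable L1_loc_add L1_loc_component g P that assms(1))
    have "(\<lambda>x. (P x *v g x) \<bullet> axis j 1) \<in> borel_measurable ?M"
      by (intro borel_measurable_matrix_form Pm g borel_measurable_const)
    then show "(\<lambda>x. (P x *v g x) $ j * \<psi> x) \<in> borel_measurable ?M"
      by (intro borel_measurable_times test_functions_borel_measurable[OF that]) (simp add: inner_axis)
    show "AE x in ?M. norm ((P x *v g x) $ j * \<psi> x) \<le> norm (((P x *v g x) \<bullet> g x + P x $ j $ j) * \<psi> x)"
      using sym nn
    proof eventually_elim
      case (elim x)
      have "(P x *v axis j 1) \<bullet> axis j 1 = P x $ j $ j"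
        by (simp add: inner_axis matrix_vector_mult_basis column_def)
      then have "2 * \<bar>(P x *v g x) $ j\<bar> \<le> (P x *v g x) \<bullet> g x + P x $ j $ j"
        using nonneg_form_cross_bound[of "P x" "g x" "axis j 1"] elim by (simp add: inner_axis)
      then have "\<bar>(P x *v g x) $ j\<bar> \<le> \<bar>(P x *v g x) \<bullet> g x + P x $ j $ j\<bar>" by linarith
      then show ?case by (simp add: abs_mult mult_right_mono)
    qed
  qed
  have i1: "integrable ?M (\<lambda>x. (P x *v g x) $ j * partial_deriv j \<phi> x)" for j
    by (intro cross test_functions_partial_deriv \<phi>)
  then show "integrable ?M (\<lambda>x. (P x *v g x) \<bullet> gradient \<phi> x)"
    by (simp add: inner_vec_def)
  have "div_distr (regular_distr_vec \<Omega> (\<lambda>x. P x *v g x)) \<phi>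
      = - (\<integral>x. (\<Sum>j\<in>UNIV. (P x *v g x) $ j * partial_deriv j \<phi> x) \<partial>?M)"
    using i1 by (simp add: div_distr_def regular_distr_vec_def regular_distr_eq[OF assms(1)])
  also have "(\<lambda>x. \<Sum>j\<in>UNIV. (P x *v g x) $ j * partial_deriv j \<phi> x)
      = (\<lambda>x. (P x *v g x) \<bullet> gradient \<phi> x)"
    by (simp add: inner_vec_def)
  finally show "div_distr (regular_distr_vec \<Omega> (\<lambda>x. P x *v g x)) \<phi>
      = - (\<integral>x. (P x *v g x) \<bullet> gradient \<phi> x \<partial>?M)" .
qed

text \<open>With \<open>\<phi> = h\<^sup>2\<close> one has \<open>P\<nabla>h\<sqdot>\<nabla>h + Pg\<sqdot>\<nabla>\<phi> + \<phi> Pg\<sqdot>g = P(\<nabla>h + h g)\<sqdot>(\<nabla>h + h g) \<ge> 0\<close>.\<close>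

lemma nonneg_definite_if_riccati:
  assumes "open \<Omega>" and P: "P \<in> L1_loc \<Omega>"
    and sym: "AE x in lebesgue_on \<Omega>. \<forall>j k. P x $ j $ k = P x $ k $ j"
    and nn: "AE x in lebesgue_on \<Omega>. \<forall>\<xi>. 0 \<le> (P x *v \<xi>) \<bullet> \<xi>"
    and g: "g \<in> borel_measurable (lebesgue_on \<Omega>)" "(\<lambda>x. (P x *v g x) \<bullet> g x) \<in> L1_loc \<Omega>"
    and h: "h \<in> test_functions \<Omega>"
    and int: "integrable (lebesgue_on \<Omega>) (\<lambda>x. (P x *v gradient h x) \<bullet> gradient h x)"
    and ineq: "s \<le> div_distr (regular_distr_vec \<Omega> (\<lambda>x. P x *v g x)) (\<lambda>x. (h x)\<^sup>2)
                    - regular_distr \<Omega> (\<lambda>x. (P x *v g x) \<bullet> g x) (\<lambda>x. (h x)\<^sup>2)"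
  shows "s \<le> (\<integral>x. (P x *v gradient h x) \<bullet> gradient h x \<partial>lebesgue_on \<Omega>)"
proof -
  let ?M = "lebesgue_on \<Omega>"
  define \<phi> where "\<phi> x = (h x)\<^sup>2" for x
  have \<phi>: "\<phi> \<in> test_functions \<Omega>" unfolding \<phi>_def[abs_def] by (intro test_functions_power2 h)
  note flux = div_distr_flux[OF assms(1) P sym nn g \<phi>]
  have i2: "integrable ?M (\<lambda>x. (P x *v g x) \<bullet> g x * \<phi> x)"
    by (intro L1_loc_times_test_function_integrable g \<phi> assms(1))
  have "0 \<le> (\<integral>x. (P x *v gradient h x) \<bullet> gradient h x + ((P x *v g x) \<bullet> gradient \<phi> x
      + (P x *v g x) \<bullet> g x * \<phi> x) \<partial>?M)"
  proof (rule integral_nonneg_AE, use sym nn in eventually_elim)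
    case (elim x)
    have "gradient \<phi> x = (2 * h x) *\<^sub>R gradient h x"
      by (simp add: vec_eq_iff \<phi>_def[abs_def] partial_deriv_power2 test_functions_smooth[OF h])
    then have "(P x *v gradient h x) \<bullet> gradient h x + ((P x *v g x) \<bullet> gradient \<phi> x + (P x *v g x) \<bullet> g x * \<phi> x)
      = (P x *v (h x *\<^sub>R g x + 1 *\<^sub>R gradient h x)) \<bullet> (h x *\<^sub>R g x + 1 *\<^sub>R gradient h x)"
      using elim(1) by (subst symmetric_form_square) (auto simp: \<phi>_def)
    also have "0 \<le> \<dots>" using elim(2) by blast
    finally show ?case .
  qed
  also have "\<dots> = (\<integral>x. (P x *v gradient h x) \<bullet> gradient h x \<partial>?M) + ((\<integral>x. (P x *v g x) \<bullet> gradient \<phi> x \<partial>?M)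
      + (\<integral>x. (P x *v g x) \<bullet> g x * \<phi> x \<partial>?M))"
    using int i2 flux(1) by simp
  finally show ?thesis
    using ineq flux(2) by (simp add: regular_distr_eq[OF assms(1)] \<phi>_def[abs_def])
qed

section \<open>Minimax, minimal norm and completeness\<close>

text \<open>The set of pairs strictly above some \<open>(f x, g x)\<close> is convex and misses the origin, so a line separates them; the
  set is closed upwards, which forces both coefficients to be nonnegative.\<close>

lemma convexlike_alternative_two:
  fixes f g :: "'x \<Rightarrow> real"
  assumes "X \<noteq> {}"
    and conv: "\<And>x y t. x \<in> X \<Longrightarrow> y \<in> X \<Longrightarrow> 0 \<le> t \<Longrightarrow> t \<le> 1 \<Longrightarrow>
      \<exists>z\<in>X. f z \<le> (1 - t) * f x + t * f y \<and> g z \<le> (1 - t) * g x + t * g y"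
    and no: "\<not> (\<exists>x\<in>X. f x < 0 \<and> g x < 0)"
  obtains a b where "0 \<le> a" "0 \<le> b" "0 < a + b" "\<And>x. x \<in> X \<Longrightarrow> 0 \<le> a * f x + b * g x"
proof -
  define S where "S = {p. \<exists>x\<in>X. f x < fst p \<and> g x < snd p}"
  have "convex S"
  proof (rule convexI)
    fix p q :: "real \<times> real" and u v :: real
    assume pq: "p \<in> S" "q \<in> S" and uv: "0 \<le> u" "0 \<le> v" "u + v = 1"
    obtain x y where xy: "x \<in> X" "f x < fst p" "g x < snd p" "y \<in> X" "f y < fst q" "g y < snd q"
      using pq by (auto simp: S_def)
    obtain z where z: "z \<in> X" "f z \<le> u * f x + v * f y" "g z \<le> u * g x + v * g y"
      using conv[of x y v] xy uv by (metis add.commute add_diff_cancel_left' le_add_same_cancel1)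
    have "u * a + v * b < u * a' + v * b'" if "a < a'" "b < b'" for a b a' b' :: real
    proof (cases "u = 0")
      case False
      then have "u * a < u * a'" "v * b \<le> v * b'" using that uv by (auto intro: mult_left_mono)
      then show ?thesis by linarith
    qed (use that uv in auto)
    from this[OF xy(2,5)] this[OF xy(3,6)] z show "u *\<^sub>R p + v *\<^sub>R q \<in> S"
      by (force simp: S_def)
  qed
  moreover have "0 \<notin> S" using no by (auto simp: S_def)
  ultimately obtain w where w: "w \<noteq> 0" "\<And>p. p \<in> S \<Longrightarrow> 0 \<le> w \<bullet> p"
    using separating_hyperplane_set_0 by (metis (no_types))
  obtain a b where [simp]: "w = (a, b)" by (cases w)
  have ge: "0 \<le> a * s + b * t" if "x \<in> X" "f x < s" "g x < t" for x s t
    using w(2)[of "(s, t)"] that by (auto simp: S_def)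
  obtain x0 where x0: "x0 \<in> X" using assms(1) by blast
  \<comment> \<open>An affine function of \<open>s\<close> that is nonnegative for all large \<open>s\<close> has nonnegative slope.\<close>
  have coeff: "0 \<le> a'" if "\<And>s. 1 \<le> s \<Longrightarrow> 0 \<le> a' * s + k" for a' k :: real
  proof (rule ccontr)
    assume "\<not> 0 \<le> a'"
    then have "a' * ((\<bar>k\<bar> + 1) / (- a') + 1) + k = - (\<bar>k\<bar> + 1) + a' + k"
      by (simp add: field_simps)
    moreover have "1 \<le> (\<bar>k\<bar> + 1) / (- a') + 1" using \<open>\<not> 0 \<le> a'\<close> by (simp add: field_simps)
    ultimately show False using that[of "(\<bar>k\<bar> + 1) / (- a') + 1"] \<open>\<not> 0 \<le> a'\<close> by linarith
  qed
  have "0 \<le> a"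
    by (rule coeff[of _ "a * f x0 + b * (g x0 + 1)"])
       (use ge[OF x0, of "f x0 + s" "g x0 + 1" for s] in \<open>auto simp: algebra_simps\<close>)
  moreover have "0 \<le> b"
    by (rule coeff[of _ "a * (f x0 + 1) + b * g x0"])
       (use ge[OF x0, of "f x0 + 1" "g x0 + s" for s] in \<open>auto simp: algebra_simps\<close>)
  moreover have "0 \<le> a * f x + b * g x" if "x \<in> X" for x
  proof (rule field_le_epsilon)
    fix e :: real assume "0 < e"
    define r where "r = e / (a + b + 1)"
    have "0 < r" and r: "(a + b) * r \<le> e"
      using \<open>0 < e\<close> \<open>0 \<le> a\<close> \<open>0 \<le> b\<close> by (auto simp: r_def field_simps)
    from ge[OF that, of "f x + r" "g x + r"] this
    show "0 \<le> a * f x + b * g x + e" by (simp add: algebra_simps)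
  qed
  moreover have "0 < a + b" using calculation w(1) by (auto simp: zero_prod_def)
  ultimately show ?thesis using that by blast
qed

text \<open>Convexlike families, in which a convex combination of values is only required to be dominated at some point, need
  no vector space structure on \<open>X\<close>. The induction applies the hypothesis on \<open>{x. F i x < 0}\<close>, which is again
  convexlike, and then the case of two functions to the resulting combination and \<open>F i\<close>.\<close>

lemma convexlike_alternative:
  fixes F :: "'i \<Rightarrow> 'x \<Rightarrow> real"
  assumes "finite I" "I \<noteq> {}" "X \<noteq> {}"
    and "\<And>x y t. x \<in> X \<Longrightarrow> y \<in> X \<Longrightarrow> 0 \<le> t \<Longrightarrow> t \<le> 1 \<Longrightarrow>
      \<exists>z\<in>X. \<forall>i\<in>I. F i z \<le> (1 - t) * F i x + t * F i y"
    and "\<not> (\<exists>x\<in>X. \<forall>i\<in>I. F i x < 0)"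
  shows "\<exists>w. (\<forall>i\<in>I. 0 \<le> w i) \<and> 0 < (\<Sum>i\<in>I. w i) \<and> (\<forall>x\<in>X. 0 \<le> (\<Sum>i\<in>I. w i * F i x))"
  using assms
proof (induction I arbitrary: X rule: finite_ne_induct)
  case (singleton i)
  then show ?case by (intro exI[of _ "\<lambda>_. 1"]) (force simp: not_less)
next
  case (insert i I)
  define X' where "X' = {x \<in> X. F i x < 0}"
  show ?case
  proof (cases "X' = {}")
    case True
    then show ?thesis using insert.hyps
      by (intro exI[of _ "\<lambda>j. if j = i then 1 else 0"])
         (auto simp: X'_def not_less sum.If_cases if_distrib[of "\<lambda>c. c * _"] cong: if_cong)
  next
    case False
    have "\<exists>w. (\<forall>i\<in>I. 0 \<le> w i) \<and> 0 < (\<Sum>i\<in>I. w i) \<and> (\<forall>x\<in>X'. 0 \<le> (\<Sum>i\<in>I. w i * F i x))"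
    proof (rule insert.IH[OF False])
      fix x y and t :: real assume xy: "x \<in> X'" "y \<in> X'" and t: "0 \<le> t" "t \<le> 1"
      then obtain z where z: "z \<in> X" "\<forall>j\<in>insert i I. F j z \<le> (1 - t) * F j x + t * F j y"
        using insert.prems(2)[of x y t] by (auto simp: X'_def)
      have "(1 - t) * F i x + t * F i y < 0"
      proof (cases "t = 0")
        case False
        then have "t * F i y < 0" "(1 - t) * F i x \<le> 0"
          using xy t by (auto simp: X'_def mult_pos_neg mult_nonneg_nonpos)
        then show ?thesis by linarith
      qed (use xy in \<open>simp add: X'_def\<close>)
      then have "z \<in> X'" using z by (auto simp: X'_def)
      with z show "\<exists>z\<in>X'. \<forall>i\<in>I. F i z \<le> (1 - t) * F i x + t * F i y" by blast
    next
      show "\<not> (\<exists>x\<in>X'. \<forall>i\<in>I. F i x < 0)" using insert.prems(3) by (auto simp: X'_def)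
    qed
    then obtain w where w: "\<And>j. j \<in> I \<Longrightarrow> 0 \<le> w j" "0 < (\<Sum>j\<in>I. w j)"
      "\<And>x. x \<in> X' \<Longrightarrow> 0 \<le> (\<Sum>j\<in>I. w j * F j x)" by blast
    define G where "G x = (\<Sum>j\<in>I. w j * F j x)" for x
    obtain a b where ab: "0 \<le> a" "0 \<le> b" "0 < a + b" "\<And>x. x \<in> X \<Longrightarrow> 0 \<le> a * G x + b * F i x"
    proof (rule convexlike_alternative_two[OF insert.prems(1), of G "F i"])
      fix x y and t :: real assume xy: "x \<in> X" "y \<in> X" and t: "0 \<le> t" "t \<le> 1"
      then obtain z where z: "z \<in> X" "\<forall>j\<in>insert i I. F j z \<le> (1 - t) * F j x + t * F j y"
        using insert.prems(2)[of x y t] by auto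
      have "G z \<le> (\<Sum>j\<in>I. w j * ((1 - t) * F j x + t * F j y))"
        unfolding G_def using z w(1) by (intro sum_mono mult_left_mono) auto
      also have "\<dots> = (1 - t) * G x + t * G y"
        by (simp add: G_def sum_distrib_left ring_distribs sum.distrib sum_subtractf mult.left_commute)
      finally show "\<exists>z\<in>X. G z \<le> (1 - t) * G x + t * G y \<and> F i z \<le> (1 - t) * F i x + t * F i y"
        using z by blast
    next
      show "\<not> (\<exists>x\<in>X. G x < 0 \<and> F i x < 0)" using w(3) by (force simp: X'_def G_def)
    qed blast
    define w' where "w' j = (if j = i then b else a * w j)" for j
    have sum': "(\<Sum>j\<in>insert i I. w' j * h j) = b * h i + a * (\<Sum>j\<in>I. w j * h j)" for h
    proof -
      have "(\<Sum>j\<in>I. w' j * h j) = (\<Sum>j\<in>I. a * (w j * h j))"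
        using insert.hyps by (intro sum.cong) (auto simp: w'_def)
      then show ?thesis using insert.hyps by (simp add: sum_distrib_left) (simp add: w'_def)
    qed
    have "0 < b + a * (\<Sum>j\<in>I. w j)"
      using ab w(2) by (cases "a = 0") (auto intro: add_nonneg_pos)
    then have "0 < (\<Sum>j\<in>insert i I. w' j)" using sum'[of "\<lambda>_. 1"] by simp
    moreover have "\<forall>x\<in>X. 0 \<le> (\<Sum>j\<in>insert i I. w' j * F j x)"
      using ab(4) unfolding sum' by (simp add: G_def add.commute)
    moreover have "\<forall>j\<in>insert i I. 0 \<le> w' j" using ab w(1) by (simp add: w'_def)
    ultimately show ?thesis by blast
  qed
qed

text \<open>This replaces weak compactness in the intersection of a family of closed convex sets. Let \<open>d J\<close> be the infimum of the norm
  square on \<open>\<Inter>J\<close>, and \<open>s\<close> the supremum of \<open>d\<close> over finite subfamilies. Two elements of \<open>\<Inter>J\<close> whose norm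
  squares are almost \<open>s\<close>, where \<open>d J\<close> is almost \<open>s\<close> too, are close to each other by the parallelogram inequality, as
  their midpoint still lies in \<open>\<Inter>J\<close>. The sequence \<open>x\<close> is chosen along an increasing sequence of such \<open>J\<close>; any further
  set \<open>C\<close> of the family may be added to these \<open>J\<close> without destroying the estimate, whence the comparison sequence \<open>y\<close>
  inside \<open>C\<close>. Here \<open>N\<close> plays the role of the norm square and \<open>D\<close> that of the squared distance.\<close>

lemma minimal_norm_sequence:
  fixes N :: "'x \<Rightarrow> real" and D :: "'x \<Rightarrow> 'x \<Rightarrow> real" and mid :: "'x \<Rightarrow> 'x \<Rightarrow> 'x"
  assumes sub: "\<And>C. C \<in> \<C> \<Longrightarrow> C \<subseteq> X"
    and mid: "\<And>C x y. C \<in> insert X \<C> \<Longrightarrow> x \<in> C \<Longrightarrow> y \<in> C \<Longrightarrow> mid x y \<in> C"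
    and par: "\<And>x y. x \<in> X \<Longrightarrow> y \<in> X \<Longrightarrow> N (mid x y) \<le> (N x + N y) / 2 - D x y / 4"
    and nonneg: "\<And>x. x \<in> X \<Longrightarrow> 0 \<le> N x"
    and fip: "\<And>J. finite J \<Longrightarrow> J \<subseteq> \<C> \<Longrightarrow> \<exists>x\<in>X \<inter> \<Inter>J. N x \<le> B"
  obtains x where "\<And>n. x n \<in> X" "\<And>k m n. k \<le> m \<Longrightarrow> k \<le> n \<Longrightarrow> D (x m) (x n) \<le> 8 / Suc k"
    "\<And>C. C \<in> \<C> \<Longrightarrow> \<exists>y. (\<forall>n. y n \<in> C \<and> D (y n) (x n) \<le> 8 / Suc n)"
proof -
  define d where "d J = Inf (N ` (X \<inter> \<Inter>J))" for J
  define \<J> where "\<J> = {J. finite J \<and> J \<subseteq> \<C>}"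
  have d_le: "d J \<le> N x" if "x \<in> X \<inter> \<Inter>J" for J x
    unfolding d_def using nonneg that by (intro cINF_lower bdd_belowI2[of _ 0]) auto
  have d_B: "d J \<le> B" if J: "J \<in> \<J>" for J
  proof -
    obtain x where "x \<in> X \<inter> \<Inter>J" "N x \<le> B" using fip[of J] J unfolding \<J>_def by blast
    then show ?thesis using d_le[of x J] by linarith
  qed
  define s where "s = Sup (d ` \<J>)"
  have bdd: "bdd_above (d ` \<J>)" using d_B by (intro bdd_aboveI2)
  have d_s: "d J \<le> s" if "J \<in> \<J>" for J
    unfolding s_def by (intro cSUP_upper that bdd)
  have "{} \<in> \<J>" by (simp add: \<J>_def)
  have "\<exists>J\<in>\<J>. s - 1 / Suc n < d J" for n :: nat
    using less_cSUP_iff[OF _ bdd, of "s - 1 / Suc n"] \<open>{} \<in> \<J>\<close> unfolding s_def[symmetric] by auto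
  then obtain J where J: "\<And>n. J n \<in> \<J>" "\<And>n. s - 1 / Suc n < d (J n)" by metis
  define J' where "J' n = (\<Union>l\<le>n. J l)" for n
  have J': "J' n \<in> \<J>" for n using J(1) by (auto simp: \<J>_def J'_def)
  have J'_mono: "J' k \<subseteq> J' n" if "k \<le> n" for k n using that by (force simp: J'_def)
  have ne: "X \<inter> \<Inter>J \<noteq> {}" if "J \<in> \<J>" for J using fip[of J] that by (auto simp: \<J>_def)
  have "d (J n) \<le> d (J' n)" for n
    unfolding d_def[of "J' n"]
    by (intro cINF_greatest ne J' d_le) (auto simp: J'_def)
  then have d_J': "s - 1 / Suc n < d (J' n)" for n using J(2)[of n] by (meson less_le_trans)
  have near: "\<exists>x\<in>X \<inter> \<Inter>J. N x < s + 1 / Suc n" if "J \<in> \<J>" for J and n :: nat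
  proof -
    have "d J < s + 1 / Suc n" by (rule le_less_trans[OF d_s[OF that]]) simp
    moreover have "bdd_below (N ` (X \<inter> \<Inter>J))" using nonneg by (intro bdd_belowI2[of _ 0]) auto
    ultimately show ?thesis unfolding d_def
      using cINF_less_iff[OF ne[OF that], of N] by blast
  qed
  have close: "D u v \<le> 8 / Suc k" if "u \<in> X \<inter> \<Inter>(J' k)" "v \<in> X \<inter> \<Inter>(J' k)"
    "N u < s + 1 / Suc k" "N v < s + 1 / Suc k" for u v k
  proof -
    have "mid u v \<in> X \<inter> \<Inter>(J' k)"
      using that(1,2) mid J'[of k] by (auto simp: \<J>_def)
    from d_le[OF this] have "s - 1 / Suc k < N (mid u v)" using d_J'[of k] by linarith
    moreover have "N (mid u v) \<le> (N u + N v) / 2 - D u v / 4" using par that by blast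
    ultimately have "D u v \<le> 8 * q" if "q = 1 / real (Suc k)" for q
      using \<open>N u < s + 1 / Suc k\<close> \<open>N v < s + 1 / Suc k\<close>
      unfolding that[symmetric] by (simp add: field_simps)
    then show ?thesis by simp
  qed
  have "\<forall>n. \<exists>x\<in>X \<inter> \<Inter>(J' n). N x < s + 1 / Suc n"
    by (intro allI near J')
  then obtain x where x: "\<And>n. x n \<in> X \<inter> \<Inter>(J' n)" "\<And>n. N (x n) < s + 1 / Suc n"
    by metis
  have le: "1 / real (Suc n) \<le> 1 / real (Suc k)" if "k \<le> n" for k n
    using that by (simp add: field_simps)
  have "D (x m) (x n) \<le> 8 / Suc k" if "k \<le> m" "k \<le> n" for k m n
  proof (rule close)
    show "x m \<in> X \<inter> \<Inter>(J' k)" "x n \<in> X \<inter> \<Inter>(J' k)"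
      using x(1)[of m] x(1)[of n] J'_mono[OF that(1)] J'_mono[OF that(2)] by blast+
    show "N (x m) < s + 1 / Suc k" "N (x n) < s + 1 / Suc k"
      using x(2)[of m] x(2)[of n] le[OF that(1)] le[OF that(2)] by linarith+
  qed
  moreover have "\<exists>y. (\<forall>n. y n \<in> C \<and> D (y n) (x n) \<le> 8 / Suc n)" if "C \<in> \<C>" for C
  proof -
    have "insert C (J' n) \<in> \<J>" for n using J'[of n] that by (auto simp: \<J>_def)
    then have "\<forall>n. \<exists>x\<in>X \<inter> \<Inter>(insert C (J' n)). N x < s + 1 / Suc n"
      by (intro allI near)
    then obtain y where "\<And>n. y n \<in> X \<inter> \<Inter>(insert C (J' n))"
      "\<And>n. N (y n) < s + 1 / Suc n" by metis
    then show ?thesis using x by (intro exI[of _ y] allI conjI close) auto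
  qed
  ultimately show ?thesis using that x(1) by blast
qed

text \<open>Completeness of \<open>L\<^sup>2\<close> in a form that produces a limit independent of the measure: the pointwise limit. The rate makes
  \<open>\<Sum> 2\<^sup>n \<bar>u (Suc n) - u n\<bar>\<^sup>2\<close> integrable, hence finite almost everywhere, so the increments are dominated by a geometric
  series; Fatou's lemma then carries the estimate to the limit.\<close>

lemma L2_fast_cauchy_limit:
  fixes u :: "nat \<Rightarrow> 'a \<Rightarrow> 'b::{banach, second_countable_topology}"
  assumes [measurable]: "\<And>n. u n \<in> borel_measurable M"
    and cauchy: "\<And>m n. n \<le> m \<Longrightarrow>
      (\<integral>\<^sup>+x. ennreal ((norm (u m x - u n x))\<^sup>2) \<partial>M) \<le> ennreal (B * (1 / 4) ^ n)"
  shows "(\<integral>\<^sup>+x. ennreal ((norm (lim (\<lambda>m. u m x) - u n x))\<^sup>2) \<partial>M) \<le> ennreal (B * (1 / 4) ^ n)"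
proof -
  define \<Delta> where "\<Delta> n x = u (Suc n) x - u n x" for n x
  have [measurable]: "\<Delta> n \<in> borel_measurable M" for n unfolding \<Delta>_def by measurable
  define B' where "B' = max B 0"
  have "(\<integral>\<^sup>+x. (\<Sum>n. ennreal (2 ^ n * (norm (\<Delta> n x))\<^sup>2)) \<partial>M)
      = (\<Sum>n. \<integral>\<^sup>+x. ennreal (2 ^ n * (norm (\<Delta> n x))\<^sup>2) \<partial>M)"
    by (intro nn_integral_suminf) measurable
  also have "\<dots> \<le> (\<Sum>n. ennreal (B' * (1 / 2) ^ n))"
  proof (intro suminf_le allI)
    fix n
    have "(\<integral>\<^sup>+x. ennreal (2 ^ n * (norm (\<Delta> n x))\<^sup>2) \<partial>M)
        = ennreal (2 ^ n) * (\<integral>\<^sup>+x. ennreal ((norm (\<Delta> n x))\<^sup>2) \<partial>M)"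
      by (simp add: ennreal_mult nn_integral_cmult)
    also have "\<dots> \<le> ennreal (2 ^ n) * ennreal (B * (1 / 4) ^ n)"
      unfolding \<Delta>_def by (intro mult_left_mono cauchy) auto
    also have "\<dots> \<le> ennreal (2 ^ n) * ennreal (B' * (1 / 4) ^ n)"
      by (intro mult_left_mono ennreal_leI mult_right_mono) (auto simp: B'_def)
    also have "\<dots> = ennreal (2 ^ n * (B' * (1 / 4) ^ n))"
      by (simp add: ennreal_mult[symmetric] B'_def)
    also have "2 ^ n * (B' * (1 / 4) ^ n) = B' * (1 / 2) ^ n"
      by (simp add: power_divide field_simps flip: power_mult_distrib)
    finally show "(\<integral>\<^sup>+x. ennreal (2 ^ n * (norm (\<Delta> n x))\<^sup>2) \<partial>M) \<le> ennreal (B' * (1 / 2) ^ n)" .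
  qed auto
  also have "\<dots> < \<infinity>"
  proof -
    have "summable (\<lambda>n. B' * (1 / 2) ^ n)"
      by (intro summable_mult summable_geometric) auto
    then have "(\<Sum>n. ennreal (B' * (1 / 2) ^ n)) = ennreal (\<Sum>n. B' * (1 / 2) ^ n)"
      by (intro suminf_ennreal2) (auto simp: B'_def)
    then show ?thesis by simp
  qed
  finally have "AE x in M. (\<Sum>n. ennreal (2 ^ n * (norm (\<Delta> n x))\<^sup>2)) \<noteq> \<infinity>"
    by (intro nn_integral_noteq_infinite) auto
  then have conv: "AE x in M. convergent (\<lambda>n. u n x)"
  proof eventually_elim
    case (elim x)
    then have "summable (\<lambda>n. 2 ^ n * (norm (\<Delta> n x))\<^sup>2)"
      by (intro summable_suminf_not_top) auto
    then have "(\<lambda>n. 2 ^ n * (norm (\<Delta> n x))\<^sup>2) \<longlonglongrightarrow> 0" by (rule summable_LIMSEQ_zero)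
    then have ev1: "\<forall>\<^sub>F n in sequentially. 2 ^ n * (norm (\<Delta> n x))\<^sup>2 < 1"
      by (rule order_tendstoD) simp
    have sq: "(sqrt 2 ^ n)\<^sup>2 = 2 ^ n" for n
      by (simp flip: real_sqrt_power)
    have ev: "\<forall>\<^sub>F n in sequentially. norm (\<Delta> n x) \<le> (1 / sqrt 2) ^ n"
      using ev1
    proof eventually_elim
      case (elim n)
      then have "(norm (\<Delta> n x))\<^sup>2 \<le> ((1 / sqrt 2) ^ n)\<^sup>2"
        by (simp add: power_divide sq field_simps)
      then show ?case by (rule power2_le_imp_le) auto
    qed
    have "summable (\<lambda>n. \<Delta> n x)"
      by (rule summable_comparison_test_ev[OF ev]) (auto intro!: summable_geometric)
    then have "convergent (\<lambda>n. \<Sum>i<n. \<Delta> i x)" by (simp add: summable_iff_convergent)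
    then have "convergent (\<lambda>n. (\<Sum>i<n. \<Delta> i x) + u 0 x)" by (intro convergent_add convergent_const)
    then show ?case
      using sum_lessThan_telescope[of "\<lambda>i. u i x"] by (simp add: \<Delta>_def)
  qed
  define g where "g x = lim (\<lambda>m. u m x)" for x
  have "(\<integral>\<^sup>+x. ennreal ((norm (g x - u n x))\<^sup>2) \<partial>M)
      \<le> (\<integral>\<^sup>+x. liminf (\<lambda>m. ennreal ((norm (u m x - u n x))\<^sup>2)) \<partial>M)"
  proof (rule nn_integral_mono_AE, use conv in eventually_elim)
    case (elim x)
    then have "(\<lambda>m. u m x) \<longlonglongrightarrow> g x" by (simp add: g_def convergent_LIMSEQ_iff)
    then have "(\<lambda>m. ennreal ((norm (u m x - u n x))\<^sup>2)) \<longlonglongrightarrow> ennreal ((norm (g x - u n x))\<^sup>2)"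
      by (intro tendsto_intros tendsto_ennrealI)
    then show ?case using lim_imp_Liminf[OF trivial_limit_sequentially] by fastforce
  qed
  also have "\<dots> \<le> liminf (\<lambda>m. \<integral>\<^sup>+x. ennreal ((norm (u m x - u n x))\<^sup>2) \<partial>M)"
    by (intro nn_integral_liminf) measurable
  also have "\<dots> \<le> limsup (\<lambda>m. \<integral>\<^sup>+x. ennreal ((norm (u m x - u n x))\<^sup>2) \<partial>M)"
    by (intro Liminf_le_Limsup) auto
  also have "\<dots> \<le> ennreal (B * (1 / 4) ^ n)"
    using cauchy[of n] by (intro Limsup_bounded) (auto simp: eventually_at_top_linorder)
  finally show ?thesis by (simp add: g_def)
qed

section \<open>Domination by locally integrable functions\<close>

lemma L1_loc_const: "(\<lambda>x. c :: real) \<in> L1_loc \<Omega>"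
  by (auto simp: L1_loc_def intro!: absolutely_integrable_on_const lmeasurable_compact)

lemma L1_loc_cmult: "f \<in> L1_loc \<Omega> \<Longrightarrow> (\<lambda>x. c * f x :: real) \<in> L1_loc \<Omega>"
  by (auto simp: L1_loc_def)

lemma L1_loc_dominated:
  fixes f :: "real^'n \<Rightarrow> real"
  assumes "open \<Omega>" "f \<in> borel_measurable (lebesgue_on \<Omega>)" "h \<in> L1_loc \<Omega>"
    and bound: "AE x in lebesgue_on \<Omega>. \<bar>f x\<bar> \<le> h x"
  shows "f \<in> L1_loc \<Omega>"
  unfolding L1_loc_def
proof (intro CollectI allI impI)
  fix K assume K: "compact K \<and> K \<subseteq> \<Omega>"
  have "f \<in> borel_measurable (lebesgue_on K)"
    using assms(2) K by (auto intro: measurable_restrict_mono)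
  then have "set_borel_measurable lebesgue K f"
    using K unfolding set_borel_measurable_def
    by (subst (asm) borel_measurable_restrict_space_iff) (auto intro: lmeasurable_compact fmeasurableD)
  moreover have "set_integrable lebesgue K h"
    using assms(3) K by (simp add: L1_loc_def)
  moreover have "AE x in lebesgue. x \<in> \<Omega> \<longrightarrow> \<bar>f x\<bar> \<le> h x"
    using bound assms(1) by (subst (asm) AE_restrict_space_iff) auto
  then have "AE x in lebesgue. x \<in> K \<longrightarrow> norm (f x) \<le> norm (h x)"
    by eventually_elim (use K in auto)
  ultimately show "set_integrable lebesgue K f"
    using set_integrable_bound by blast
qed

lemma compactly_supported_integrable:
  fixes f :: "real^'n \<Rightarrow> real"
  assumes "open \<Omega>" "f \<in> borel_measurable (lebesgue_on \<Omega>)" "h \<in> L1_loc \<Omega>" "compact K" "K \<subseteq> \<Omega>"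
    and "\<And>x. x \<in> K \<Longrightarrow> \<bar>f x\<bar> \<le> h x" "\<And>x. x \<in> \<Omega> \<Longrightarrow> x \<notin> K \<Longrightarrow> f x = 0"
  shows "integrable (lebesgue_on \<Omega>) f"
proof (rule Bochner_Integration.integrable_bound)
  show "integrable (lebesgue_on \<Omega>) (\<lambda>x. indicator K x * h x)"
    by (rule L1_loc_indicator_integrable) fact+
  show "AE x in lebesgue_on \<Omega>. norm (f x) \<le> norm (indicator K x * h x)"
  proof (intro AE_I2)
    fix x assume "x \<in> space (lebesgue_on \<Omega>)"
    then show "norm (f x) \<le> norm (indicator K x * h x)"
      using assms(6)[of x] assms(7)[of x] by (cases "x \<in> K") auto
  qed
qed fact

lemma test_function_gradient_bounded:
  assumes "f \<in> test_functions \<Omega>"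
  obtains C where "0 < C" "\<And>x. \<bar>f x\<bar> \<le> C" "\<And>x. norm (gradient f x) \<le> C"
proof -
  have "\<forall>i. \<exists>c. \<forall>x. \<bar>partial_deriv i f x\<bar> \<le> c"
    using test_functions_bounded[OF test_functions_partial_deriv[OF assms]] by metis
  then obtain c where c: "\<And>i x. \<bar>partial_deriv i f x\<bar> \<le> c i" by metis
  obtain c0 where c0: "0 \<le> c0" "\<And>x. \<bar>f x\<bar> \<le> c0" using test_functions_bounded[OF assms] by metis
  have n: "norm (gradient f x) \<le> (\<Sum>i\<in>UNIV. c i)" for x
    by (rule order_trans[OF norm_le_l1_cart], rule sum_mono) (simp add: c)
  have "0 \<le> (\<Sum>i\<in>UNIV. c i)" using n[of undefined] norm_ge_zero order_trans by blast
  then show ?thesis using c0 n by (intro that[of "c0 + (\<Sum>i\<in>UNIV. c i) + 1"]) (auto simp: add_increasing add_increasing2)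
qed

lemma test_function_gradient_outside_support:
  "f \<in> test_functions \<Omega> \<Longrightarrow> x \<notin> support f \<Longrightarrow> gradient f x = 0"
  by (auto simp: vec_eq_iff elim!: test_functionsE)

lemma gradient_add:
  "smooth f \<Longrightarrow> smooth g \<Longrightarrow> gradient (\<lambda>x. f x + g x) x = gradient f x + gradient g x"
  by (simp add: vec_eq_iff partial_deriv_add smooth_imp_differentiable)

lemma gradient_cmult: "smooth f \<Longrightarrow> gradient (\<lambda>x. r * f x) x = r *\<^sub>R gradient f x"
  using partial_deriv_mult[of "\<lambda>_. r" x f] 
  by (simp add: vec_eq_iff partial_deriv_const smooth_imp_differentiable)

lemma gradient_power2: "smooth f \<Longrightarrow> gradient (\<lambda>x. (f x)\<^sup>2) x = (2 * f x) *\<^sub>R gradient f x"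
  by (simp add: vec_eq_iff partial_deriv_power2)

lemma L2_locD: "g \<in> L2_loc \<Omega> \<Longrightarrow> g \<in> borel_measurable (lebesgue_on \<Omega>)"
  "g \<in> L2_loc \<Omega> \<Longrightarrow> (\<lambda>x. (norm (g x))\<^sup>2) \<in> L1_loc \<Omega>"
  by (auto simp: L2_loc_def)

lemma norm_diff_square_le:
  fixes a b :: "'a::real_normed_vector"
  shows "(norm (a - b))\<^sup>2 \<le> 2 * (norm a)\<^sup>2 + 2 * (norm b)\<^sup>2"
proof -
  have "(norm (a - b))\<^sup>2 \<le> (norm a + norm b)\<^sup>2"
    by (intro power_mono norm_triangle_ineq4) auto
  also have "\<dots> \<le> 2 * (norm a)\<^sup>2 + 2 * (norm b)\<^sup>2"
    using sum_squares_bound[of "norm a" "norm b"] by (simp add: power2_sum)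
  finally show ?thesis .
qed

section \<open>The Riccati functional of a coercive form\<close>

text \<open>The setting of the converse: \<open>Q\<close> is a representative of \<open>P\<close> for which symmetry and ellipticity hold at every point,
  so that inequalities between integrals come from pointwise ones.\<close>

locale coercive_form =
  fixes \<Omega> :: "(real^'n) set" and Q :: "real^'n \<Rightarrow> real^'n^'n" and m M :: real and \<sigma> :: "'n distr"
  assumes open_dom: "open \<Omega>"
    and Q_meas: "Q \<in> borel_measurable (lebesgue_on \<Omega>)"
    and Q_sym: "\<And>x j k. Q x $ j $ k = Q x $ k $ j"
    and m_pos: "0 < m"
    and Q_lower: "\<And>x \<xi>. m * (norm \<xi>)\<^sup>2 \<le> (Q x *v \<xi>) \<bullet> \<xi>"
    and Q_upper: "\<And>x \<xi>. (Q x *v \<xi>) \<bullet> \<xi> \<le> M * (norm \<xi>)\<^sup>2"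
    and lin: "test_linear \<Omega> \<sigma>"
    and form_nonneg: "\<And>h. h \<in> test_functions \<Omega> \<Longrightarrow>
      \<sigma> (\<lambda>x. (h x)\<^sup>2) \<le> (\<integral>x. (Q x *v gradient h x) \<bullet> gradient h x \<partial>lebesgue_on \<Omega>)"
begin

lemma Q_nonneg: "0 \<le> (Q x *v \<xi>) \<bullet> \<xi>"
  using Q_lower[of \<xi> x] m_pos by (meson less_imp_le mult_nonneg_nonneg order_trans zero_le_power2)

lemma M_pos: "0 < M"
proof -
  have "m * (norm (axis undefined 1 :: real^'n))\<^sup>2 \<le> M * (norm (axis undefined 1 :: real^'n))\<^sup>2"
    using Q_lower Q_upper order_trans by blast
  then show ?thesis using m_pos by (simp add: norm_axis_1)
qed

text \<open>Normalize both vectors and use the bound on cross terms.\<close>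

lemma Q_cauchy_schwarz: "\<bar>(Q x *v \<xi>) \<bullet> \<zeta>\<bar> \<le> M * norm \<xi> * norm \<zeta>"
proof (cases "\<xi> = 0 \<or> \<zeta> = 0")
  case False
  define a b where "a = 1 / norm \<xi>" and "b = 1 / norm \<zeta>"
  have ab: "0 < a" "0 < b" using False by (auto simp: a_def b_def)
  have n: "norm (a *\<^sub>R \<xi>) = 1" "norm (b *\<^sub>R \<zeta>) = 1" using False by (auto simp: a_def b_def)
  have "2 * \<bar>(Q x *v (a *\<^sub>R \<xi>)) \<bullet> (b *\<^sub>R \<zeta>)\<bar> \<le> M + M"
    using nonneg_form_cross_bound[OF Q_sym Q_nonneg, of x "a *\<^sub>R \<xi>" "b *\<^sub>R \<zeta>"]
      Q_upper[of x "a *\<^sub>R \<xi>"] Q_upper[of x "b *\<^sub>R \<zeta>"] unfolding n by simp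
  then have "a * b * \<bar>(Q x *v \<xi>) \<bullet> \<zeta>\<bar> \<le> M"
    using ab by (simp add: matrix_vector_mult_scaleR abs_mult mult_ac)
  then show ?thesis using False by (simp add: a_def b_def field_simps)
qed auto

text \<open>The integral part of the functional \<open>F(g, \<phi>)\<close>; \<open>riccati \<phi> g \<le> 0\<close> is the Riccati inequality
  tested with \<open>\<phi>\<close>.\<close>

definition riccati_density :: "(real^'n \<Rightarrow> real) \<Rightarrow> (real^'n \<Rightarrow> real^'n) \<Rightarrow> real^'n \<Rightarrow> real" where
  "riccati_density \<phi> g x = (Q x *v g x) \<bullet> gradient \<phi> x + \<phi> x * ((Q x *v g x) \<bullet> g x)"

definition riccati :: "(real^'n \<Rightarrow> real) \<Rightarrow> (real^'n \<Rightarrow> real^'n) \<Rightarrow> real" where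
  "riccati \<phi> g = \<sigma> \<phi> + (\<integral>x. riccati_density \<phi> g x \<partial>lebesgue_on \<Omega>)"

definition nonneg_tests :: "(real^'n \<Rightarrow> real) set" where
  "nonneg_tests = {\<phi> \<in> test_functions \<Omega>. \<forall>x. 0 \<le> \<phi> x}"

text \<open>A convex class of competitors on which every integral in sight converges. Fields with compact support have finite
  norm no matter how fast the weights of that norm have to decay.\<close>

definition bounded_fields :: "(real^'n \<Rightarrow> real^'n) set" where
  "bounded_fields = {g \<in> borel_measurable (lebesgue_on \<Omega>).
     \<exists>K B. compact K \<and> K \<subseteq> \<Omega> \<and> (\<forall>x. norm (g x) \<le> B) \<and> (\<forall>x. x \<notin> K \<longrightarrow> g x = 0)}"

lemma bounded_fields_L2_loc:
  assumes "g \<in> bounded_fields" shows "g \<in> L2_loc \<Omega>"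
proof -
  from assms obtain B where g: "g \<in> borel_measurable (lebesgue_on \<Omega>)" "\<And>x. norm (g x) \<le> B"
    by (auto simp: bounded_fields_def)
  have "(norm (g x))\<^sup>2 \<le> B\<^sup>2" for x using g(2) by (intro power_mono) auto
  then have "(\<lambda>x. (norm (g x))\<^sup>2) \<in> L1_loc \<Omega>"
    using g(1) by (intro L1_loc_dominated[OF open_dom _ L1_loc_const[of "B\<^sup>2"]]) auto
  with g(1) show ?thesis by (simp add: L2_loc_def)
qed

lemma bounded_fields_combination:
  assumes "g \<in> bounded_fields" "g' \<in> bounded_fields"
  shows "(\<lambda>x. s *\<^sub>R g x + t *\<^sub>R g' x) \<in> bounded_fields"
proof -
  from assms obtain K B K' B' where *: "g \<in> borel_measurable (lebesgue_on \<Omega>)"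
    "g' \<in> borel_measurable (lebesgue_on \<Omega>)" "compact K" "K \<subseteq> \<Omega>" "compact K'" "K' \<subseteq> \<Omega>"
    "\<And>x. norm (g x) \<le> B" "\<And>x. norm (g' x) \<le> B'" "\<And>x. x \<notin> K \<Longrightarrow> g x = 0" "\<And>x. x \<notin> K' \<Longrightarrow> g' x = 0"
    unfolding bounded_fields_def by blast
  have "norm (s *\<^sub>R g x + t *\<^sub>R g' x) \<le> \<bar>s\<bar> * B + \<bar>t\<bar> * B'" for x
    using * by (intro norm_triangle_le add_mono) (auto intro: mult_left_mono)
  moreover have "(\<lambda>x. s *\<^sub>R g x + t *\<^sub>R g' x) \<in> borel_measurable (lebesgue_on \<Omega>)"
    using *(1,2) by measurable
  ultimately show ?thesis
    using * unfolding bounded_fields_def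
    by (intro CollectI conjI exI[of _ "K \<union> K'"] exI[of _ "\<bar>s\<bar> * B + \<bar>t\<bar> * B'"]) auto
qed

lemma form_measurable:
  "u \<in> borel_measurable (lebesgue_on \<Omega>) \<Longrightarrow> v \<in> borel_measurable (lebesgue_on \<Omega>) \<Longrightarrow>
    (\<lambda>x. (Q x *v u x) \<bullet> v x) \<in> borel_measurable (lebesgue_on \<Omega>)"
  by (rule borel_measurable_matrix_form[OF Q_meas])

lemma riccati_density_integrable:
  assumes g: "g \<in> L2_loc \<Omega>" and \<phi>: "\<phi> \<in> test_functions \<Omega>"
  shows "integrable (lebesgue_on \<Omega>) (riccati_density \<phi> g)"
proof (rule test_functionsE[OF \<phi>])
  assume K: "compact (support \<phi>)" "support \<phi> \<subseteq> \<Omega>" "\<And>x. x \<notin> support \<phi> \<Longrightarrow> \<phi> x = 0"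
  obtain C where C: "0 < C" "\<And>x. \<bar>\<phi> x\<bar> \<le> C" "\<And>x. norm (gradient \<phi> x) \<le> C"
    using test_function_gradient_bounded[OF \<phi>] by blast
  have "riccati_density \<phi> g \<in> borel_measurable (lebesgue_on \<Omega>)"
    unfolding riccati_density_def[abs_def]
    by (intro borel_measurable_add borel_measurable_times form_measurable L2_locD g
        borel_measurable_gradient[OF \<phi>] test_functions_borel_measurable[OF \<phi>])
  moreover have "(\<lambda>x. M * C * (1 + 2 * (norm (g x))\<^sup>2)) \<in> L1_loc \<Omega>"
    by (intro L1_loc_cmult L1_loc_add L1_loc_const L2_locD g)
  moreover have "\<bar>riccati_density \<phi> g x\<bar> \<le> M * C * (1 + 2 * (norm (g x))\<^sup>2)" for x
  proof -
    have "\<bar>(Q x *v g x) \<bullet> gradient \<phi> x\<bar> \<le> M * norm (g x) * norm (gradient \<phi> x)"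
      by (rule Q_cauchy_schwarz)
    also have "\<dots> \<le> M * norm (g x) * C"
      using M_pos C by (intro mult_left_mono) auto
    finally have 1: "\<bar>(Q x *v g x) \<bullet> gradient \<phi> x\<bar> \<le> M * C * norm (g x)" by (simp add: mult_ac)
    have "\<bar>\<phi> x * ((Q x *v g x) \<bullet> g x)\<bar> \<le> C * (M * (norm (g x))\<^sup>2)"
      unfolding abs_mult using C Q_upper Q_nonneg by (intro mult_mono) auto
    then have "\<bar>riccati_density \<phi> g x\<bar> \<le> M * C * (norm (g x) + (norm (g x))\<^sup>2)"
      using 1 unfolding riccati_density_def by (simp add: algebra_simps)
    also have "\<dots> \<le> M * C * (1 + 2 * (norm (g x))\<^sup>2)"
    proof (intro mult_left_mono)
      have "0 \<le> (norm (g x) - 1 / 2)\<^sup>2" by simp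
      then show "norm (g x) + (norm (g x))\<^sup>2 \<le> 1 + 2 * (norm (g x))\<^sup>2"
        by (simp add: power2_eq_square algebra_simps)
    qed (use M_pos C in auto)
    finally show ?thesis .
  qed
  ultimately show ?thesis
    using K by (intro compactly_supported_integrable[OF open_dom, where K = "support \<phi>"])
      (auto simp: riccati_density_def test_function_gradient_outside_support[OF \<phi>])
qed

lemma energy_integrable:
  assumes h: "h \<in> test_functions \<Omega>"
  shows "integrable (lebesgue_on \<Omega>) (\<lambda>x. (Q x *v gradient h x) \<bullet> gradient h x)"
proof (rule test_functionsE[OF h])
  assume K: "compact (support h)" "support h \<subseteq> \<Omega>"
  obtain C where C: "0 < C" "\<And>x. \<bar>h x\<bar> \<le> C" "\<And>x. norm (gradient h x) \<le> C"
    using test_function_gradient_bounded[OF h] by blast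
  have "\<bar>(Q x *v gradient h x) \<bullet> gradient h x\<bar> \<le> M * C\<^sup>2" for x
  proof -
    have "\<bar>(Q x *v gradient h x) \<bullet> gradient h x\<bar> \<le> M * (norm (gradient h x))\<^sup>2"
      using Q_upper Q_nonneg by simp
    also have "\<dots> \<le> M * C\<^sup>2" using M_pos C by (intro mult_left_mono power_mono) auto
    finally show ?thesis .
  qed
  then show ?thesis
    using K by (intro compactly_supported_integrable[OF open_dom _ L1_loc_const[of "M * C\<^sup>2"], where K = "support h"]
        form_measurable borel_measurable_gradient[OF h])
      (auto simp: test_function_gradient_outside_support[OF h])
qed

lemma riccati_add:
  assumes "g \<in> L2_loc \<Omega>" "\<phi> \<in> test_functions \<Omega>" "\<psi> \<in> test_functions \<Omega>"
  shows "riccati (\<lambda>x. \<phi> x + \<psi> x) g = riccati \<phi> g + riccati \<psi> g"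
proof -
  have "riccati_density (\<lambda>x. \<phi> x + \<psi> x) g = (\<lambda>x. riccati_density \<phi> g x + riccati_density \<psi> g x)"
    using assms(2,3)[THEN test_functions_smooth]
    by (auto simp: riccati_density_def gradient_add inner_add_right distrib_right)
  then show ?thesis
    using assms test_linearD(1)[OF lin assms(2,3)] unfolding riccati_def
    by (simp add: Bochner_Integration.integral_add riccati_density_integrable)
qed

lemma riccati_cmult:
  assumes "g \<in> L2_loc \<Omega>" "\<phi> \<in> test_functions \<Omega>"
  shows "riccati (\<lambda>x. r * \<phi> x) g = r * riccati \<phi> g"
proof -
  have "riccati_density (\<lambda>x. r * \<phi> x) g = (\<lambda>x. r * riccati_density \<phi> g x)"
    using assms(2)[THEN test_functions_smooth]
    by (auto simp: riccati_density_def gradient_cmult distrib_left mult.assoc)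
  then show ?thesis
    using assms test_linearD(2)[OF lin assms(2)] unfolding riccati_def
    by (simp add: riccati_density_integrable distrib_left)
qed

lemma riccati_sum:
  assumes g: "g \<in> L2_loc \<Omega>" and "finite \<Phi>" "\<Phi> \<subseteq> nonneg_tests" "\<And>\<phi>. \<phi> \<in> \<Phi> \<Longrightarrow> 0 \<le> w \<phi>"
  shows "(\<lambda>x. \<Sum>\<phi>\<in>\<Phi>. w \<phi> * \<phi> x) \<in> nonneg_tests"
    and "riccati (\<lambda>x. \<Sum>\<phi>\<in>\<Phi>. w \<phi> * \<phi> x) g = (\<Sum>\<phi>\<in>\<Phi>. w \<phi> * riccati \<phi> g)"
proof -
  have "(\<lambda>x. \<Sum>\<phi>\<in>\<Phi>. w \<phi> * \<phi> x) \<in> nonneg_tests \<and>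
      riccati (\<lambda>x. \<Sum>\<phi>\<in>\<Phi>. w \<phi> * \<phi> x) g = (\<Sum>\<phi>\<in>\<Phi>. w \<phi> * riccati \<phi> g)"
    using assms(2-4)
  proof (induction \<Phi> rule: finite_induct)
    case empty
    show ?case using riccati_cmult[OF g test_functions_zero, of 0]
      by (simp add: nonneg_tests_def test_functions_zero)
  next
    case (insert \<psi> \<Phi>)
    then have t: "\<psi> \<in> test_functions \<Omega>" "(\<lambda>x. \<Sum>\<phi>\<in>\<Phi>. w \<phi> * \<phi> x) \<in> test_functions \<Omega>"
      by (auto simp: nonneg_tests_def)
    let ?s = "\<lambda>x. w \<psi> * \<psi> x + (\<Sum>\<phi>\<in>\<Phi>. w \<phi> * \<phi> x)"
    have "?s \<in> test_functions \<Omega>" by (intro test_functions_add test_functions_scale t)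
    moreover have "0 \<le> ?s x" for x
      using insert by (auto simp: nonneg_tests_def)
    moreover have "riccati ?s g = w \<psi> * riccati \<psi> g + (\<Sum>\<phi>\<in>\<Phi>. w \<phi> * riccati \<phi> g)"
      using insert riccati_add[OF g test_functions_scale[OF t(1), of "w \<psi>"] t(2)] riccati_cmult[OF g t(1), of "w \<psi>"]
      by simp
    ultimately show ?case using insert.hyps by (simp add: nonneg_tests_def)
  qed
  then show "(\<lambda>x. \<Sum>\<phi>\<in>\<Phi>. w \<phi> * \<phi> x) \<in> nonneg_tests"
    "riccati (\<lambda>x. \<Sum>\<phi>\<in>\<Phi>. w \<phi> * \<phi> x) g = (\<Sum>\<phi>\<in>\<Phi>. w \<phi> * riccati \<phi> g)" by auto
qed

text \<open>The defect of convexity is \<open>t(1 - t) \<phi> Q(g - g')\<sqdot>(g - g') \<ge> 0\<close>.\<close>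

lemma riccati_convex:
  assumes \<phi>: "\<phi> \<in> nonneg_tests" and g: "g \<in> bounded_fields" "g' \<in> bounded_fields" and t: "0 \<le> t" "t \<le> 1"
  shows "riccati \<phi> (\<lambda>x. (1 - t) *\<^sub>R g x + t *\<^sub>R g' x) \<le> (1 - t) * riccati \<phi> g + t * riccati \<phi> g'"
proof -
  let ?z = "\<lambda>x. (1 - t) *\<^sub>R g x + t *\<^sub>R g' x"
  have \<phi>': "\<phi> \<in> test_functions \<Omega>" "\<And>x. 0 \<le> \<phi> x" using \<phi> by (auto simp: nonneg_tests_def)
  note int = riccati_density_integrable[OF bounded_fields_L2_loc \<phi>'(1)]
  have "(\<integral>x. riccati_density \<phi> ?z x \<partial>lebesgue_on \<Omega>)
      \<le> (\<integral>x. (1 - t) * riccati_density \<phi> g x + t * riccati_density \<phi> g' x \<partial>lebesgue_on \<Omega>)"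
  proof (intro integral_mono int bounded_fields_combination g Bochner_Integration.integrable_add
      integrable_mult_right)
    fix x
    let ?B = "\<lambda>\<xi> \<zeta>. (Q x *v \<xi>) \<bullet> \<zeta>"
    have sq: "?B (a *\<^sub>R \<xi> + b *\<^sub>R \<zeta>) (a *\<^sub>R \<xi> + b *\<^sub>R \<zeta>) = a\<^sup>2 * ?B \<xi> \<xi> + 2 * a * b * ?B \<xi> \<zeta> + b\<^sup>2 * ?B \<zeta> \<zeta>"
      for a b \<xi> \<zeta> by (rule symmetric_form_square[OF Q_sym])
    have "0 \<le> (t * (1 - t)) * ?B (1 *\<^sub>R g x + (-1) *\<^sub>R g' x) (1 *\<^sub>R g x + (-1) *\<^sub>R g' x)"
      using t Q_nonneg by (intro mult_nonneg_nonneg) auto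
    then have "?B (?z x) (?z x) \<le> (1 - t) * ?B (g x) (g x) + t * ?B (g' x) (g' x)"
      unfolding sq by (simp add: power2_eq_square algebra_simps)
    from mult_left_mono[OF this \<phi>'(2)[of x]]
    show "riccati_density \<phi> ?z x \<le> (1 - t) * riccati_density \<phi> g x + t * riccati_density \<phi> g' x"
      unfolding riccati_density_def
      by (simp add: matrix_vector_right_distrib matrix_vector_mult_scaleR inner_add_left inner_add_right algebra_simps)
  qed
  also have "\<dots> = (1 - t) * (\<integral>x. riccati_density \<phi> g x \<partial>lebesgue_on \<Omega>)
      + t * (\<integral>x. riccati_density \<phi> g' x \<partial>lebesgue_on \<Omega>)"
    using int g by simp
  finally show ?thesis unfolding riccati_def by (simp add: algebra_simps)
qed

definition energy :: "(real^'n \<Rightarrow> real) \<Rightarrow> real" where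
  "energy h = (\<integral>x. (Q x *v gradient h x) \<bullet> gradient h x \<partial>lebesgue_on \<Omega>)"

text \<open>Take \<open>h = \<surd>(\<phi> + \<delta>) - \<surd>\<delta> + \<surd>\<delta> \<eta>\<close>, where \<open>\<eta>\<close> is a cutoff equal to 1 near the support of \<open>\<phi>\<close>. Near that support
  \<open>h = \<surd>(\<phi> + \<delta>)\<close> and off it \<open>h = \<surd>\<delta> \<eta>\<close>, so that \<open>h\<close> is a test function with \<open>h\<^sup>2 = \<phi> + \<delta>\<eta>\<^sup>2\<close>. The competitor
  \<open>g = -\<nabla>\<phi>/(2(\<phi> + \<delta>))\<close> is bounded and equals \<open>-\<nabla>h/h\<close> near the support. Comparison with the energy of \<open>h\<close> leaves an error of order \<open>\<delta>\<close>.\<close>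

lemma riccati_single_test:
  assumes \<phi>: "\<phi> \<in> nonneg_tests" and "0 < \<epsilon>"
  shows "\<exists>g\<in>bounded_fields. riccati \<phi> g \<le> \<epsilon>"
proof -
  have \<phi>t: "\<phi> \<in> test_functions \<Omega>" and \<phi>0: "\<And>x. 0 \<le> \<phi> x" using \<phi> by (auto simp: nonneg_tests_def)
  have \<phi>s: "smooth \<phi>" "compact (support \<phi>)" "support \<phi> \<subseteq> \<Omega>" "\<And>x. x \<notin> support \<phi> \<Longrightarrow> \<phi> x = 0"
    using test_functionsE[OF \<phi>t] by blast+
  obtain \<eta> U where \<eta>t: "\<eta> \<in> test_functions \<Omega>" and U: "open U" "support \<phi> \<subseteq> U" "\<And>x. x \<in> U \<Longrightarrow> \<eta> x = 1"
    and \<eta>0: "\<And>x. 0 \<le> \<eta> x" "\<And>x. \<eta> x \<le> 1"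
    using cutoff_function_exists[OF open_dom \<phi>s(2,3)] by metis
  have \<eta>s: "smooth \<eta>" "compact (support \<eta>)" "support \<eta> \<subseteq> \<Omega>" "\<And>x. x \<notin> support \<eta> \<Longrightarrow> \<eta> x = 0"
    using test_functionsE[OF \<eta>t] by blast+
  define e where "e = energy \<eta> - \<sigma> (\<lambda>x. (\<eta> x)\<^sup>2)"
  \<comment> \<open>The value of the functional will turn out to be at most \<open>\<delta> e\<close>.\<close>
  define \<delta> where "\<delta> = \<epsilon> / (\<bar>e\<bar> + 1)"
  have \<delta>: "0 < \<delta>" "\<delta> * e \<le> \<epsilon>"
  proof -
    show "0 < \<delta>" using \<open>0 < \<epsilon>\<close> by (auto simp: \<delta>_def)
    then have "\<delta> * e \<le> \<delta> * (\<bar>e\<bar> + 1)" by (intro mult_left_mono) auto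
    then show "\<delta> * e \<le> \<epsilon>" by (simp add: \<delta>_def)
  qed
  define r where "r x = sqrt (\<phi> x + \<delta>)" for x
  have s_pos: "0 < \<phi> x + \<delta>" for x using \<phi>0[of x] \<delta>(1) by linarith
  have r: "0 < r x" "(r x)\<^sup>2 = \<phi> x + \<delta>" for x using s_pos[of x] by (auto simp: r_def)
  have r_smooth: "smooth r"
  proof -
    have "smooth (\<lambda>x. (\<phi> x + \<delta>) powr (1 / 2))"
      by (intro smooth_powr smooth_add \<phi>s smooth_const s_pos)
    moreover have "(\<lambda>x. (\<phi> x + \<delta>) powr (1 / 2)) = r"
      using s_pos by (auto simp: r_def powr_half_sqrt less_imp_le)
    ultimately show ?thesis by simp
  qed
  define h where "h x = r x + (sqrt \<delta> * \<eta> x + - sqrt \<delta>)" for x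
  have h_smooth: "smooth h"
    unfolding h_def[abs_def] by (intro smooth_add smooth_mult smooth_const r_smooth \<eta>s)
  have h_test: "h \<in> test_functions \<Omega>"
  proof (rule test_functionsI[OF h_smooth])
    show "compact (support \<phi> \<union> support \<eta>)" "support \<phi> \<union> support \<eta> \<subseteq> \<Omega>" using \<phi>s \<eta>s by auto
    show "h x = 0" if "x \<notin> support \<phi> \<union> support \<eta>" for x
      using that \<phi>s(4) \<eta>s(4) by (auto simp: h_def r_def)
  qed
  have h_sq: "(h x)\<^sup>2 = \<phi> x + \<delta> * (\<eta> x)\<^sup>2" for x
  proof (cases "x \<in> U")
    case True
    then show ?thesis using U(3)[of x] r(2)[of x] by (simp add: h_def)
  next
    case False
    then have "\<phi> x = 0" using U(2) \<phi>s(4) by blast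
    then show ?thesis using \<delta>(1) by (simp add: h_def r_def power_mult_distrib)
  qed
  have grad_r: "gradient r x = (1 / (2 * r x)) *\<^sub>R gradient \<phi> x" for x
  proof -
    have "((\<lambda>t. sqrt (t + \<delta>)) has_real_derivative 1 / (2 * r x)) (at (\<phi> x))"
      using DERIV_real_sqrt[OF s_pos[of x]]
      by (simp add: DERIV_shift[symmetric] r_def inverse_eq_divide mult.commute)
    then have "partial_deriv i (\<lambda>x. sqrt (\<phi> x + \<delta>)) x = 1 / (2 * r x) * partial_deriv i \<phi> x" for i
      by (rule partial_deriv_compose[where d = "\<lambda>t. sqrt (t + \<delta>)" and f = \<phi>,
            OF smooth_imp_differentiable[OF \<phi>s(1)]])
    then show ?thesis by (simp add: vec_eq_iff r_def[abs_def])
  qed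
  have grad_h: "gradient h x = (1 / (2 * r x)) *\<^sub>R gradient \<phi> x + sqrt \<delta> *\<^sub>R gradient \<eta> x" for x
  proof -
    have "gradient (\<lambda>x. - sqrt \<delta>) x = 0" by (simp add: vec_eq_iff partial_deriv_const)
    then show ?thesis unfolding h_def[abs_def]
      using gradient_add[OF r_smooth smooth_add[OF smooth_mult[OF smooth_const \<eta>s(1)] smooth_const]]
        gradient_add[OF smooth_mult[OF smooth_const \<eta>s(1)] smooth_const]
      by (simp add: grad_r gradient_cmult[OF \<eta>s(1)] del: add_uminus_conv_diff)
  qed
  \<comment> \<open>This removes the cross term from the energy of \<open>h\<close>.\<close>
  have disj: "gradient \<phi> x = 0 \<or> gradient \<eta> x = 0" for x
  proof (cases "x \<in> U")
    case True
    have "((\<lambda>x. 1) has_derivative (\<lambda>h. 0 :: real)) (at x)" by simp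
    then have "(\<eta> has_derivative (\<lambda>h. 0)) (at x)"
      by (rule has_derivative_transform_within_open[OF _ U(1) True]) (simp add: U(3))
    then have "gradient \<eta> x = 0" by (simp add: vec_eq_iff partial_deriv_eqI)
    then show ?thesis ..
  next
    case False
    then show ?thesis using U(2) test_function_gradient_outside_support[OF \<phi>t, of x] by blast
  qed
  define g where "g x = (- 1 / (2 * (\<phi> x + \<delta>))) *\<^sub>R gradient \<phi> x" for x
  obtain C where C: "0 < C" "\<And>x. \<bar>\<phi> x\<bar> \<le> C" "\<And>x. norm (gradient \<phi> x) \<le> C"
    using test_function_gradient_bounded[OF \<phi>t] by blast
  have g_bounded: "g \<in> bounded_fields"
    unfolding bounded_fields_def
  proof (intro CollectI conjI exI allI impI)
    show "g \<in> borel_measurable (lebesgue_on \<Omega>)"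
      unfolding g_def[abs_def]
      by (intro borel_measurable_scaleR borel_measurable_divide borel_measurable_times borel_measurable_add
          borel_measurable_const borel_measurable_gradient[OF \<phi>t] test_functions_borel_measurable[OF \<phi>t])
    show "compact (support \<phi>)" "support \<phi> \<subseteq> \<Omega>" by fact+
    show "norm (g x) \<le> 1 / (2 * \<delta>) * C" for x
    proof -
      have "norm (g x) = 1 / (2 * (\<phi> x + \<delta>)) * norm (gradient \<phi> x)"
        using s_pos[of x] by (simp add: g_def)
      also have "\<dots> \<le> 1 / (2 * \<delta>) * C"
        using C \<delta>(1) \<phi>0[of x] by (intro mult_mono divide_left_mono) auto
      finally show ?thesis .
    qed
    show "g x = 0" if "x \<notin> support \<phi>" for x
      using test_function_gradient_outside_support[OF \<phi>t that] by (simp add: g_def)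
  qed
  have pointwise: "riccati_density \<phi> g x + (Q x *v gradient h x) \<bullet> gradient h x
      \<le> \<delta> * ((Q x *v gradient \<eta> x) \<bullet> gradient \<eta> x)" for x
  proof -
    let ?b = "(Q x *v gradient \<phi> x) \<bullet> gradient \<phi> x" and ?s = "\<phi> x + \<delta>"
    have "(1 / (2 * r x))\<^sup>2 = 1 / (4 * ?s)" using r(2)[of x] by (simp add: power_divide power_mult_distrib)
    then have "(Q x *v gradient h x) \<bullet> gradient h x
        = 1 / (4 * ?s) * ?b + \<delta> * ((Q x *v gradient \<eta> x) \<bullet> gradient \<eta> x)"
      unfolding grad_h symmetric_form_square[OF Q_sym] using disj[of x] \<delta>(1) by auto
    moreover have "riccati_density \<phi> g x = (\<phi> x / (4 * ?s\<^sup>2) - 1 / (2 * ?s)) * ?b"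
    proof -
      define k where "k = - 1 / (2 * ?s)"
      have "riccati_density \<phi> g x = (k + \<phi> x * k\<^sup>2) * ?b"
        unfolding riccati_density_def g_def k_def[symmetric]
        by (simp add: matrix_vector_mult_scaleR power2_eq_square algebra_simps)
      moreover have "k + \<phi> x * k\<^sup>2 = \<phi> x / (4 * ?s\<^sup>2) - 1 / (2 * ?s)"
        unfolding k_def power_divide power_mult_distrib by simp
      ultimately show ?thesis by simp
    qed
    moreover have "(\<phi> x / (4 * ?s\<^sup>2) - 1 / (2 * ?s)) * ?b \<le> - (1 / (4 * ?s)) * ?b"
    proof (rule mult_right_mono[OF _ Q_nonneg])
      have "\<phi> x / (4 * ?s\<^sup>2) \<le> ?s / (4 * ?s\<^sup>2)"
        using \<delta>(1) s_pos[of x] by (intro divide_right_mono) auto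
      also have "\<dots> = 1 / (4 * ?s)" by (simp add: power2_eq_square)
      also have "\<dots> = 1 / (2 * ?s) - 1 / (4 * ?s)" using s_pos[of x] by (simp add: field_simps)
      finally show "\<phi> x / (4 * ?s\<^sup>2) - 1 / (2 * ?s) \<le> - (1 / (4 * ?s))" by linarith
    qed
    ultimately show ?thesis by (simp add: algebra_simps)
  qed
  note int = riccati_density_integrable[OF bounded_fields_L2_loc[OF g_bounded] \<phi>t]
  have "(\<integral>x. riccati_density \<phi> g x \<partial>lebesgue_on \<Omega>) + energy h
      = (\<integral>x. riccati_density \<phi> g x + (Q x *v gradient h x) \<bullet> gradient h x \<partial>lebesgue_on \<Omega>)"
    unfolding energy_def using int energy_integrable[OF h_test] by simp
  also have "\<dots> \<le> (\<integral>x. \<delta> * ((Q x *v gradient \<eta> x) \<bullet> gradient \<eta> x) \<partial>lebesgue_on \<Omega>)"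
    by (intro integral_mono pointwise Bochner_Integration.integrable_add int energy_integrable[OF h_test]
        integrable_mult_right energy_integrable[OF \<eta>t])
  also have "\<dots> = \<delta> * energy \<eta>" by (simp add: energy_def)
  finally have "(\<integral>x. riccati_density \<phi> g x \<partial>lebesgue_on \<Omega>) \<le> \<delta> * energy \<eta> - energy h" by linarith
  moreover have "\<sigma> \<phi> + \<delta> * \<sigma> (\<lambda>x. (\<eta> x)\<^sup>2) = \<sigma> (\<lambda>x. (h x)\<^sup>2)"
    unfolding h_sq using test_functions_power2[OF \<eta>t]
    by (simp add: test_linearD[OF lin] \<phi>t test_functions_scale)
  moreover have "\<sigma> (\<lambda>x. (h x)\<^sup>2) \<le> energy h" unfolding energy_def by (rule form_nonneg[OF h_test])
  ultimately have "riccati \<phi> g \<le> \<delta> * e" unfolding riccati_def e_def by (simp add: algebra_simps)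
  then show ?thesis using g_bounded \<delta>(2) by (intro bexI[of _ g]) auto
qed

lemma zero_bounded_field: "(\<lambda>x. 0) \<in> bounded_fields"
  unfolding bounded_fields_def
  by (intro CollectI conjI exI[of _ "{} :: (real^'n) set"] exI[of _ "0 :: real"]) auto

text \<open>If no field works, the alternative yields nonnegative weights \<open>w\<close> for which \<open>\<Sum> w \<phi> * riccati \<phi> g\<close> stays above a positive
  number for all \<open>g\<close>. By linearity this sum is the value at the single test function \<open>\<Sum> w \<phi> * \<phi>\<close>, which contradicts
  the previous lemma.\<close>

lemma riccati_finitely_many_tests:
  assumes "finite \<Phi>" "\<Phi> \<subseteq> nonneg_tests" "0 < \<epsilon>"
  shows "\<exists>g\<in>bounded_fields. \<forall>\<phi>\<in>\<Phi>. riccati \<phi> g \<le> \<epsilon>"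
proof (cases "\<Phi> = {}")
  case True
  then show ?thesis using zero_bounded_field by auto
next
  case False
  show ?thesis
  proof (rule ccontr)
    assume *: "\<not> ?thesis"
    define F where "F \<phi> g = riccati \<phi> g - \<epsilon>" for \<phi> g
    have "\<exists>w. (\<forall>\<phi>\<in>\<Phi>. 0 \<le> w \<phi>) \<and> 0 < (\<Sum>\<phi>\<in>\<Phi>. w \<phi>) \<and>
        (\<forall>g\<in>bounded_fields. 0 \<le> (\<Sum>\<phi>\<in>\<Phi>. w \<phi> * F \<phi> g))"
    proof (rule convexlike_alternative[OF assms(1) False])
      show "bounded_fields \<noteq> {}" using zero_bounded_field by blast
      show "\<not> (\<exists>g\<in>bounded_fields. \<forall>\<phi>\<in>\<Phi>. F \<phi> g < 0)" using * by (force simp: F_def)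
      fix g g' and t :: real
      assume g: "g \<in> bounded_fields" "g' \<in> bounded_fields" and t: "0 \<le> t" "t \<le> 1"
      let ?z = "\<lambda>x. (1 - t) *\<^sub>R g x + t *\<^sub>R g' x"
      have "F \<phi> ?z \<le> (1 - t) * F \<phi> g + t * F \<phi> g'" if "\<phi> \<in> \<Phi>" for \<phi>
        using riccati_convex[OF _ g t, of \<phi>] that assms(2) by (auto simp: F_def algebra_simps)
      then show "\<exists>z\<in>bounded_fields. \<forall>\<phi>\<in>\<Phi>. F \<phi> z \<le> (1 - t) * F \<phi> g + t * F \<phi> g'"
        using bounded_fields_combination[OF g] by blast
    qed
    then obtain w where w: "\<And>\<phi>. \<phi> \<in> \<Phi> \<Longrightarrow> 0 \<le> w \<phi>" "0 < (\<Sum>\<phi>\<in>\<Phi>. w \<phi>)"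
      "\<And>g. g \<in> bounded_fields \<Longrightarrow> 0 \<le> (\<Sum>\<phi>\<in>\<Phi>. w \<phi> * F \<phi> g)" by blast
    define W where "W = (\<Sum>\<phi>\<in>\<Phi>. w \<phi>)"
    note sum = riccati_sum[OF bounded_fields_L2_loc assms(1,2), of _ w, OF _ w(1)]
    have "0 < \<epsilon> * W / 2" using assms(3) w(2) by (simp add: W_def)
    then obtain g where g: "g \<in> bounded_fields" "riccati (\<lambda>x. \<Sum>\<phi>\<in>\<Phi>. w \<phi> * \<phi> x) g \<le> \<epsilon> * W / 2"
      using riccati_single_test[OF sum(1)[OF zero_bounded_field]] by blast
    have "0 \<le> (\<Sum>\<phi>\<in>\<Phi>. w \<phi> * riccati \<phi> g) - \<epsilon> * W"
      using w(3)[OF g(1)] by (simp add: F_def W_def right_diff_distrib sum_subtractf sum_distrib_left mult.commute)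
    then show False using g sum(2)[OF g(1)] \<open>0 < \<epsilon> * W / 2\<close> by simp
  qed
qed

definition local_bound :: "(real^'n \<Rightarrow> real) \<Rightarrow> real" where
  "local_bound \<eta> = 2 / m * (1 - \<sigma> (\<lambda>x. (\<eta> x)\<^sup>2) + 2 * energy \<eta>)"

text \<open>The a priori estimate: \<open>2\<eta> Qg\<sqdot>\<nabla>\<eta> \<ge> -\<eta>\<^sup>2 Qg\<sqdot>g/2 - 2Q\<nabla>\<eta>\<sqdot>\<nabla>\<eta>\<close> lets half of the quadratic term survive, and
  ellipticity bounds it from below.\<close>

lemma L2_bound_from_riccati:
  assumes g: "g \<in> L2_loc \<Omega>" and \<eta>: "\<eta> \<in> test_functions \<Omega>" and K: "compact K" "K \<subseteq> \<Omega>" "\<And>x. x \<in> K \<Longrightarrow> \<eta> x = 1"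
    and "riccati (\<lambda>x. (\<eta> x)\<^sup>2) g \<le> 1"
  shows "(\<integral>x. indicator K x * (norm (g x))\<^sup>2 \<partial>lebesgue_on \<Omega>) \<le> local_bound \<eta>"
proof -
  let ?N = "\<integral>x. indicator K x * (norm (g x))\<^sup>2 \<partial>lebesgue_on \<Omega>"
  have iN: "integrable (lebesgue_on \<Omega>) (\<lambda>x. indicator K x * (norm (g x))\<^sup>2)"
    by (intro L1_loc_indicator_integrable open_dom L2_locD g K)
  have "m / 2 * ?N - 2 * energy \<eta>
      = (\<integral>x. m / 2 * (indicator K x * (norm (g x))\<^sup>2) - 2 * ((Q x *v gradient \<eta> x) \<bullet> gradient \<eta> x) \<partial>lebesgue_on \<Omega>)"
    unfolding energy_def using iN energy_integrable[OF \<eta>] by simp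
  also have "\<dots> \<le> (\<integral>x. riccati_density (\<lambda>x. (\<eta> x)\<^sup>2) g x \<partial>lebesgue_on \<Omega>)"
  proof (intro integral_mono Bochner_Integration.integrable_diff integrable_mult_right iN
      energy_integrable[OF \<eta>] riccati_density_integrable g test_functions_power2 \<eta>)
    fix x
    let ?B = "\<lambda>\<xi> \<zeta>. (Q x *v \<xi>) \<bullet> \<zeta>"
    \<comment> \<open>Half of this square is the Young inequality that absorbs the cross term.\<close>
    have "0 \<le> ?B (\<eta> x *\<^sub>R g x + 2 *\<^sub>R gradient \<eta> x) (\<eta> x *\<^sub>R g x + 2 *\<^sub>R gradient \<eta> x)" by (rule Q_nonneg)
    also have "\<dots> = (\<eta> x)\<^sup>2 * ?B (g x) (g x) + 4 * \<eta> x * ?B (g x) (gradient \<eta> x) + 4 * ?B (gradient \<eta> x) (gradient \<eta> x)"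
      by (subst symmetric_form_square[OF Q_sym]) simp
    finally have "(\<eta> x)\<^sup>2 * ?B (g x) (g x) / 2 - 2 * ?B (gradient \<eta> x) (gradient \<eta> x)
        \<le> riccati_density (\<lambda>x. (\<eta> x)\<^sup>2) g x"
      unfolding riccati_density_def gradient_power2[OF test_functions_smooth[OF \<eta>]] by simp
    moreover have "m * (indicator K x * (norm (g x))\<^sup>2) \<le> (\<eta> x)\<^sup>2 * ?B (g x) (g x)"
      using K(3)[of x] Q_lower[of "g x" x] Q_nonneg[of x "g x"] by (cases "x \<in> K") auto
    ultimately show "m / 2 * (indicator K x * (norm (g x))\<^sup>2) - 2 * ?B (gradient \<eta> x) (gradient \<eta> x)
        \<le> riccati_density (\<lambda>x. (\<eta> x)\<^sup>2) g x" by linarith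
  qed
  also have "\<dots> \<le> 1 - \<sigma> (\<lambda>x. (\<eta> x)\<^sup>2)" using assms(6) by (simp add: riccati_def)
  finally have "m / 2 * ?N \<le> 1 - \<sigma> (\<lambda>x. (\<eta> x)\<^sup>2) + 2 * energy \<eta>" by linarith
  then show ?thesis using m_pos by (simp add: local_bound_def field_simps)
qed

lemma L2_loc_diff:
  assumes "g \<in> L2_loc \<Omega>" "v \<in> L2_loc \<Omega>"
  shows "(\<lambda>x. g x - v x) \<in> L2_loc \<Omega>"
proof -
  note norm_diff_square_le[of "g x" "v x" for x]
  moreover have meas: "(\<lambda>x. g x - v x) \<in> borel_measurable (lebesgue_on \<Omega>)"
    using assms by (intro borel_measurable_diff L2_locD)
  moreover have "(\<lambda>x. 2 * (norm (g x))\<^sup>2 + 2 * (norm (v x))\<^sup>2) \<in> L1_loc \<Omega>"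
    by (intro L1_loc_add L1_loc_cmult L2_locD(2) assms)
  ultimately have "(\<lambda>x. (norm (g x - v x))\<^sup>2) \<in> L1_loc \<Omega>"
    by - (rule L1_loc_dominated[OF open_dom, of _ "\<lambda>x. 2 * (norm (g x))\<^sup>2 + 2 * (norm (v x))\<^sup>2"], auto)
  with meas show ?thesis by (simp add: L2_loc_def)
qed

text \<open>Convexity gives \<open>F(g) - F(v) \<le> \<integral> \<bar>d\<bar>(1 + 2\<bar>g\<bar>)\<close> up to a constant, with \<open>d = g - v\<close>. Young's inequality
  with parameter \<open>t = 2\<^sup>-\<^sup>n\<close> bounds this by \<open>t \<integral> (2\<bar>g\<bar>\<^sup>2 + 2) + (1/t) \<integral> \<bar>d\<bar>\<^sup>2\<close>; both terms
  vanish in the limit, as the second integral is of order \<open>4\<^sup>-\<^sup>n\<close>.\<close>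

lemma riccati_lower_semicontinuous:
  assumes g: "g \<in> L2_loc \<Omega>" and v: "\<And>n. v n \<in> L2_loc \<Omega>" and \<phi>: "\<phi> \<in> nonneg_tests"
    and K: "compact K" "K \<subseteq> \<Omega>" "support \<phi> \<subseteq> K"
    and le: "\<And>n. riccati \<phi> (v n) \<le> \<epsilon>"
    and conv: "\<And>n. (\<integral>x. indicator K x * (norm (g x - v n x))\<^sup>2 \<partial>lebesgue_on \<Omega>) \<le> c * (1 / 4) ^ n"
  shows "riccati \<phi> g \<le> \<epsilon>"
proof -
  have \<phi>t: "\<phi> \<in> test_functions \<Omega>" and \<phi>0: "\<And>x. 0 \<le> \<phi> x" using \<phi> by (auto simp: nonneg_tests_def)
  obtain C where C: "0 < C" "\<And>x. \<bar>\<phi> x\<bar> \<le> C" "\<And>x. norm (gradient \<phi> x) \<le> C"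
    using test_function_gradient_bounded[OF \<phi>t] by blast
  have pointwise: "riccati_density \<phi> g x \<le> riccati_density \<phi> (v n) x
      + M * C * (t * (indicator K x * (2 * (norm (g x))\<^sup>2 + 2)) + indicator K x * (norm (g x - v n x))\<^sup>2 / t)"
    if t: "0 < t" for n x t
  proof (cases "x \<in> support \<phi>")
    case True
    let ?B = "\<lambda>\<xi> \<zeta>. (Q x *v \<xi>) \<bullet> \<zeta>" and ?d = "g x - v n x"
    have v_eq: "v n x = 1 *\<^sub>R g x + (-1) *\<^sub>R ?d" by simp
    have "0 \<le> ?B ?d ?d" by (rule Q_nonneg)
    moreover have "?B (v n x) (v n x) = ?B (g x) (g x) - 2 * ?B (g x) ?d + ?B ?d ?d"
      by (subst v_eq, subst (2) v_eq, subst symmetric_form_square[OF Q_sym]) simp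
    ultimately have "?B (g x) (g x) - ?B (v n x) (v n x) \<le> 2 * ?B (g x) ?d" by linarith
    then have "\<phi> x * (?B (g x) (g x) - ?B (v n x) (v n x)) \<le> \<phi> x * (2 * ?B (g x) ?d)"
      by (rule mult_left_mono[OF _ \<phi>0])
    also have "\<dots> \<le> \<phi> x * (2 * (M * norm (g x) * norm ?d))"
      using Q_cauchy_schwarz[of x "g x" ?d] by (intro mult_left_mono[OF _ \<phi>0]) linarith
    also have "\<dots> \<le> C * (2 * (M * norm (g x) * norm ?d))"
      using C(2)[of x] M_pos by (intro mult_right_mono) auto
    finally have 1: "\<phi> x * (?B (g x) (g x) - ?B (v n x) (v n x)) \<le> M * C * (2 * norm (g x) * norm ?d)"
      by (simp add: mult_ac)
    have "?B ?d (gradient \<phi> x) \<le> M * norm ?d * norm (gradient \<phi> x)"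
      using Q_cauchy_schwarz[of x ?d "gradient \<phi> x"] by linarith
    also have "\<dots> \<le> M * norm ?d * C" using M_pos C by (intro mult_left_mono) auto
    finally have 2: "?B ?d (gradient \<phi> x) \<le> M * C * norm ?d" by (simp add: mult_ac)
    have "riccati_density \<phi> g x - riccati_density \<phi> (v n) x
        = ?B ?d (gradient \<phi> x) + \<phi> x * (?B (g x) (g x) - ?B (v n x) (v n x))"
      by (simp add: riccati_density_def matrix_vector_mult_diff_distrib inner_diff_left right_diff_distrib)
    also have "\<dots> \<le> M * C * (norm ?d * (1 + 2 * norm (g x)))"
      using 1 2 by (simp add: algebra_simps)
    also have "\<dots> \<le> M * C * (t * (2 * (norm (g x))\<^sup>2 + 2) + (norm ?d)\<^sup>2 / t)"
    proof (intro mult_left_mono)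
      \<comment> \<open>Expanding this square gives Young's inequality with parameter \<open>t\<close>.\<close>
      have "0 \<le> (t * (1 + 2 * norm (g x)) / 2 - norm ?d)\<^sup>2 / t" using t by simp
      also have "\<dots> = t * (1 + 2 * norm (g x))\<^sup>2 / 4 - norm ?d * (1 + 2 * norm (g x)) + (norm ?d)\<^sup>2 / t"
        using t by (simp add: field_simps power2_eq_square)
      finally have "norm ?d * (1 + 2 * norm (g x)) \<le> t * ((1 + 2 * norm (g x))\<^sup>2 / 4) + (norm ?d)\<^sup>2 / t" by simp
      moreover have "(1 + 2 * norm (g x))\<^sup>2 / 4 \<le> 2 * (norm (g x))\<^sup>2 + 2"
        using zero_le_power2[of "norm (g x) - 1 / 2"] by (simp add: power2_eq_square field_simps)
      then have "t * ((1 + 2 * norm (g x))\<^sup>2 / 4) \<le> t * (2 * (norm (g x))\<^sup>2 + 2)"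
        using t by (intro mult_left_mono) auto
      ultimately show "norm ?d * (1 + 2 * norm (g x)) \<le> t * (2 * (norm (g x))\<^sup>2 + 2) + (norm ?d)\<^sup>2 / t"
        by linarith
    qed (use M_pos C in auto)
    finally show ?thesis using True K(3) by (auto simp: indicator_def)
  next
    case False
    then have "\<phi> x = 0" "gradient \<phi> x = 0"
      using test_function_gradient_outside_support[OF \<phi>t False] \<phi>t by (auto elim: test_functionsE)
    then show ?thesis using t M_pos C(1) by (simp add: riccati_density_def)
  qed
  define G where "G = (\<integral>x. indicator K x * (2 * (norm (g x))\<^sup>2 + 2) \<partial>lebesgue_on \<Omega>)"
  have iG: "integrable (lebesgue_on \<Omega>) (\<lambda>x. indicator K x * (2 * (norm (g x))\<^sup>2 + 2))"
    by (intro L1_loc_indicator_integrable open_dom K L1_loc_add L1_loc_cmult L2_locD g L1_loc_const)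
  have iD: "integrable (lebesgue_on \<Omega>) (\<lambda>x. indicator K x * (norm (g x - v n x))\<^sup>2)" for n
    by (intro L1_loc_indicator_integrable open_dom K L2_locD(2)[OF L2_loc_diff] g v)
  note iR = riccati_density_integrable[OF _ \<phi>t]
  have bound: "riccati \<phi> g \<le> \<epsilon> + M * C * (G + c) * (1 / 2) ^ n" for n
  proof -
    define t :: real where "t = (1 / 2) ^ n"
    have t: "0 < t" by (simp add: t_def)
    have "(\<integral>x. riccati_density \<phi> g x \<partial>lebesgue_on \<Omega>) \<le> (\<integral>x. riccati_density \<phi> (v n) x
      + M * C * (t * (indicator K x * (2 * (norm (g x))\<^sup>2 + 2)) + indicator K x * (norm (g x - v n x))\<^sup>2 / t) \<partial>lebesgue_on \<Omega>)"
      by (intro integral_mono pointwise[OF t] iR g v Bochner_Integration.integrable_add integrable_mult_right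
          integrable_divide iG iD)
    also have "\<dots> = (\<integral>x. riccati_density \<phi> (v n) x \<partial>lebesgue_on \<Omega>)
      + M * C * (t * G + (\<integral>x. indicator K x * (norm (g x - v n x))\<^sup>2 \<partial>lebesgue_on \<Omega>) / t)"
      unfolding G_def using iR[OF v[of n]] iG iD[of n] by simp
    also have "\<dots> \<le> (\<integral>x. riccati_density \<phi> (v n) x \<partial>lebesgue_on \<Omega>) + M * C * (t * G + c * (1 / 4) ^ n / t)"
      using conv[of n] t M_pos C(1) by (intro add_left_mono mult_left_mono divide_right_mono) auto
    also have "(1 / 4) ^ n = t * t" by (simp add: t_def flip: power_mult_distrib)
    finally have "(\<integral>x. riccati_density \<phi> g x \<partial>lebesgue_on \<Omega>)
        \<le> (\<integral>x. riccati_density \<phi> (v n) x \<partial>lebesgue_on \<Omega>) + M * C * (t * G + c * t)"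
      using t by simp
    then show ?thesis using le[of n] unfolding riccati_def t_def by (simp add: algebra_simps)
  qed
  have "(\<lambda>n. \<epsilon> + M * C * (G + c) * (1 / 2) ^ n) \<longlonglongrightarrow> \<epsilon> + M * C * (G + c) * 0"
    by (intro tendsto_intros LIMSEQ_power_zero) auto
  from LIMSEQ_le_const[OF this] bound show ?thesis by auto
qed

section \<open>Passing to all test functions at once\<close>

definition sq_mass :: "(real^'n) set \<Rightarrow> (real^'n \<Rightarrow> real^'n) \<Rightarrow> real" where
  "sq_mass K g = (\<integral>x. indicator K x * (norm (g x))\<^sup>2 \<partial>lebesgue_on \<Omega>)"

lemma sq_mass_integrable:
  assumes "g \<in> L2_loc \<Omega>" "compact K" "K \<subseteq> \<Omega>"
  shows "integrable (lebesgue_on \<Omega>) (\<lambda>x. indicator K x * (norm (g x))\<^sup>2)"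
  by (intro L1_loc_indicator_integrable open_dom L2_locD assms)

lemma sq_mass_nonneg: "0 \<le> sq_mass K g"
  unfolding sq_mass_def by (intro integral_nonneg_AE AE_I2) simp

lemma sq_mass_diff_le:
  assumes "f \<in> L2_loc \<Omega>" "g \<in> L2_loc \<Omega>" "h \<in> L2_loc \<Omega>" "compact K" "K \<subseteq> \<Omega>"
  shows "sq_mass K (\<lambda>x. f x - g x) \<le> 2 * sq_mass K (\<lambda>x. f x - h x) + 2 * sq_mass K (\<lambda>x. g x - h x)"
proof -
  have "sq_mass K (\<lambda>x. f x - g x) \<le> (\<integral>x. 2 * (indicator K x * (norm (f x - h x))\<^sup>2)
      + 2 * (indicator K x * (norm (g x - h x))\<^sup>2) \<partial>lebesgue_on \<Omega>)"
    unfolding sq_mass_def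
  proof (intro integral_mono Bochner_Integration.integrable_add integrable_mult_right sq_mass_integrable L2_loc_diff assms)
    fix x show "indicator K x * (norm (f x - g x))\<^sup>2
        \<le> 2 * (indicator K x * (norm (f x - h x))\<^sup>2) + 2 * (indicator K x * (norm (g x - h x))\<^sup>2)"
      using norm_diff_square_le[of "f x - h x" "g x - h x"] by (simp add: indicator_def)
  qed
  also have "\<dots> = 2 * sq_mass K (\<lambda>x. f x - h x) + 2 * sq_mass K (\<lambda>x. g x - h x)"
    unfolding sq_mass_def
    using sq_mass_integrable[OF L2_loc_diff[OF assms(1,3)] assms(4,5)]
      sq_mass_integrable[OF L2_loc_diff[OF assms(2,3)] assms(4,5)] by simp
  finally show ?thesis .
qed

lemma sq_mass_midpoint:
  assumes "f \<in> L2_loc \<Omega>" "g \<in> L2_loc \<Omega>" "compact K" "K \<subseteq> \<Omega>"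
  shows "sq_mass K (\<lambda>x. (1 - 1 / 2) *\<^sub>R f x + (1 / 2) *\<^sub>R g x)
    = (sq_mass K f + sq_mass K g) / 2 - sq_mass K (\<lambda>x. f x - g x) / 4"
proof -
  have "indicator K x * (norm ((1 - 1 / 2) *\<^sub>R f x + (1 / 2) *\<^sub>R g x))\<^sup>2
      = (indicator K x * (norm (f x))\<^sup>2 + indicator K x * (norm (g x))\<^sup>2) / 2
        - indicator K x * (norm (f x - g x))\<^sup>2 / 4" for x
    by (simp add: power2_norm_eq_inner inner_add_left inner_add_right inner_diff_left inner_diff_right
        inner_commute field_simps)
  then show ?thesis
    unfolding sq_mass_def
    using assms(1,2)[THEN sq_mass_integrable, OF assms(3,4)]
      sq_mass_integrable[OF L2_loc_diff[OF assms(1,2)] assms(3,4)] by simp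
qed

lemma sq_mass_mono:
  assumes "g \<in> L2_loc \<Omega>" "compact K" "K \<subseteq> \<Omega>" "compact L" "L \<subseteq> \<Omega>"
    and "\<And>x. x \<in> K \<Longrightarrow> x \<notin> L \<Longrightarrow> g x = 0"
  shows "sq_mass K g \<le> sq_mass L g"
  unfolding sq_mass_def using assms(6)
  by (intro integral_mono sq_mass_integrable assms) (auto simp: indicator_def)

lemma bounded_fields_restrict:
  assumes "g \<in> bounded_fields" "compact K" "K \<subseteq> \<Omega>"
  shows "(\<lambda>x. indicator K x *\<^sub>R g x) \<in> bounded_fields"
proof -
  from assms obtain B where g: "g \<in> borel_measurable (lebesgue_on \<Omega>)" "\<And>x. norm (g x) \<le> B"
    by (auto simp: bounded_fields_def)
  have "(indicator K :: _ \<Rightarrow> real) \<in> borel_measurable (lebesgue_on \<Omega>)"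
    using assms(2) by (intro measurable_restrict_space1 borel_measurable_indicator)
      (auto intro: fmeasurableD lmeasurable_compact)
  then have "(\<lambda>x. indicator K x *\<^sub>R g x) \<in> borel_measurable (lebesgue_on \<Omega>)"
    using g(1) by (rule borel_measurable_scaleR)
  moreover have "norm (indicator K x *\<^sub>R g x) \<le> B" for x
    using g(2)[of x] order_trans[OF norm_ge_zero g(2)[of x]] by (simp add: indicator_def)
  ultimately show ?thesis
    using assms unfolding bounded_fields_def
    by (intro CollectI conjI exI[of _ K] exI[of _ B]) auto
qed

lemma riccati_restrict:
  assumes "\<phi> \<in> test_functions \<Omega>" "support \<phi> \<subseteq> K"
  shows "riccati \<phi> (\<lambda>x. indicator K x *\<^sub>R g x) = riccati \<phi> g"
proof -
  have "riccati_density \<phi> (\<lambda>x. indicator K x *\<^sub>R g x) x = riccati_density \<phi> g x" for x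
  proof (cases "x \<in> support \<phi>")
    case False
    then have "\<phi> x = 0" "gradient \<phi> x = 0"
      using test_function_gradient_outside_support[OF assms(1) False] assms(1)
      by (auto elim: test_functionsE)
    then show ?thesis by (simp add: riccati_density_def)
  qed (use assms(2) in \<open>auto simp: riccati_density_def\<close>)
  then show ?thesis by (simp add: riccati_def)
qed

text \<open>Completeness of \<open>L\<^sup>2\<^sub>l\<^sub>o\<^sub>c\<close>. The pointwise limit serves all members of the exhaustion simultaneously.\<close>

lemma L2_loc_cauchy_limit:
  assumes K: "\<And>k. compact (K k)" "\<And>k. K k \<subseteq> \<Omega>"
      "\<And>L. compact L \<Longrightarrow> L \<subseteq> \<Omega> \<Longrightarrow> \<exists>k. L \<subseteq> K k"
    and u: "\<And>n. u n \<in> L2_loc \<Omega>" and B: "\<And>k. 0 \<le> B k"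
    and cauchy: "\<And>k m n. n \<le> m \<Longrightarrow> sq_mass (K k) (\<lambda>x. u m x - u n x) \<le> B k * (1 / 4) ^ n"
  obtains g where "g \<in> L2_loc \<Omega>" "\<And>k n. sq_mass (K k) (\<lambda>x. g x - u n x) \<le> B k * (1 / 4) ^ n"
proof -
  have ind: "(indicator (K k) :: _ \<Rightarrow> real) \<in> borel_measurable (lebesgue_on \<Omega>)" for k
    using K(1)[of k] by (intro measurable_restrict_space1 borel_measurable_indicator)
      (auto intro: fmeasurableD lmeasurable_compact)
  define g where "g x = lim (\<lambda>m. u m x)" for x
  have um: "u n \<in> borel_measurable (lebesgue_on \<Omega>)" for n by (intro L2_locD u)
  then have gm: "g \<in> borel_measurable (lebesgue_on \<Omega>)"
    unfolding g_def[abs_def] by (rule borel_measurable_lim_metric)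
  have lim_bound: "(\<integral>\<^sup>+x. ennreal (indicator (K k) x * (norm (g x - u n x))\<^sup>2) \<partial>lebesgue_on \<Omega>)
      \<le> ennreal (B k * (1 / 4) ^ n)" for k n
  proof -
    define u' where "u' n x = indicator (K k) x *\<^sub>R u n x" for n x
    have sq: "(norm (indicator (K k) x *\<^sub>R p - indicator (K k) x *\<^sub>R q))\<^sup>2
        = indicator (K k) x * (norm (p - q))\<^sup>2" for x and p q :: "real^'n"
      by (simp add: indicator_def)
    have lim': "lim (\<lambda>m. u' m x) = indicator (K k) x *\<^sub>R g x" for x
      by (simp add: u'_def g_def indicator_def)
    have "(\<integral>\<^sup>+x. ennreal ((norm (lim (\<lambda>m. u' m x) - u' n x))\<^sup>2) \<partial>lebesgue_on \<Omega>)
        \<le> ennreal (B k * (1 / 4) ^ n)"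
    proof (rule L2_fast_cauchy_limit)
      show "u' n \<in> borel_measurable (lebesgue_on \<Omega>)" for n
        unfolding u'_def[abs_def] by (intro borel_measurable_scaleR ind um)
      fix m n :: nat assume "n \<le> m"
      have "(\<integral>\<^sup>+x. ennreal ((norm (u' m x - u' n x))\<^sup>2) \<partial>lebesgue_on \<Omega>)
          = ennreal (sq_mass (K k) (\<lambda>x. u m x - u n x))"
        unfolding u'_def sq sq_mass_def
        by (intro nn_integral_eq_integral sq_mass_integrable L2_loc_diff u K AE_I2) simp
      also have "\<dots> \<le> ennreal (B k * (1 / 4) ^ n)"
        by (intro ennreal_leI cauchy \<open>n \<le> m\<close>)
      finally show "(\<integral>\<^sup>+x. ennreal ((norm (u' m x - u' n x))\<^sup>2) \<partial>lebesgue_on \<Omega>)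
          \<le> ennreal (B k * (1 / 4) ^ n)" .
    qed
    then show ?thesis unfolding lim' unfolding u'_def sq .
  qed
  have int: "integrable (lebesgue_on \<Omega>) (\<lambda>x. indicator (K k) x * (norm (g x - u n x))\<^sup>2)" for k n
  proof (rule integrableI_nonneg)
    show "(\<lambda>x. indicator (K k) x * (norm (g x - u n x))\<^sup>2) \<in> borel_measurable (lebesgue_on \<Omega>)"
      using gm um[of n] ind[of k] by measurable
    show "(\<integral>\<^sup>+x. ennreal (indicator (K k) x * (norm (g x - u n x))\<^sup>2) \<partial>lebesgue_on \<Omega>) < \<infinity>"
      using lim_bound[of k n] by (rule le_less_trans) simp
  qed simp
  have "(\<lambda>x. (norm (g x - u 0 x))\<^sup>2) \<in> L1_loc \<Omega>"
    unfolding L1_loc_def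
  proof (intro CollectI allI impI)
    fix L assume L: "compact L \<and> L \<subseteq> \<Omega>"
    then obtain k where k: "L \<subseteq> K k" using K(3) by blast
    have "(\<lambda>x. indicator \<Omega> x *\<^sub>R (indicator (K k) x * (norm (g x - u 0 x))\<^sup>2))
        = (\<lambda>x. indicator (K k) x *\<^sub>R (norm (g x - u 0 x))\<^sup>2)"
      using subsetD[OF K(2)[of k]] by (auto simp: indicator_def fun_eq_iff)
    then have "set_integrable lebesgue (K k) (\<lambda>x. (norm (g x - u 0 x))\<^sup>2)"
      using int[of k 0] open_dom unfolding set_integrable_def
      by (subst (asm) integrable_restrict_space) auto
    then show "set_integrable lebesgue L (\<lambda>x. (norm (g x - u 0 x))\<^sup>2)"
      by (rule set_integrable_subset) (use L k in \<open>auto intro: fmeasurableD lmeasurable_compact\<close>)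
  qed
  then have "(\<lambda>x. g x - u 0 x) \<in> L2_loc \<Omega>"
    using gm um[of 0] by (simp add: L2_loc_def)
  then have "g \<in> L2_loc \<Omega>"
    using L2_loc_diff[OF _ L2_loc_diff[OF bounded_fields_L2_loc[OF zero_bounded_field] u[of 0]]]
    by fastforce
  moreover have g_u: "sq_mass (K k) (\<lambda>x. g x - u n x) \<le> B k * (1 / 4) ^ n" for k n
  proof -
    have "ennreal (sq_mass (K k) (\<lambda>x. g x - u n x)) \<le> ennreal (B k * (1 / 4) ^ n)"
      unfolding sq_mass_def using lim_bound[of k n]
      by (subst nn_integral_eq_integral[symmetric]) (auto intro: int)
    then show ?thesis using B[of k] by (subst (asm) ennreal_le_iff) auto
  qed
  ultimately show ?thesis using that by blast
qed

text \<open>The bounds \<open>A k\<close> must not depend on the finite set of test functions, although only finitely many of the constraints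
  that enforce them can be imposed at a time. If all given supports lie in \<open>K n\<close>, impose them for \<open>k \<le> n\<close> and cut the
  field off outside \<open>K n\<close>; this changes none of the values at the given test functions, and the bounds for \<open>k > n\<close> follow from
  the one for \<open>n\<close>.\<close>

lemma locally_bounded_approximation:
  fixes K :: "nat \<Rightarrow> (real^'n) set"
  assumes K: "\<And>k. compact (K k)" "\<And>k. K k \<subseteq> \<Omega>"
      "\<And>L. compact L \<Longrightarrow> L \<subseteq> \<Omega> \<Longrightarrow> \<exists>k. L \<subseteq> K k"
    and K_mono: "\<And>k n. k \<le> n \<Longrightarrow> K k \<subseteq> K n"
  obtains A where "\<And>k. 1 \<le> A k"
    "\<And>\<Phi> \<epsilon>. finite \<Phi> \<Longrightarrow> \<Phi> \<subseteq> nonneg_tests \<Longrightarrow> 0 < \<epsilon> \<Longrightarrow>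
      \<exists>g\<in>bounded_fields. (\<forall>\<phi>\<in>\<Phi>. riccati \<phi> g \<le> \<epsilon>) \<and> (\<forall>k. sq_mass (K k) g \<le> A k)"
proof -
  have "\<forall>k. \<exists>\<eta>\<in>test_functions \<Omega>. \<forall>x\<in>K k. \<eta> x = 1"
    using cutoff_function_exists[OF open_dom K(1) K(2)] by (metis subsetD)
  then obtain \<eta> where \<eta>: "\<And>k. \<eta> k \<in> test_functions \<Omega>" "\<And>k x. x \<in> K k \<Longrightarrow> \<eta> k x = 1" by metis
  define A where "A k = 1 + (\<Sum>l\<le>k. \<bar>local_bound (\<eta> l)\<bar>)" for k
  have A: "1 \<le> A k" for k by (simp add: A_def sum_nonneg)
  have A_bound: "local_bound (\<eta> l) \<le> A k" if "l \<le> k" for k l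
  proof -
    have "\<bar>local_bound (\<eta> l)\<bar> \<le> (\<Sum>l\<le>k. \<bar>local_bound (\<eta> l)\<bar>)"
      using that by (intro member_le_sum) auto
    then show ?thesis unfolding A_def by linarith
  qed
  have "\<exists>g\<in>bounded_fields. (\<forall>\<phi>\<in>\<Phi>. riccati \<phi> g \<le> \<epsilon>) \<and> (\<forall>k. sq_mass (K k) g \<le> A k)"
    if \<Phi>: "finite \<Phi>" "\<Phi> \<subseteq> nonneg_tests" "0 < \<epsilon>" for \<Phi> \<epsilon>
  proof -
    have supp: "compact (support \<phi>)" "support \<phi> \<subseteq> \<Omega>" if "\<phi> \<in> \<Phi>" for \<phi>
      using that \<Phi>(2) by (auto simp: nonneg_tests_def test_functions_def)
    have "compact (\<Union>\<phi>\<in>\<Phi>. support \<phi>)" "(\<Union>\<phi>\<in>\<Phi>. support \<phi>) \<subseteq> \<Omega>"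
      using supp by (auto intro!: compact_UN \<Phi>(1))
    then obtain n where n: "(\<Union>\<phi>\<in>\<Phi>. support \<phi>) \<subseteq> K n" using K(3) by blast
    define \<Phi>' where "\<Phi>' = \<Phi> \<union> (\<lambda>k x. (\<eta> k x)\<^sup>2) ` {..n}"
    have "finite \<Phi>'" "\<Phi>' \<subseteq> nonneg_tests"
      using \<Phi> test_functions_power2[OF \<eta>(1)] by (auto simp: \<Phi>'_def nonneg_tests_def)
    then obtain g where g: "g \<in> bounded_fields" "\<And>\<phi>. \<phi> \<in> \<Phi>' \<Longrightarrow> riccati \<phi> g \<le> min \<epsilon> 1"
      using riccati_finitely_many_tests[of \<Phi>' "min \<epsilon> 1"] \<Phi>(3) by (auto simp del: min.bounded_iff)
    define g' where "g' x = indicator (K n) x *\<^sub>R g x" for x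
    have g': "g' \<in> bounded_fields"
      unfolding g'_def[abs_def] by (intro bounded_fields_restrict g K(1,2))
    have small: "riccati \<phi> g' \<le> \<epsilon>" if "\<phi> \<in> \<Phi>" for \<phi>
    proof -
      have "riccati \<phi> g' = riccati \<phi> g"
        unfolding g'_def[abs_def] using that \<Phi>(2) n
        by (intro riccati_restrict) (auto simp: nonneg_tests_def)
      then show ?thesis using g(2)[of \<phi>] that by (simp add: \<Phi>'_def)
    qed
    have mass: "sq_mass (K k) g' \<le> A k" for k
    proof -
      let ?l = "min k n"
      have "sq_mass (K k) g' \<le> sq_mass (K ?l) g'"
        using K_mono by (intro sq_mass_mono bounded_fields_L2_loc g' K(1,2)) (auto simp: g'_def min_def split: if_splits)
      also have "\<dots> = sq_mass (K ?l) g"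
        unfolding sq_mass_def using K_mono[of ?l n]
        by (intro Bochner_Integration.integral_cong) (auto simp: g'_def indicator_def)
      also have "\<dots> \<le> local_bound (\<eta> ?l)"
        unfolding sq_mass_def
      proof (intro L2_bound_from_riccati bounded_fields_L2_loc g \<eta> K(1,2))
        have "(\<lambda>x. (\<eta> ?l x)\<^sup>2) \<in> \<Phi>'" by (auto simp: \<Phi>'_def)
        from g(2)[OF this] show "riccati (\<lambda>x. (\<eta> ?l x)\<^sup>2) g \<le> 1" by simp
      qed
      also have "\<dots> \<le> A k" by (rule A_bound) simp
      finally show ?thesis .
    qed
    show ?thesis using g' small mass by blast
  qed
  then show ?thesis using that[of A] A by blast
qed

text \<open>The minimal norm argument in the norm square \<open>\<Sum>k. a k * sq_mass (K k) g\<close>, with weights that bring each of the bounds of the previous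
  lemma down to \<open>2\<^sup>-\<^sup>k\<close>. Each of the seminorms is controlled by the sum, so the almost minimal sequence converges in
  \<open>L\<^sup>2\<^sub>l\<^sub>o\<^sub>c\<close>, and semicontinuity applies to the comparison sequence in each \<open>{g. riccati \<phi> g \<le> \<epsilon>}\<close>.\<close>

lemma riccati_field_exists: "\<exists>g\<in>L2_loc \<Omega>. \<forall>\<phi>\<in>nonneg_tests. riccati \<phi> g \<le> 0"
proof -
  obtain K where K: "\<And>n. compact (K n)" "\<And>n. K n \<subseteq> \<Omega>" "\<And>n. K n \<subseteq> interior (K (Suc n))"
    "\<Union>(range K) = \<Omega>" "\<And>L. compact L \<Longrightarrow> L \<subseteq> \<Omega> \<Longrightarrow> \<exists>N. \<forall>n\<ge>N. L \<subseteq> K n"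
    by (rule open_Union_compact_subsets[OF open_dom]) (rule that)
  have "K n \<subseteq> K (Suc n)" for n using K(3)[of n] interior_subset by blast
  then have K_mono: "K k \<subseteq> K n" if "k \<le> n" for k n
    using lift_Suc_mono_le[of K] that by blast
  have K_ex: "\<exists>k. L \<subseteq> K k" if "compact L" "L \<subseteq> \<Omega>" for L using K(5)[OF that] by blast
  obtain A where A: "\<And>k. 1 \<le> A k"
    and approx: "\<And>\<Phi> \<epsilon>. finite \<Phi> \<Longrightarrow> \<Phi> \<subseteq> nonneg_tests \<Longrightarrow> 0 < \<epsilon> \<Longrightarrow>
      \<exists>g\<in>bounded_fields. (\<forall>\<phi>\<in>\<Phi>. riccati \<phi> g \<le> \<epsilon>) \<and> (\<forall>k. sq_mass (K k) g \<le> A k)"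
    using locally_bounded_approximation[of K, OF K(1,2) K_ex K_mono] by metis
  define a where "a k = (1 / 2) ^ k / A k" for k
  have a: "0 < a k" "a k \<le> (1 / 2) ^ k" for k
    using A[of k] by (auto simp: a_def divide_le_eq mult_left_mono[of 1 "A k", simplified])
  define N where "N g = (\<Sum>k. a k * sq_mass (K k) g)" for g
  note L2 = bounded_fields_L2_loc
  have summ: "summable (\<lambda>k. a k * sq_mass (K k) g)" if g: "g \<in> bounded_fields" for g
  proof -
    from g obtain L where L: "compact L" "L \<subseteq> \<Omega>" "\<And>x. x \<notin> L \<Longrightarrow> g x = 0"
      by (auto simp: bounded_fields_def)
    have le: "sq_mass (K k) g \<le> sq_mass L g" for k
      by (intro sq_mass_mono L2 g K L)
    have "norm (a k * sq_mass (K k) g) \<le> (1 / 2) ^ k * sq_mass L g" for k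
      using a[of k] le[of k] sq_mass_nonneg[of "K k" g] by (auto intro!: mult_mono)
    moreover have "summable (\<lambda>k. (1 / 2) ^ k * sq_mass L g)"
      by (intro summable_mult2 summable_geometric) auto
    ultimately show ?thesis by (metis (no_types, lifting) summable_comparison_test')
  qed
  have term_nonneg: "0 \<le> a k * sq_mass (K k) g" for k g
    using a(1)[of k] by (simp add: sq_mass_nonneg less_imp_le)
  have mass_le: "sq_mass (K k) g \<le> N g / a k" if "g \<in> bounded_fields" for k g
  proof -
    have "a k * sq_mass (K k) g \<le> N g"
      using sum_le_suminf[OF summ[OF that], of "{k}"] term_nonneg by (simp add: N_def)
    then show ?thesis using a(1)[of k] by (simp add: field_simps)
  qed
  define mid :: "(real^'n \<Rightarrow> real^'n) \<Rightarrow> (real^'n \<Rightarrow> real^'n) \<Rightarrow> real^'n \<Rightarrow> real^'n"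
    where "mid f g = (\<lambda>x. (1 - 1 / 2) *\<^sub>R f x + (1 / 2) *\<^sub>R g x)" for f g
  define D where "D f g = N (\<lambda>x. f x - g x)" for f g :: "real^'n \<Rightarrow> real^'n"
  have diff: "(\<lambda>x. f x - g x) \<in> bounded_fields" if "f \<in> bounded_fields" "g \<in> bounded_fields" for f g
    using bounded_fields_combination[OF that, of 1 "-1"] by simp
  define S where "S \<phi> \<epsilon> = {g \<in> bounded_fields. riccati \<phi> g \<le> \<epsilon>}" for \<phi> \<epsilon>
  define \<C> where "\<C> = (\<lambda>(\<phi>, \<epsilon>). S \<phi> \<epsilon>) ` (nonneg_tests \<times> {0<..})"
  obtain w where w: "\<And>n. w n \<in> bounded_fields" "\<And>k m n. k \<le> m \<Longrightarrow> k \<le> n \<Longrightarrow> D (w m) (w n) \<le> 8 / Suc k"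
    "\<And>C. C \<in> \<C> \<Longrightarrow> \<exists>y. (\<forall>n. y n \<in> C \<and> D (y n) (w n) \<le> 8 / Suc n)"
  proof (rule minimal_norm_sequence[of \<C> bounded_fields mid N D 2])
    show "C \<subseteq> bounded_fields" if "C \<in> \<C>" for C using that by (auto simp: \<C>_def S_def)
    show "mid f g \<in> C" if C0: "C \<in> insert bounded_fields \<C>" and "f \<in> C" "g \<in> C" for C f g
    proof -
      have fg: "f \<in> bounded_fields" "g \<in> bounded_fields"
        using that by (auto simp: \<C>_def S_def)
      have m: "mid f g \<in> bounded_fields" unfolding mid_def by (intro bounded_fields_combination fg)
      show ?thesis
      proof (cases "C = bounded_fields")
        case False
        then obtain \<phi> \<epsilon> where C: "C = S \<phi> \<epsilon>" "\<phi> \<in> nonneg_tests" using C0 by (auto simp: \<C>_def)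
        have "riccati \<phi> (mid f g) \<le> (1 - 1 / 2) * riccati \<phi> f + 1 / 2 * riccati \<phi> g"
          unfolding mid_def by (intro riccati_convex C fg) auto
        also have "\<dots> \<le> \<epsilon>" using that(2,3) by (simp add: C(1) S_def)
        finally show ?thesis using m by (simp add: C(1) S_def)
      qed (use m in simp)
    qed
    show "N (mid f g) \<le> (N f + N g) / 2 - D f g / 4" if fg: "f \<in> bounded_fields" "g \<in> bounded_fields" for f g
    proof -
      have s: "(\<lambda>k. a k * sq_mass (K k) h) sums N h" if "h \<in> bounded_fields" for h
        unfolding N_def by (intro summable_sums summ that)
      have "(\<lambda>k. (a k * sq_mass (K k) f + a k * sq_mass (K k) g) / 2 - a k * sq_mass (K k) (\<lambda>x. f x - g x) / 4)
          sums ((N f + N g) / 2 - D f g / 4)"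
        unfolding D_def by (intro sums_diff sums_divide sums_add s fg diff)
      moreover have "a k * sq_mass (K k) (mid f g)
          = (a k * sq_mass (K k) f + a k * sq_mass (K k) g) / 2 - a k * sq_mass (K k) (\<lambda>x. f x - g x) / 4" for k
        unfolding mid_def sq_mass_midpoint[OF L2[OF fg(1)] L2[OF fg(2)] K(1) K(2)]
        by (simp add: algebra_simps)
      ultimately show ?thesis unfolding N_def[of "mid f g"] using sums_unique by force
    qed
    show "0 \<le> N g" if "g \<in> bounded_fields" for g
      unfolding N_def by (intro suminf_nonneg summ that term_nonneg)
    show "\<exists>g\<in>bounded_fields \<inter> \<Inter>J. N g \<le> 2" if J: "finite J" "J \<subseteq> \<C>" for J
    proof -
      obtain I where I: "I \<subseteq> nonneg_tests \<times> {0<..}" "finite I" "J = (\<lambda>(\<phi>, \<epsilon>). S \<phi> \<epsilon>) ` I"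
        using finite_subset_image[OF J[unfolded \<C>_def]] by blast
      define \<epsilon> where "\<epsilon> = Min (insert 1 (snd ` I))"
      have \<epsilon>: "0 < \<epsilon>" "\<And>i. i \<in> I \<Longrightarrow> \<epsilon> \<le> snd i"
        using I by (auto simp: \<epsilon>_def)
      have "finite (fst ` I)" "fst ` I \<subseteq> nonneg_tests" using I(1,2) by auto
      from approx[OF this \<epsilon>(1)] obtain g where g: "g \<in> bounded_fields"
        "\<And>\<phi>. \<phi> \<in> fst ` I \<Longrightarrow> riccati \<phi> g \<le> \<epsilon>" and mass: "\<And>k. sq_mass (K k) g \<le> A k" by blast
      have "g \<in> S \<phi> e" if "(\<phi>, e) \<in> I" for \<phi> e
        using g(1) g(2)[of \<phi>] \<epsilon>(2)[OF that] that by (force simp: S_def)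
      then have "g \<in> \<Inter>J" by (auto simp: I(3))
      have "N g \<le> (\<Sum>k. (1 / 2) ^ k)"
        unfolding N_def
      proof (intro suminf_le summ g summable_geometric)
        show "a k * sq_mass (K k) g \<le> (1 / 2) ^ k" for k
          using mult_left_mono[OF mass[of k], of "a k"] a(1)[of k] A[of k] by (simp add: a_def)
      qed auto
      also have "\<dots> = 2" using suminf_geometric[of "1 / 2 :: real"] by simp
      finally show ?thesis using g(1) \<open>g \<in> \<Inter>J\<close> by blast
    qed
  qed (rule that)
  \<comment> \<open>A subsequence along which the rate \<open>8 / Suc n\<close> becomes geometric.\<close>
  define r :: "nat \<Rightarrow> nat" where "r n = 8 * 4 ^ n" for n
  define u where "u n = w (r n)" for n
  have u: "u n \<in> bounded_fields" for n by (simp add: u_def w)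
  have rate: "8 / real (Suc (r n)) \<le> (1 / 4) ^ n" for n
  proof -
    have "8 / real (Suc (r n)) \<le> 8 / (8 * 4 ^ n)"
      by (intro divide_left_mono) (auto simp: r_def intro!: mult_pos_pos add_pos_pos)
    then show ?thesis by (simp add: power_divide)
  qed
  have u_cauchy: "sq_mass (K k) (\<lambda>x. u m x - u n x) \<le> 1 / a k * (1 / 4) ^ n" if "n \<le> m" for k m n
  proof -
    have "r n \<le> r m" using that by (simp add: r_def power_increasing)
    then have "D (u m) (u n) \<le> (1 / 4) ^ n" using w(2)[of "r n" "r m" "r n"] rate[of n] by (simp add: u_def)
    then have "D (u m) (u n) / a k \<le> (1 / 4) ^ n / a k"
      using a(1)[of k] by (intro divide_right_mono) auto
    then show ?thesis
      using mass_le[OF diff[OF u[of m] u[of n]], of k] by (simp add: D_def)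
  qed
  obtain g where g_L2: "g \<in> L2_loc \<Omega>"
    and g_u: "\<And>k n. sq_mass (K k) (\<lambda>x. g x - u n x) \<le> 1 / a k * (1 / 4) ^ n"
  proof (rule L2_loc_cauchy_limit[of K u "\<lambda>k. 1 / a k"])
    show "compact (K k)" "K k \<subseteq> \<Omega>" for k by (rule K)+
    show "\<exists>k. L \<subseteq> K k" if "compact L" "L \<subseteq> \<Omega>" for L by (rule K_ex[OF that])
    show "u n \<in> L2_loc \<Omega>" for n by (rule L2[OF u])
    show "0 \<le> 1 / a k" for k using a(1)[of k] by simp
    show "sq_mass (K k) (\<lambda>x. u m x - u n x) \<le> 1 / a k * (1 / 4) ^ n" if "n \<le> m" for k m n
      by (rule u_cauchy[OF that])
  qed (rule that)
  have le_eps: "riccati \<phi> g \<le> \<epsilon>" if \<phi>: "\<phi> \<in> nonneg_tests" and "0 < \<epsilon>" for \<phi> \<epsilon>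
  proof -
    have "S \<phi> \<epsilon> \<in> \<C>" using that by (auto simp: \<C>_def)
    from w(3)[OF this] obtain y where y: "\<And>n. y n \<in> S \<phi> \<epsilon>" "\<And>n. D (y n) (w n) \<le> 8 / Suc n" by blast
    define v where "v n = y (r n)" for n
    have v: "v n \<in> bounded_fields" "riccati \<phi> (v n) \<le> \<epsilon>" for n
      using y(1)[of "r n"] by (auto simp: v_def S_def)
    obtain k where k: "support \<phi> \<subseteq> K k"
      using K(5)[of "support \<phi>"] \<phi> by (auto simp: nonneg_tests_def test_functions_def)
    have v_u: "sq_mass (K k) (\<lambda>x. v n x - u n x) \<le> 1 / a k * (1 / 4) ^ n" for n
    proof -
      have "D (v n) (u n) \<le> (1 / 4) ^ n" using y(2)[of "r n"] rate[of n] by (simp add: u_def v_def)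
      then have "D (v n) (u n) / a k \<le> (1 / 4) ^ n / a k"
        using a(1)[of k] by (intro divide_right_mono) auto
      then show ?thesis
        using mass_le[OF diff[OF v(1)[of n] u[of n]], of k] by (simp add: D_def)
    qed
    show ?thesis
    proof (rule riccati_lower_semicontinuous[OF g_L2 L2[OF v(1)] \<phi> K(1) K(2) k v(2), where c = "4 / a k"])
      fix n
      have "sq_mass (K k) (\<lambda>x. g x - v n x) \<le> 4 / a k * (1 / 4) ^ n"
        using sq_mass_diff_le[OF g_L2 L2[OF v(1)[of n]] L2[OF u[of n]] K(1)[of k] K(2)[of k]]
          g_u[of k n] v_u[of n] by simp
      then show "(\<integral>x. indicator (K k) x * (norm (g x - v n x))\<^sup>2 \<partial>lebesgue_on \<Omega>) \<le> 4 / a k * (1 / 4) ^ n"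
        by (simp add: sq_mass_def)
    qed
  qed
  have "riccati \<phi> g \<le> 0" if "\<phi> \<in> nonneg_tests" for \<phi>
  proof (rule field_le_epsilon)
    fix e :: real assume "0 < e"
    from le_eps[OF that this] show "riccati \<phi> g \<le> 0 + e" by simp
  qed
  then show ?thesis using g_L2 by blast
qed

end

section \<open>Existence of the field under ellipticity\<close>

text \<open>On a null set containing the exceptional points of \<open>\<Omega>\<close>, and outside \<open>\<Omega>\<close>, \<open>P\<close> is replaced by \<open>m\<close> times the identity, which satisfies the bounds
  once \<open>M\<close> is at least \<open>m\<close>.\<close>

lemma uniformly_elliptic_representative:
  fixes P :: "real^'n \<Rightarrow> real^'n^'n"
  assumes "open \<Omega>" and P: "P \<in> borel_measurable (lebesgue_on \<Omega>)"
    and sym: "AE x in lebesgue_on \<Omega>. \<forall>j k. P x $ j $ k = P x $ k $ j"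
    and ell: "uniformly_elliptic \<Omega> P"
  obtains Q m M where "0 < m" "Q \<in> borel_measurable (lebesgue_on \<Omega>)"
    "AE x in lebesgue_on \<Omega>. Q x = P x" "\<And>x j k. Q x $ j $ k = Q x $ k $ j"
    "\<And>x \<xi>. m * (norm \<xi>)\<^sup>2 \<le> (Q x *v \<xi>) \<bullet> \<xi>" "\<And>x \<xi>. (Q x *v \<xi>) \<bullet> \<xi> \<le> M * (norm \<xi>)\<^sup>2"
proof -
  obtain m M where m: "0 < m" and mM: "AE x in lebesgue_on \<Omega>. \<forall>\<xi>.
     m * (norm \<xi>)\<^sup>2 \<le> (P x *v \<xi>) \<bullet> \<xi> \<and> (P x *v \<xi>) \<bullet> \<xi> \<le> M * (norm \<xi>)\<^sup>2"
    using ell by (auto simp: uniformly_elliptic_def)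
  define good where "good x \<longleftrightarrow> (\<forall>j k. P x $ j $ k = P x $ k $ j) \<and> (\<forall>\<xi>.
     m * (norm \<xi>)\<^sup>2 \<le> (P x *v \<xi>) \<bullet> \<xi> \<and> (P x *v \<xi>) \<bullet> \<xi> \<le> M * (norm \<xi>)\<^sup>2)" for x
  have "AE x in lebesgue_on \<Omega>. good x" using sym mM by eventually_elim (simp add: good_def)
  then obtain Z where Z: "{x \<in> space (lebesgue_on \<Omega>). \<not> good x} \<subseteq> Z" "Z \<in> null_sets (lebesgue_on \<Omega>)"
    by (auto elim!: AE_E simp: null_sets_def)
  define Q where "Q x = (if x \<in> \<Omega> - Z then P x else m *\<^sub>R mat 1)" for x
  have Q: "good x \<and> Q x = P x \<or> Q x = m *\<^sub>R mat 1" for x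
    using Z(1) by (auto simp: Q_def)
  have scalar: "((m *\<^sub>R mat 1) *v \<xi>) \<bullet> \<xi> = m * (norm \<xi>)\<^sup>2" for \<xi> :: "real^'n"
    by (simp add: scaleR_matrix_vector_assoc[symmetric] power2_norm_eq_inner)
  show ?thesis
  proof (rule that[OF m, of Q "max M m"])
    have "{x \<in> space (lebesgue_on \<Omega>). x \<in> \<Omega> - Z} = space (lebesgue_on \<Omega>) - Z" by auto
    then show "Q \<in> borel_measurable (lebesgue_on \<Omega>)"
      unfolding Q_def[abs_def] using Z(2) P
      by (intro measurable_If) auto
    show "AE x in lebesgue_on \<Omega>. Q x = P x"
      using AE_not_in[OF Z(2)] AE_space by eventually_elim (auto simp: Q_def)
    show "Q x $ j $ k = Q x $ k $ j" for x j k
      using Q[of x] by (auto simp: good_def mat_def)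
    show "m * (norm \<xi>)\<^sup>2 \<le> (Q x *v \<xi>) \<bullet> \<xi>" for x \<xi>
      using Q[of x] by (auto simp: good_def scalar)
    show "(Q x *v \<xi>) \<bullet> \<xi> \<le> max M m * (norm \<xi>)\<^sup>2" for x \<xi>
    proof -
      have "M * (norm \<xi>)\<^sup>2 \<le> max M m * (norm \<xi>)\<^sup>2" "m * (norm \<xi>)\<^sup>2 \<le> max M m * (norm \<xi>)\<^sup>2"
        by (intro mult_right_mono; simp)+
      moreover have "(Q x *v \<xi>) \<bullet> \<xi> \<le> M * (norm \<xi>)\<^sup>2 \<or> (Q x *v \<xi>) \<bullet> \<xi> = m * (norm \<xi>)\<^sup>2"
        using Q[of x] by (auto simp: good_def scalar)
      ultimately show ?thesis by linarith
    qed
  qed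
qed

theorem theorem2p2:
  fixes \<Omega> :: "(real^'n) set"
    and A :: "'n distr ^ 'n ^ 'n" and b :: "'n distr ^ 'n" and c \<sigma> :: "'n distr"
    and P :: "real^'n \<Rightarrow> real^'n^'n"
  assumes "open \<Omega>"
    and "\<And>j k. distribution \<Omega> (A $ j $ k)"
    and "\<And>j. distribution \<Omega> (b $ j)"
    and "distribution \<Omega> c"
    and "L1_loc_density \<Omega> (sym_part A) P"
    and "ae_nonneg_definite \<Omega> P"
    and "\<sigma> = (\<lambda>\<phi>. c \<phi> - 1/2 * div_distr b \<phi>)"
  shows "((\<exists>g. g \<in> borel_measurable (lebesgue_on \<Omega>) \<and>
             (\<lambda>x. (P x *v g x) \<bullet> g x) \<in> L1_loc \<Omega> \<and>
             distr_le \<Omega> \<sigma>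
               (\<lambda>\<phi>. div_distr (regular_distr_vec \<Omega> (\<lambda>x. P x *v g x)) \<phi>
                    - regular_distr \<Omega> (\<lambda>x. (P x *v g x) \<bullet> g x) \<phi>))
           \<longrightarrow> minus_L_nonneg_definite \<Omega> A b c)
       \<and> (uniformly_elliptic \<Omega> P \<longrightarrow> minus_L_nonneg_definite \<Omega> A b c \<longrightarrow>
           (\<exists>g. g \<in> L2_loc \<Omega> \<and>
             (\<lambda>x. (P x *v g x) \<bullet> g x) \<in> L1_loc \<Omega> \<and>
             distr_le \<Omega> \<sigma>
               (\<lambda>\<phi>. div_distr (regular_distr_vec \<Omega> (\<lambda>x. P x *v g x)) \<phi>
                    - regular_distr \<Omega> (\<lambda>x. (P x *v g x) \<bullet> g x) \<phi>)))"
proof -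
  have P: "P \<in> L1_loc \<Omega>" using assms(5) by (simp add: L1_loc_density_def)
  note sym = L1_loc_density_symmetric[OF assms(1,5)]
  have nn: "AE x in lebesgue_on \<Omega>. \<forall>\<xi>. 0 \<le> (P x *v \<xi>) \<bullet> \<xi>"
    using assms(6) by (simp add: ae_nonneg_definite_def)
  note lin = assms(2-4)[THEN distribution_imp_test_linear]
  have \<sigma>_lin: "test_linear \<Omega> \<sigma>"
    unfolding assms(7) by (intro test_linear_diff_div lin)
  have int: "integrable (lebesgue_on \<Omega>) (\<lambda>x. (P x *v gradient h x) \<bullet> gradient h x)"
    and diag: "- L_form A b c h h = (\<integral>x. (P x *v gradient h x) \<bullet> gradient h x \<partial>lebesgue_on \<Omega>)
      - \<sigma> (\<lambda>x. (h x)\<^sup>2)" if "h \<in> test_functions \<Omega>" for h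
    using L_form_diagonal[OF assms(1) lin(1,2) assms(5) that] by (simp_all add: assms(7))
  have nonneg_iff: "minus_L_nonneg_definite \<Omega> A b c \<longleftrightarrow> (\<forall>h\<in>test_functions \<Omega>.
      \<sigma> (\<lambda>x. (h x)\<^sup>2) \<le> (\<integral>x. (P x *v gradient h x) \<bullet> gradient h x \<partial>lebesgue_on \<Omega>))"
    by (simp add: minus_L_nonneg_definite_def diag)
  show ?thesis
  proof (intro conjI impI)
    assume "\<exists>g. g \<in> borel_measurable (lebesgue_on \<Omega>) \<and>
             (\<lambda>x. (P x *v g x) \<bullet> g x) \<in> L1_loc \<Omega> \<and>
             distr_le \<Omega> \<sigma>
               (\<lambda>\<phi>. div_distr (regular_distr_vec \<Omega> (\<lambda>x. P x *v g x)) \<phi>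
                    - regular_distr \<Omega> (\<lambda>x. (P x *v g x) \<bullet> g x) \<phi>)"
    then obtain g where g: "g \<in> borel_measurable (lebesgue_on \<Omega>)" "(\<lambda>x. (P x *v g x) \<bullet> g x) \<in> L1_loc \<Omega>"
      and le: "distr_le \<Omega> \<sigma> (\<lambda>\<phi>. div_distr (regular_distr_vec \<Omega> (\<lambda>x. P x *v g x)) \<phi>
                    - regular_distr \<Omega> (\<lambda>x. (P x *v g x) \<bullet> g x) \<phi>)" by blast
    show "minus_L_nonneg_definite \<Omega> A b c"
      unfolding nonneg_iff
    proof
      fix h assume h: "h \<in> test_functions \<Omega>"
      show "\<sigma> (\<lambda>x. (h x)\<^sup>2) \<le> (\<integral>x. (P x *v gradient h x) \<bullet> gradient h x \<partial>lebesgue_on \<Omega>)"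
        by (rule nonneg_definite_if_riccati[OF assms(1) P sym nn g h int[OF h]])
           (use le test_functions_power2[OF h] in \<open>auto simp: distr_le_def\<close>)
    qed
  next
    assume ell: "uniformly_elliptic \<Omega> P" and nonneg: "minus_L_nonneg_definite \<Omega> A b c"
    have Pm: "P \<in> borel_measurable (lebesgue_on \<Omega>)" by (rule L1_loc_borel_measurable[OF assms(1) P])
    obtain Q m M where Q: "0 < m" "Q \<in> borel_measurable (lebesgue_on \<Omega>)"
      "AE x in lebesgue_on \<Omega>. Q x = P x" "\<And>x j k. Q x $ j $ k = Q x $ k $ j"
      "\<And>x \<xi>. m * (norm \<xi>)\<^sup>2 \<le> (Q x *v \<xi>) \<bullet> \<xi>" "\<And>x \<xi>. (Q x *v \<xi>) \<bullet> \<xi> \<le> M * (norm \<xi>)\<^sup>2"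
      by (rule uniformly_elliptic_representative[OF assms(1) Pm sym ell]) (rule that)
    have form_eq: "(\<integral>x. (Q x *v gradient h x) \<bullet> gradient h x \<partial>lebesgue_on \<Omega>)
        = (\<integral>x. (P x *v gradient h x) \<bullet> gradient h x \<partial>lebesgue_on \<Omega>)" if h: "h \<in> test_functions \<Omega>" for h
    proof (rule integral_cong_AE)
      show "AE x in lebesgue_on \<Omega>. (Q x *v gradient h x) \<bullet> gradient h x = (P x *v gradient h x) \<bullet> gradient h x"
        using Q(3) by eventually_elim simp
    qed (intro borel_measurable_matrix_form Q(2) Pm borel_measurable_gradient[OF h])+
    have Q_nonneg_form: "\<sigma> (\<lambda>x. (h x)\<^sup>2) \<le> (\<integral>x. (Q x *v gradient h x) \<bullet> gradient h x \<partial>lebesgue_on \<Omega>)"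
      if "h \<in> test_functions \<Omega>" for h
      using nonneg that unfolding nonneg_iff by (simp add: form_eq)
    interpret coercive_form \<Omega> Q m M \<sigma>
      by (rule coercive_form.intro[OF assms(1) Q(2,4,1,5,6) \<sigma>_lin Q_nonneg_form])
    obtain g where g: "g \<in> L2_loc \<Omega>" and ric: "\<And>\<phi>. \<phi> \<in> nonneg_tests \<Longrightarrow> riccati \<phi> g \<le> 0"
      using riccati_field_exists by blast
    have gm: "g \<in> borel_measurable (lebesgue_on \<Omega>)" by (rule L2_locD(1)[OF g])
    have Pgg: "(\<lambda>x. (P x *v g x) \<bullet> g x) \<in> L1_loc \<Omega>"
    proof (rule L1_loc_dominated[OF assms(1)])
      show "(\<lambda>x. (P x *v g x) \<bullet> g x) \<in> borel_measurable (lebesgue_on \<Omega>)"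
        by (intro borel_measurable_matrix_form Pm gm)
      show "(\<lambda>x. M * (norm (g x))\<^sup>2) \<in> L1_loc \<Omega>" by (intro L1_loc_cmult L2_locD g)
      show "AE x in lebesgue_on \<Omega>. \<bar>(P x *v g x) \<bullet> g x\<bar> \<le> M * (norm (g x))\<^sup>2"
        using Q(3) by eventually_elim (metis Q_nonneg Q_upper abs_of_nonneg)
    qed
    have "distr_le \<Omega> \<sigma> (\<lambda>\<phi>. div_distr (regular_distr_vec \<Omega> (\<lambda>x. P x *v g x)) \<phi>
                    - regular_distr \<Omega> (\<lambda>x. (P x *v g x) \<bullet> g x) \<phi>)"
      unfolding distr_le_def
    proof (intro ballI impI)
      fix \<phi> assume \<phi>: "\<phi> \<in> test_functions \<Omega>" "\<forall>x. 0 \<le> \<phi> x"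
      note flux = div_distr_flux[OF assms(1) P sym nn gm Pgg \<phi>(1)]
      have i: "integrable (lebesgue_on \<Omega>) (\<lambda>x. (P x *v g x) \<bullet> g x * \<phi> x)"
        by (rule L1_loc_times_test_function_integrable[OF assms(1) Pgg \<phi>(1)])
      have "(\<integral>x. riccati_density \<phi> g x \<partial>lebesgue_on \<Omega>)
          = (\<integral>x. (P x *v g x) \<bullet> gradient \<phi> x + (P x *v g x) \<bullet> g x * \<phi> x \<partial>lebesgue_on \<Omega>)"
      proof (rule integral_cong_AE)
        show "riccati_density \<phi> g \<in> borel_measurable (lebesgue_on \<Omega>)"
          using riccati_density_integrable[OF g \<phi>(1)] by simp
        show "(\<lambda>x. (P x *v g x) \<bullet> gradient \<phi> x + (P x *v g x) \<bullet> g x * \<phi> x) \<in> borel_measurable (lebesgue_on \<Omega>)"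
          using flux(1) i by auto
        show "AE x in lebesgue_on \<Omega>. riccati_density \<phi> g x
            = (P x *v g x) \<bullet> gradient \<phi> x + (P x *v g x) \<bullet> g x * \<phi> x"
          using Q(3) by eventually_elim (simp add: riccati_density_def)
      qed
      also have "\<dots> = (\<integral>x. (P x *v g x) \<bullet> gradient \<phi> x \<partial>lebesgue_on \<Omega>)
          + (\<integral>x. (P x *v g x) \<bullet> g x * \<phi> x \<partial>lebesgue_on \<Omega>)"
        by (rule Bochner_Integration.integral_add[OF flux(1) i])
      finally show "0 \<le> div_distr (regular_distr_vec \<Omega> (\<lambda>x. P x *v g x)) \<phi>
                    - regular_distr \<Omega> (\<lambda>x. (P x *v g x) \<bullet> g x) \<phi> - \<sigma> \<phi>"
        using ric[of \<phi>] \<phi> by (simp add: riccati_def nonneg_tests_def flux(2) regular_distr_eq[OF assms(1)])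
    qed
    with g Pgg show "\<exists>g. g \<in> L2_loc \<Omega> \<and>
             (\<lambda>x. (P x *v g x) \<bullet> g x) \<in> L1_loc \<Omega> \<and>
             distr_le \<Omega> \<sigma>
               (\<lambda>\<phi>. div_distr (regular_distr_vec \<Omega> (\<lambda>x. P x *v g x)) \<phi>
                    - regular_distr \<Omega> (\<lambda>x. (P x *v g x) \<bullet> g x) \<phi>)" by blast
  qed
qed

end
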